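(* There exist constants $c>0$ and $m_0\ge 3$ such that the following holds for every integer $m\ge m_0$. Let $$\mathscr{C}_m=\left\{(\tilde u_m(s),\tilde\Omega_m(s))\in C^2(\mathbb{T})\times\left(0,\tfrac12\right):\ 0\le s<\infty\right\}$$ be a continuous curve (i.e. $s\mapsto(\tilde u_m(s),\tilde\Omega_m(s))$ is continuous from $[0,\infty)$ to $C^2(\mathbb{T})\times(0,\frac12)$) satisfying: (A1) for every $s\ge0$, $\tilde u_m(s)$ belongs to the set of $u\in C^2(\mathbb{T})$ with $u>-1$ and $u(\theta)=\sum_{n=1}^\infty a_n\cos(nm\theta)$ for some real sequence $(a_n)_{n\ge1}$; (A2) for every $s\ge0$, $(D^{\tilde u_m(s)},\tilde\Omega_m(s))$ is a rotating-patch solution, where $D^u:=\{r(\cos\theta,\sin\theta)\in\mathbb{R}^2:\ 0\le r<1+u(\theta),\ \theta\in\mathbb{T}\}$; (A3) for every $s>0$, the function $u=\tilde u_m(s)$ satisfies $\partial_\theta u(\theta)<0$ for all $\theta\in(0,\frac{\pi}{m})$; (A4) $(\tilde u_m(0),\tilde\Omega_m(0))=\left(0,\frac{m-1}{2m}\right)$. Then $$\|\tilde u_m(s)\|_{L^\infty(\mathbb{T})}\le\frac{c}{m}\qquad\text{for all } s\ge0.$$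
   Context: $\mathbb{T}=\mathbb{R}/2\pi\mathbb{Z}$. Let $\mathcal{N}(x)=\frac1{2\pi}\log|x|$ be the Newtonian potential in $\mathbb{R}^2$. For a bounded domain $D\subset\mathbb{R}^2$ and $\Omega\in\mathbb{R}$, the pair $(D,\Omega)$ is called a rotating-patch solution if the function $\Psi(x)=(1_D*\mathcal{N})(x)-\frac{\Omega}{2}|x|^2$ is constant on $\partial D$ (one constant on all of $\partial D$). *)

theory Defs
  imports "HOL-Analysis.Analysis" "HOL-Probability.Essential_Supremum"
begin

text \<open>Functions on the torus \<open>\<real>/2\<pi>\<int>\<close> are represented by \<open>2\<pi>\<close>-periodic functions on \<open>\<real>\<close>.\<close>

definition C2_torus :: "(real \<Rightarrow> real) set" where
  "C2_torus = {u. (\<forall>\<theta>. u (\<theta> + 2 * pi) = u \<theta>) \<and>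
     (\<forall>\<theta>. u differentiable (at \<theta>)) \<and>
     (\<forall>\<theta>. deriv u differentiable (at \<theta>)) \<and>
     continuous_on UNIV (deriv (deriv u))}"

text \<open>For \<open>u \<in> C2_torus\<close> the three suprema are over bounded sets; the norm is meaningless
  for other functions.\<close>

definition C2_norm :: "(real \<Rightarrow> real) \<Rightarrow> real" where
  "C2_norm u = (SUP \<theta>. \<bar>u \<theta>\<bar>) + (SUP \<theta>. \<bar>deriv u \<theta>\<bar>) + (SUP \<theta>. \<bar>deriv (deriv u) \<theta>\<bar>)"

definition C2_continuous_on :: "real set \<Rightarrow> (real \<Rightarrow> real \<Rightarrow> real) \<Rightarrow> bool" where
  "C2_continuous_on S U \<longleftrightarrow>
     (\<forall>s\<in>S. ((\<lambda>t. C2_norm (\<lambda>\<theta>. U t \<theta> - U s \<theta>)) \<longlongrightarrow> 0) (at s within S))"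

definition Linfty_norm :: "(real \<Rightarrow> real) \<Rightarrow> ereal" where
  "Linfty_norm u = esssup (lebesgue_on {0..2 * pi}) (\<lambda>\<theta>. ereal \<bar>u \<theta>\<bar>)"

definition admissible :: "nat \<Rightarrow> (real \<Rightarrow> real) set" where
  "admissible m = {u \<in> C2_torus. (\<forall>\<theta>. u \<theta> > -1) \<and>
     (\<exists>a :: nat \<Rightarrow> real. \<forall>\<theta>.
        (\<lambda>n. a (Suc n) * cos (real (Suc n) * real m * \<theta>)) sums u \<theta>)}"

definition newtonian :: "real ^ 2 \<Rightarrow> real" where
  "newtonian x = ln (norm x) / (2 * pi)"

text \<open>For bounded measurable \<open>D\<close> the convolution integral converges absolutely for every \<open>x\<close>;
  the value of \<open>newtonian\<close> at the origin is irrelevant.\<close>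

definition stream :: "(real ^ 2) set \<Rightarrow> real \<Rightarrow> real ^ 2 \<Rightarrow> real" where
  "stream D \<Omega> x =
     (LINT y|lborel. indicator D y * newtonian (x - y)) - \<Omega> / 2 * (norm x)\<^sup>2"

definition rotating_patch :: "(real ^ 2) set \<Rightarrow> real \<Rightarrow> bool" where
  "rotating_patch D \<Omega> \<longleftrightarrow>
     open D \<and> connected D \<and> D \<noteq> {} \<and> bounded D \<and>
     stream D \<Omega> constant_on frontier D"

definition polar_domain :: "(real \<Rightarrow> real) \<Rightarrow> (real ^ 2) set" where
  "polar_domain u =
     {r *\<^sub>R vector [cos \<theta>, sin \<theta>] | r \<theta>. 0 \<le> r \<and> r < 1 + u \<theta>}"

end

theory Submission
  imports Defs "HOL-Complex_Analysis.Complex_Analysis" "HOL-Real_Asymp.Real_Asymp"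
begin

text \<open>
  Let \<open>\<Psi>\<close> be the relative stream function of a patch \<open>D\<close> with inner and outer radius \<open>R1 < R2\<close>, let \<open>C\<close> be
  its boundary value and \<open>e = (1 - 2\<Omega>)/4\<close>. Averaging over the \<open>m\<close> rotations that preserve \<open>D\<close> turns
  \<open>ln |x - y|\<close> into \<open>ln |x^m - y^m| / m = ln max |x| |y| + ln |1 - t w| / m\<close> with \<open>t < 1\<close> and \<open>|w| = 1\<close>. The
  last term has mean zero on circles, so that \<open>\<Psi>\<close> lies below its circular mean \<open>H\<close> on the axis of a
  finger of \<open>D\<close> and above it on the axis between two fingers.

  Put \<open>q = exp (100/m)\<close> and suppose \<open>R2 = R1 q^34\<close>. Let \<open>\<nu>\<close> be the fraction of the circle of radius
  \<open>r2 = R1 q^2\<close> that lies outside \<open>D\<close>, and let \<open>r1 = R1 q\<close>. Since \<open>\<Psi> = C\<close> at the tip and at the root of a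
  finger, \<open>H R1 \<le> H R2\<close>; as at least the fraction \<open>\<nu>\<close> of the annulus between \<open>r2\<close> and \<open>R2\<close> is missing from
  \<open>D\<close>, this bounds \<open>e\<close> from below by a multiple of \<open>\<nu>/m\<close>. Conversely \<open>H r2 - H r1\<close> is almost
  \<open>e (r2^2 - r1^2)\<close>, but \<open>\<Psi>\<close> exceeds \<open>C\<close> by \<open>O(\<nu>/m^2)\<close> only between the fingers at radius \<open>r2\<close>, and on the
  axis of a finger \<open>C - \<Psi>\<close> has decayed at radius \<open>r1\<close> by the minimum principle with the barrier
  \<open>Re (x powi - (m/4))\<close>. This bounds \<open>e\<close> from above by a smaller multiple of \<open>\<nu>/m\<close>, a contradiction.

  Hence \<open>R2/R1\<close>, which equals \<open>1\<close> at the start of the curve, never reaches \<open>exp (3400/m)\<close>. A cosine series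
  without constant term has a zero, so \<open>R1 \<le> 1 \<le> R2\<close> and \<open>u = O(1/m)\<close>.
\<close>

unbundle no fps_syntax

section \<open>Polar coordinates\<close>

text \<open>The obstacle is that \<open>e\<close> has no positive lower bound: \<Omega> may approach
  1/2, where \<Psi> becomes harmonic in the patch. Every error term must therefore carry a factor
  \<open>e\<close> or \<nu>, and two inequalities in opposite directions eliminate these two unknown
  small quantities. The sign of \<Psi> - H rests on nested arcs: the patch cuts each circle, after
  folding its m sectors into one, in an arc about the finger axis, and ln |1 - t w| is negative on
  an arc about the same axis. Origin of the exponents: put \<eta> = 100/m and R2 = R1 q^N. The
  missing area at the tip times the logarithmic width gives a term quadratic in N, while the
  right-hand side is linear, so that to leading order \<nu> \<eta> is at most 8 N / (N - 2)^2 times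
  \<open>e\<close>. The intermediate radius R1 q^((N + 2)/2) is the best one to leading order. For N
  = 34 the factor is below 0.27, small enough for the estimate at the root. The number 100 makes the
  barrier decay by about exp (-25) between R1 and r1, and m \<ge> 10^7 makes \<eta>^2 negligible
  against \<eta>.\<close>

lemma vec2_eq_axis: "(vector [x, y] :: real^2) = x *\<^sub>R axis 1 1 + y *\<^sub>R axis 2 1"
  by (simp add: vec_eq_iff forall_2 axis_def)

lemma measurable_vec2 [measurable]:
  "(\<lambda>p. vector [fst p, snd p] :: real^2) \<in> borel \<Otimes>\<^sub>M borel \<rightarrow>\<^sub>M borel"
  unfolding vec2_eq_axis by measurable

lemma measurable_Complex_pair [measurable]:
  "(\<lambda>p. Complex (fst p) (snd p)) \<in> borel \<Otimes>\<^sub>M borel \<rightarrow>\<^sub>M borel"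
  unfolding Complex_eq by measurable

lemma lborel_vec2_eq_distr:
  "(lborel :: (real^2) measure) = distr (lborel \<Otimes>\<^sub>M lborel) borel (\<lambda>p. vector [fst p, snd p])"
proof (rule lborel_eqI)
  fix l u :: "real^2"
  assume lu: "\<And>b. b \<in> Basis \<Longrightarrow> l \<bullet> b \<le> u \<bullet> b"
  have B: "(Basis :: (real^2) set) = {axis 1 1, axis 2 1}"
    by (auto simp: Basis_vec_def UNIV_2)
  have ne: "axis 1 1 \<noteq> (axis 2 1 :: real^2)"
    by (simp add: axis_eq_axis)
  have "(\<lambda>p. vector [fst p, snd p] :: real^2) -` box l u \<inter> space (lborel \<Otimes>\<^sub>M lborel)
    = {l$1<..<u$1} \<times> {l$2<..<u$2}"
    by (auto simp: mem_box_cart forall_2 space_pair_measure)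
  then have "emeasure (distr (lborel \<Otimes>\<^sub>M lborel) borel (\<lambda>p. vector [fst p, snd p] :: real^2)) (box l u)
    = emeasure (lborel \<Otimes>\<^sub>M lborel) ({l$1<..<u$1} \<times> {l$2<..<u$2})"
    by (subst emeasure_distr) auto
  also have "\<dots> = ennreal (u$1 - l$1) * ennreal (u$2 - l$2)"
    using lu[of "axis 1 1"] lu[of "axis 2 1"]
    by (subst lborel.emeasure_pair_measure_Times) (auto simp: B inner_axis)
  also have "\<dots> = ennreal (\<Prod>b\<in>Basis. (u - l) \<bullet> b)"
    using lu[of "axis 1 1"] lu[of "axis 2 1"] ne by (simp add: B inner_axis ennreal_mult)
  finally show "emeasure (distr (lborel \<Otimes>\<^sub>M lborel) borel (\<lambda>p. vector [fst p, snd p])) (box l u)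
    = ennreal (\<Prod>b\<in>Basis. (u - l) \<bullet> b)" .
qed simp

lemma lborel_complex_eq_distr:
  "(lborel :: complex measure) = distr (lborel \<Otimes>\<^sub>M lborel) borel (\<lambda>p. Complex (fst p) (snd p))"
proof (rule lborel_eqI)
  fix l u :: complex
  assume lu: "\<And>b. b \<in> Basis \<Longrightarrow> l \<bullet> b \<le> u \<bullet> b"
  have "(\<lambda>p. Complex (fst p) (snd p)) -` box l u \<inter> space (lborel \<Otimes>\<^sub>M lborel)
    = {Re l<..<Re u} \<times> {Im l<..<Im u}"
    by (auto simp: box_def Basis_complex_def space_pair_measure)
  then have "emeasure (distr (lborel \<Otimes>\<^sub>M lborel) borel (\<lambda>p. Complex (fst p) (snd p))) (box l u)
    = emeasure (lborel \<Otimes>\<^sub>M lborel) ({Re l<..<Re u} \<times> {Im l<..<Im u})"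
    by (subst emeasure_distr) auto
  also have "\<dots> = ennreal (Re u - Re l) * ennreal (Im u - Im l)"
    using lu[of 1] lu[of \<i>]
    by (subst lborel.emeasure_pair_measure_Times) (auto simp: Basis_complex_def)
  also have "\<dots> = ennreal (\<Prod>b\<in>Basis. (u - l) \<bullet> b)"
    using lu[of 1] lu[of \<i>] by (simp add: Basis_complex_def ennreal_mult)
  finally show "emeasure (distr (lborel \<Otimes>\<^sub>M lborel) borel (\<lambda>p. Complex (fst p) (snd p))) (box l u)
    = ennreal (\<Prod>b\<in>Basis. (u - l) \<bullet> b)" .
qed simp

text \<open>The patch is given in \<open>real^2\<close>, but averaging over roots of unity and the
  mean value property of holomorphic functions call for complex numbers.\<close>

definition vec_of_complex :: "complex \<Rightarrow> real^2" where
  "vec_of_complex z = vector [Re z, Im z]"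

lemma vec_of_complex_eq_axis: "vec_of_complex z = Re z *\<^sub>R axis 1 1 + Im z *\<^sub>R axis 2 1"
  unfolding vec_of_complex_def by (rule vec2_eq_axis)

lemma vec_of_complex_eq_iff [simp]: "vec_of_complex x = vec_of_complex y \<longleftrightarrow> x = y"
  by (auto simp: vec_of_complex_def vec_eq_iff forall_2 complex_eq_iff)

lemma measurable_vec_of_complex [measurable]: "vec_of_complex \<in> borel \<rightarrow>\<^sub>M borel"
  unfolding vec_of_complex_eq_axis by measurable

lemma lborel_vec2_eq_distr_complex:
  "(lborel :: (real^2) measure) = distr lborel borel vec_of_complex"
  unfolding lborel_complex_eq_distr
  by (subst distr_distr) (simp_all add: lborel_vec2_eq_distr comp_def vec_of_complex_def)

text \<open>Arc length on the unit circle, of total mass 2 pi, regarded as a Borel measure on the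
  plane so that rotations and powers of complex numbers act on it directly.\<close>

definition circ :: "complex measure" where
  "circ = distr (density lborel (indicator {0..2 * pi})) borel cis"

text \<open>\<^const>\<open>ennreal\<close> sends negative numbers to \<open>0\<close>, so \<open>rad\<close> is \<open>\<rho> d\<rho>\<close> on the half line.\<close>

definition rad :: "real measure" where
  "rad = density lborel ennreal"

lemma measurable_cis [measurable]: "cis \<in> borel \<rightarrow>\<^sub>M borel"
  by (intro borel_measurable_continuous_onI continuous_intros)

lemma sets_circ [measurable_cong, simp]: "sets circ = sets borel"
  by (simp add: circ_def)

lemma space_circ [simp]: "space circ = UNIV"
  by (simp add: circ_def)

lemma sets_rad [measurable_cong, simp]: "sets rad = sets borel"
  by (simp add: rad_def)

lemma space_rad [simp]: "space rad = UNIV"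
  by (simp add: rad_def)

lemma nn_integral_circ:
  assumes [measurable]: "f \<in> borel_measurable borel"
  shows "(\<integral>\<^sup>+w. f w \<partial>circ) = (\<integral>\<^sup>+\<theta>. f (cis \<theta>) * indicator {0..2 * pi} \<theta> \<partial>lborel)"
  unfolding circ_def by (simp add: nn_integral_distr nn_integral_density mult.commute)

lemma emeasure_circ_space: "emeasure circ UNIV = ennreal (2 * pi)"
  using nn_integral_circ[of "\<lambda>_. 1"] by (simp add: emeasure_eq_AE)

lemma nn_integral_rad:
  assumes [measurable]: "f \<in> borel_measurable borel"
  shows "(\<integral>\<^sup>+\<rho>. f \<rho> \<partial>rad) = (\<integral>\<^sup>+\<rho>. ennreal \<rho> * f \<rho> \<partial>lborel)"
  unfolding rad_def by (simp add: nn_integral_density)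

interpretation circ: finite_measure circ
  by (rule finite_measureI) (simp add: emeasure_circ_space)

interpretation rad: sigma_finite_measure rad
  unfolding rad_def
  by (subst sigma_finite_measure.sigma_finite_iff_density_finite) (auto simp: lborel.sigma_finite_measure_axioms)

lemma emeasure_complex_polar:
  assumes A: "A \<in> sets borel" "bounded A"
  shows "emeasure lborel (A :: complex set) =
    (\<integral>\<^sup>+\<rho>. \<integral>\<^sup>+\<theta>. ennreal \<rho> * indicator A (of_real \<rho> * cis \<theta>) * indicator {0..2*pi} \<theta> \<partial>lborel \<partial>lborel)"
proof -
  define g :: "real^2 \<Rightarrow> real^2" where "g = (\<lambda>p. vector [p$1 * cos (p$2), p$1 * sin (p$2)])"
  define g' :: "real^2 \<Rightarrow> real^2 \<Rightarrow> real^2" where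
    "g' = (\<lambda>p h. vector [h$1 * cos (p$2) - p$1 * sin (p$2) * h$2, h$1 * sin (p$2) + p$1 * cos (p$2) * h$2])"
  define S :: "(real^2) set" where "S = {p. 0 < p$1 \<and> 0 < p$2 \<and> p$2 < 2 * pi}"
  define B where "B = vec_of_complex ` A"
  define T where "T = {p \<in> S. g p \<in> B}"
  define N :: "(real^2) set" where "N = {x. x $ 2 = 0}"
  have B_vimage: "B = {x. Complex (x$1) (x$2) \<in> A}"
    by (force simp: B_def vec_of_complex_def image_iff vec_eq_iff forall_2 intro: bexI[of _ "Complex _ _"])
  have [measurable]: "B \<in> sets borel"
  proof -
    have "(\<lambda>x::real^2. Complex (x$1) (x$2)) \<in> borel_measurable borel"
      unfolding Complex_eq by (intro borel_measurable_continuous_onI continuous_intros)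
    from measurable_sets[OF this A(1)] show ?thesis by (simp add: B_vimage vimage_def)
  qed
  have "bounded B"
    unfolding B_def by (rule bounded_linear_image[OF A(2)])
      (simp add: bounded_linear_add bounded_linear_scaleR_const bounded_linear_Re bounded_linear_Im vec_of_complex_eq_axis[abs_def])
  then have B_fin: "emeasure lborel B < \<infinity>"
    by (rule emeasure_bounded_finite)
  then have B_meas: "B \<in> lmeasurable"
    by (intro fmeasurableI) auto
  have der: "(g has_derivative g' p) (at p within S)" for p
    unfolding g_def g'_def vec2_eq_axis
    by (auto intro!: derivative_eq_intros bounded_linear.has_derivative[OF bounded_linear_vec_nth] simp: algebra_simps scaleR_add_left)
  have inj: "inj_on g S"
  proof (rule inj_onI)
    fix p q assume pq: "p \<in> S" "q \<in> S" "g p = g q"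
    then have eq: "p$1 * cos (p$2) = q$1 * cos (q$2)" "p$1 * sin (p$2) = q$1 * sin (q$2)"
      by (auto simp: g_def vec_eq_iff forall_2)
    then have rc: "rcis (p$1) (p$2) = rcis (q$1) (q$2)"
      by (simp add: complex_eq_iff)
    have "p$1 = q$1"
      using arg_cong[OF rc, of cmod] pq by (simp add: S_def)
    moreover have "p$2 = q$2"
    proof -
      have "Arg2pi (rcis (x$1) (x$2)) = x$2" if "x \<in> S" for x :: "real^2"
        using that by (intro Arg2pi_unique[of "x$1"]) (auto simp: S_def rcis_def cis_conv_exp mult.commute)
      then show ?thesis using pq rc by metis
    qed
    ultimately show "p = q" by (simp add: vec_eq_iff forall_2)
  qed
  have img: "g ` S \<supseteq> - N"
  proof
    fix x :: "real^2" assume "x \<in> - N"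
    then have x2: "x $ 2 \<noteq> 0" by (simp add: N_def)
    define z where "z = Complex (x$1) (x$2)"
    have "z \<noteq> 0" using x2 by (auto simp: z_def complex_eq_iff)
    have z: "z = of_real (cmod z) * cis (Arg2pi z)"
      using Arg2pi[of z] by (simp add: cis_conv_exp is_Arg_def)
    have "Arg2pi z \<noteq> 0"
      using x2 Arg2pi_eq_0[of z] by (auto simp: z_def complex_is_Real_iff)
    then have "vector [cmod z, Arg2pi z] \<in> S"
      using \<open>z \<noteq> 0\<close> Arg2pi[of z] by (auto simp: S_def less_le)
    moreover have "g (vector [cmod z, Arg2pi z]) = x"
      using z by (auto simp: g_def vec_eq_iff forall_2 complex_eq_iff z_def)
    ultimately show "x \<in> g ` S" by (metis image_eqI)
  qed
  have negl: "negligible N"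
    unfolding N_def using negligible_standard_hyperplane_cart[of 2] by simp
  have open_S: "open S"
    unfolding S_def by (intro open_Collect_conj open_Collect_less continuous_intros)
  have g_meas [measurable]: "g \<in> borel_measurable borel"
    unfolding g_def vec2_eq_axis by (intro borel_measurable_continuous_onI continuous_intros)
  have S_meas [measurable]: "S \<in> sets borel"
    using open_S by simp
  have T_meas [measurable]: "T \<in> sets borel"
  proof -
    have "T = S \<inter> (g -` B \<inter> space borel)" by (auto simp: T_def)
    then show ?thesis using measurable_sets[OF g_meas \<open>B \<in> sets borel\<close>] by simp
  qed
  have "negligible (B - g ` T \<union> (g ` T - B))"
    by (rule negligible_subset[OF negl]) (use img in \<open>auto simp: T_def\<close>)
  then have gT: "g ` T \<in> lmeasurable \<and> measure lebesgue (g ` T) = measure lebesgue B"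
    using B_meas measure_negligible_symdiff lmeasurable_negligible_symdiff by blast
  have det: "\<bar>det (matrix (g' x))\<bar> = x$1" if "x \<in> S" for x
  proof -
    have "det (matrix (g' x)) = cos (x$2) * (x$1 * cos (x$2)) + x$1 * sin (x$2) * sin (x$2)"
      by (simp add: det_2 matrix_def g'_def axis_def)
    also have "\<dots> = x$1 * (cos (x$2) * cos (x$2) + sin (x$2) * sin (x$2))"
      by (simp only: algebra_simps)
    finally have "det (matrix (g' x)) = x$1"
      by (simp only: sin_cos_squared_add3 mult_1_right)
    then show ?thesis using that by (simp add: S_def)
  qed
  have "((\<lambda>x. \<bar>det (matrix (g' x))\<bar>) has_integral measure lebesgue B) T"
  proof (subst has_measure_differentiable_image[of T g g', symmetric])
    have "T \<subseteq> S" by (auto simp: T_def)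
    then show "inj_on g T" "\<And>x. (g has_derivative g' x) (at x within T)"
      using inj_on_subset[OF inj] has_derivative_subset[OF der] by blast+
  qed (use gT in auto)
  moreover have "\<bar>det (matrix (g' x))\<bar> = x$1" if "x \<in> T" for x
    using that det by (simp add: T_def)
  ultimately have "((\<lambda>x. x$1) has_integral measure lebesgue B) T"
    by (subst has_integral_cong[of T _ "\<lambda>x. \<bar>det (matrix (g' x))\<bar>"]) auto
  then have "(\<integral>\<^sup>+x\<in>T. ennreal (x$1) \<partial>lborel) = ennreal (measure lebesgue B)"
    by (intro nn_integral_has_integral_lebesgue') (auto simp: S_def T_def)
  also have "\<dots> = emeasure lborel B"
    using B_fin by (simp add: emeasure_eq_ennreal_measure measure_completion)
  also have "\<dots> = emeasure lborel A"
  proof -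
    have "vec_of_complex -` B = A"
      by (auto simp: B_def)
    then show ?thesis
      by (simp add: lborel_vec2_eq_distr_complex emeasure_distr)
  qed
  finally have "emeasure lborel A = (\<integral>\<^sup>+x. ennreal (x$1) * indicator T x \<partial>lborel)"
    by simp
  also have "\<dots> = (\<integral>\<^sup>+p. ennreal (fst p) * indicator T (vector [fst p, snd p]) \<partial>(lborel \<Otimes>\<^sub>M lborel))"
    unfolding lborel_vec2_eq_distr
    by (subst nn_integral_distr) auto
  also have "\<dots> = (\<integral>\<^sup>+\<rho>. \<integral>\<^sup>+\<theta>. ennreal \<rho> * indicator T (vector [\<rho>, \<theta>]) \<partial>lborel \<partial>lborel)"
    by (subst lborel.nn_integral_fst[symmetric]) auto
  also have "\<dots> = (\<integral>\<^sup>+\<rho>. \<integral>\<^sup>+\<theta>. ennreal \<rho> * indicator A (of_real \<rho> * cis \<theta>) * indicator {0..2*pi} \<theta> \<partial>lborel \<partial>lborel)"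
  proof (rule nn_integral_cong, rule nn_integral_cong_AE)
    fix \<rho> :: real
    have "AE \<theta> in lborel. \<theta> \<noteq> 0" "AE \<theta> in lborel. \<theta> \<noteq> 2 * pi"
      by (rule AE_lborel_singleton)+
    then show "AE \<theta> in lborel. ennreal \<rho> * indicator T (vector [\<rho>, \<theta>]) =
      ennreal \<rho> * indicator A (of_real \<rho> * cis \<theta>) * indicator {0..2*pi} \<theta>"
    proof eventually_elim
      case (elim \<theta>)
      have "Complex (\<rho> * cos \<theta>) (\<rho> * sin \<theta>) = of_real \<rho> * cis \<theta>"
        by (simp add: complex_eq_iff)
      then have "g (vector [\<rho>, \<theta>]) \<in> B \<longleftrightarrow> of_real \<rho> * cis \<theta> \<in> A"
        by (simp add: B_vimage g_def)
      then show ?case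
        using elim by (auto simp: T_def S_def indicator_def ennreal_neg not_less)
    qed
  qed
  finally show ?thesis .
qed

text \<open>A measure that gives every box its volume is Lebesgue measure, and boxes are bounded, as
  the area formula in polar coordinates requires.\<close>

theorem lborel_complex_polar:
  "(lborel :: complex measure) = distr (rad \<Otimes>\<^sub>M circ) borel (\<lambda>p. of_real (fst p) * snd p)"
proof (rule lborel_eqI)
  fix l u :: complex
  assume lu: "\<And>b. b \<in> Basis \<Longrightarrow> l \<bullet> b \<le> u \<bullet> b"
  let ?A = "box l u"
  have "emeasure (distr (rad \<Otimes>\<^sub>M circ) borel (\<lambda>p. of_real (fst p) * snd p)) ?A
    = (\<integral>\<^sup>+p. indicator ?A (of_real (fst p) * snd p) \<partial>(rad \<Otimes>\<^sub>M circ))"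
    by (subst nn_integral_indicator[symmetric], simp, subst nn_integral_distr) auto
  also have "\<dots> = (\<integral>\<^sup>+\<rho>. \<integral>\<^sup>+w. indicator ?A (of_real \<rho> * w) \<partial>circ \<partial>rad)"
    by (subst circ.nn_integral_fst[symmetric]) auto
  also have "\<dots> = (\<integral>\<^sup>+\<rho>. ennreal \<rho> * (\<integral>\<^sup>+w. indicator ?A (of_real \<rho> * w) \<partial>circ) \<partial>lborel)"
    by (rule nn_integral_rad) measurable
  also have "\<dots> = emeasure lborel ?A"
    by (simp add: emeasure_complex_polar bounded_box nn_integral_circ nn_integral_cmult[symmetric] mult.assoc)
  also have "\<dots> = (\<Prod>b\<in>Basis. (u - l) \<bullet> b)"
    using lu by (rule emeasure_lborel_box)
  finally show "emeasure (distr (rad \<Otimes>\<^sub>M circ) borel (\<lambda>p. of_real (fst p) * snd p)) ?A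
    = ennreal (\<Prod>b\<in>Basis. (u - l) \<bullet> b)" .
qed simp

lemma AE_circ_norm [simp]: "AE w in circ. cmod w = 1"
  unfolding circ_def by (subst AE_distr_iff) auto

lemma nn_integral_shift:
  fixes h :: "real \<Rightarrow> ennreal"
  assumes "h \<in> borel_measurable borel"
  shows "(\<integral>\<^sup>+x. h (x + a) \<partial>lborel) = (\<integral>\<^sup>+x. h x \<partial>lborel)"
  using nn_integral_real_affine[OF assms, of 1 a] by (simp add: add.commute)

lemma nn_integral_periodic_shift:
  fixes h :: "real \<Rightarrow> ennreal"
  assumes [measurable]: "h \<in> borel_measurable borel" and per: "\<And>x. h (x + 2 * pi) = h x"
    and a: "0 \<le> a" "a \<le> 2 * pi"
  shows "(\<integral>\<^sup>+x. h (x + a) * indicator {0..2*pi} x \<partial>lborel) = (\<integral>\<^sup>+x. h x * indicator {0..2*pi} x \<partial>lborel)"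
proof -
  have "(\<integral>\<^sup>+x. h (x + a) * indicator {0..2*pi} x \<partial>lborel)
    = (\<integral>\<^sup>+x. h (x + a) * indicator {a..a+2*pi} (x + a) \<partial>lborel)"
    by (intro nn_integral_cong) (auto simp: indicator_def)
  also have "\<dots> = (\<integral>\<^sup>+x. h x * indicator {a..a+2*pi} x \<partial>lborel)"
    by (rule nn_integral_shift) measurable
  also have "\<dots> = (\<integral>\<^sup>+x. h x * indicator {a..2*pi} x + h x * indicator {2*pi<..a+2*pi} x \<partial>lborel)"
    using a by (intro nn_integral_cong) (auto simp: indicator_def)
  also have "\<dots> = (\<integral>\<^sup>+x. h x * indicator {a..2*pi} x \<partial>lborel) + (\<integral>\<^sup>+x. h x * indicator {2*pi<..a+2*pi} x \<partial>lborel)"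
    by (intro nn_integral_add) measurable
  also have "(\<integral>\<^sup>+x. h x * indicator {2*pi<..a+2*pi} x \<partial>lborel)
    = (\<integral>\<^sup>+x. h (x + 2*pi) * indicator {2*pi<..a+2*pi} (x + 2*pi) \<partial>lborel)"
    by (rule nn_integral_shift[symmetric]) measurable
  also have "\<dots> = (\<integral>\<^sup>+x. h x * indicator {0<..a} x \<partial>lborel)"
    by (intro nn_integral_cong) (auto simp: indicator_def per)
  also have "(\<integral>\<^sup>+x. h x * indicator {a..2*pi} x \<partial>lborel) + \<dots>
    = (\<integral>\<^sup>+x. h x * indicator {a..2*pi} x + h x * indicator {0<..a} x \<partial>lborel)"
    by (intro nn_integral_add[symmetric]) measurable
  also have "\<dots> = (\<integral>\<^sup>+x. h x * indicator {0..2*pi} x \<partial>lborel)"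
  proof (rule nn_integral_cong_AE)
    have "AE x in lborel. x \<noteq> 0" "AE x in lborel. x \<noteq> a"
      by (rule AE_lborel_singleton)+
    then show "AE x in lborel. h x * indicator {a..2*pi} x + h x * indicator {0<..a} x = h x * indicator {0..2*pi} x"
      by eventually_elim (use a in \<open>auto simp: indicator_def\<close>)
  qed
  finally show ?thesis .
qed

text \<open>Substitution stretches one period to \<open>m\<close> consecutive ones. Half-open
  intervals make these disjoint, and the endpoint left out is a null set.\<close>

lemma nn_integral_periodic_scale:
  fixes h :: "real \<Rightarrow> ennreal"
  assumes [measurable]: "h \<in> borel_measurable borel" and per: "\<And>x. h (x + 2 * pi) = h x"
    and m: "0 < (m::nat)"
  shows "(\<integral>\<^sup>+x. h (real m * x) * indicator {0..2*pi} x \<partial>lborel) = (\<integral>\<^sup>+x. h x * indicator {0..2*pi} x \<partial>lborel)"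
proof -
  let ?I = "\<integral>\<^sup>+x. h x * indicator {0<..2*pi} x \<partial>lborel"
  have half: "(\<integral>\<^sup>+x. g x * indicator {0..2*pi} x \<partial>lborel) = (\<integral>\<^sup>+x. g x * indicator {0<..2*pi} x \<partial>lborel)"
    for g :: "real \<Rightarrow> ennreal"
  proof (rule nn_integral_cong_AE)
    have "AE x in lborel. x \<noteq> (0::real)"
      by (rule AE_lborel_singleton)
    then show "AE x in lborel. g x * indicator {0..2*pi} x = g x * indicator {0<..2*pi} x"
      by eventually_elim (auto simp: indicator_def)
  qed
  have pern: "h (x + 2 * pi * real j) = h x" for x j
  proof (induction j)
    case (Suc j)
    then show ?case using per[of "x + 2 * pi * real j"] by (simp add: algebra_simps)
  qed simp
  have "ennreal (real m) * (\<integral>\<^sup>+x. h (real m * x) * indicator {0<..2*pi} x \<partial>lborel)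
    = ennreal (real m) * (\<integral>\<^sup>+x. h (real m * x) * indicator {0<..real m * (2*pi)} (real m * x) \<partial>lborel)"
    using m by (intro arg_cong2[where f = "(*)"] nn_integral_cong refl)
      (auto simp: indicator_def zero_less_mult_iff)
  also have "\<dots> = (\<integral>\<^sup>+x. h x * indicator {0<..real m * (2*pi)} x \<partial>lborel)"
    using m by (subst nn_integral_real_affine[where c = "real m" and t = 0]) auto
  also have "\<dots> = of_nat m * ?I"
  proof (induction m)
    case (Suc m)
    have "(\<integral>\<^sup>+x. h x * indicator {0<..real (Suc m) * (2*pi)} x \<partial>lborel)
      = (\<integral>\<^sup>+x. h x * indicator {0<..real m * (2*pi)} x + h x * indicator {real m*(2*pi)<..real (Suc m) * (2*pi)} x \<partial>lborel)"
    proof (rule nn_integral_cong)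
      fix x :: real
      have "x \<le> real m * (2*pi) \<Longrightarrow> x \<le> real (Suc m) * (2*pi)"
        by (simp add: distrib_right) (use pi_gt_zero in linarith)
      moreover have "real m * (2*pi) < x \<Longrightarrow> 0 < x"
        by (smt (verit) mult_nonneg_nonneg of_nat_0_le_iff pi_ge_zero)
      ultimately show "h x * indicator {0<..real (Suc m) * (2*pi)} x =
        h x * indicator {0<..real m * (2*pi)} x + h x * indicator {real m*(2*pi)<..real (Suc m) * (2*pi)} x"
        by (auto simp: indicator_def)
    qed
    also have "\<dots> = of_nat m * ?I + (\<integral>\<^sup>+x. h x * indicator {real m*(2*pi)<..real (Suc m) * (2*pi)} x \<partial>lborel)"
      by (subst nn_integral_add) (simp_all add: Suc.IH)
    also have "(\<integral>\<^sup>+x. h x * indicator {real m*(2*pi)<..real (Suc m) * (2*pi)} x \<partial>lborel)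
      = (\<integral>\<^sup>+x. h (x + 2 * pi * real m) * indicator {real m*(2*pi)<..real (Suc m) * (2*pi)} (x + 2 * pi * real m) \<partial>lborel)"
      by (rule nn_integral_shift[symmetric]) measurable
    also have "\<dots> = ?I"
      unfolding pern by (intro nn_integral_cong) (auto simp: indicator_def algebra_simps)
    finally show ?case by (simp add: distrib_right add.commute)
  qed simp
  finally have "of_nat m * (\<integral>\<^sup>+x. h (real m * x) * indicator {0<..2*pi} x \<partial>lborel) = of_nat m * ?I"
    by (simp add: ennreal_of_nat_eq_real_of_nat)
  then show ?thesis
    using m unfolding half by (simp add: ennreal_mult_cancel_left)
qed

lemma circ_rotation:
  assumes "cmod c = 1"
  shows "distr circ borel (\<lambda>w. c * w) = circ"
proof (rule measure_eqI)
  fix A assume "A \<in> sets (distr circ borel (\<lambda>w. c * w))"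
  then have [measurable]: "A \<in> sets borel" by simp
  define a where "a = Arg2pi c"
  have a: "0 \<le> a" "a \<le> 2 * pi" "c = cis a"
    using Arg2pi[of c] assms by (auto simp: a_def is_Arg_def cis_conv_exp)
  have "emeasure (distr circ borel (\<lambda>w. c * w)) A = (\<integral>\<^sup>+w. indicator A (c * w) \<partial>circ)"
    by (subst nn_integral_indicator[symmetric], simp, subst nn_integral_distr) auto
  also have "\<dots> = (\<integral>\<^sup>+x. indicator A (cis (x + a)) * indicator {0..2*pi} x \<partial>lborel)"
    by (subst nn_integral_circ) (auto simp: a(3) cis_mult add.commute)
  also have "\<dots> = (\<integral>\<^sup>+x. indicator A (cis x) * indicator {0..2*pi} x \<partial>lborel)"
    using a by (intro nn_integral_periodic_shift) (auto simp flip: cis_mult)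
  also have "\<dots> = emeasure circ A"
    by (subst nn_integral_circ[symmetric]) auto
  finally show "emeasure (distr circ borel (\<lambda>w. c * w)) A = emeasure circ A" .
qed simp

text \<open>This invariance folds the \<open>m\<close> equal sectors of a symmetric domain into one:
  a function of \<open>w ^ m\<close> has the same integral as that function of
  \<open>w\<close>.\<close>

lemma circ_power:
  assumes "0 < m"
  shows "distr circ borel (\<lambda>w. w ^ m) = circ"
proof (rule measure_eqI)
  fix A assume "A \<in> sets (distr circ borel (\<lambda>w. w ^ m))"
  then have [measurable]: "A \<in> sets borel" by simp
  have "emeasure (distr circ borel (\<lambda>w. w ^ m)) A = (\<integral>\<^sup>+w. indicator A (w ^ m) \<partial>circ)"
    by (subst nn_integral_indicator[symmetric], simp, subst nn_integral_distr) auto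
  also have "\<dots> = (\<integral>\<^sup>+x. indicator A (cis (real m * x)) * indicator {0..2*pi} x \<partial>lborel)"
    by (subst nn_integral_circ) (auto simp: Complex.DeMoivre)
  also have "\<dots> = (\<integral>\<^sup>+x. indicator A (cis x) * indicator {0..2*pi} x \<partial>lborel)"
    using assms by (intro nn_integral_periodic_scale) (auto simp flip: cis_mult)
  also have "\<dots> = emeasure circ A"
    by (subst nn_integral_circ[symmetric]) auto
  finally show "emeasure (distr circ borel (\<lambda>w. w ^ m)) A = emeasure circ A" .
qed simp

text \<open>Cauchy's formula at the centre. The function \<open>g\<close> is separate from the real
  part of \<open>f\<close> because it has to be measurable on the whole plane, whereas
  \<open>f\<close> is controlled only on a disc.\<close>

lemma circ_mean_Re_holomorphic:
  fixes g :: "complex \<Rightarrow> real"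
  assumes f: "f holomorphic_on ball 0 r" "1 < r" and [measurable]: "g \<in> borel_measurable borel"
    and g: "\<And>w. cmod w = 1 \<Longrightarrow> g w = Re (f w)"
  shows "has_bochner_integral circ g (2 * pi * Re (f 0))"
proof -
  have hol: "f holomorphic_on cball 0 1"
    using f by (elim holomorphic_on_subset) auto
  have "((\<lambda>u. f u / (u - 0)) has_contour_integral (2 * of_real pi * \<i> * f 0)) (circlepath 0 1)"
    by (rule Cauchy_integral_circlepath_simple[OF hol]) simp
  then have "((\<lambda>t. f (cis t) * \<i>) has_integral (2 * of_real pi * \<i> * f 0)) {0..2*pi}"
    by (simp add: circlepath_def has_contour_integral_part_circlepath_iff)
  from has_integral_mult_left[OF this, of "-\<i>"]
  have "((\<lambda>t. f (cis t)) has_integral (2 * of_real pi * f 0)) {0..2*pi}"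
    by (simp add: mult_ac)
  from has_integral_Re[OF this] have "((\<lambda>t. Re (f (cis t))) has_integral (2 * pi * Re (f 0))) {0..2*pi}"
    by simp
  then have I: "((\<lambda>t. g (cis t)) has_integral (2 * pi * Re (f 0))) {0..2*pi}"
    by (simp add: g)
  have "continuous_on {0..2*pi} (\<lambda>t. Re (f (cis t)))"
    by (intro continuous_intros continuous_on_compose2[OF holomorphic_on_imp_continuous_on[OF hol]]) auto
  then have "set_integrable lborel {0..2*pi} (\<lambda>t. g (cis t))"
    by (intro borel_integrable_atLeastAtMost') (simp add: g)
  then have "has_bochner_integral (density lborel (\<lambda>x. ennreal (indicator {0..2*pi} x))) (\<lambda>t. g (cis t)) (2 * pi * Re (f 0))"
    using I set_borel_integral_eq_integral(2)[of "{0..2*pi}" "\<lambda>t. g (cis t)"]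
    by (subst has_bochner_integral_density)
      (auto simp: has_bochner_integral_iff set_integrable_def set_lebesgue_integral_def has_integral_iff)
  then show ?thesis
    unfolding circ_def by (subst has_bochner_integral_distr) (auto simp: ennreal_indicator[abs_def])
qed

section \<open>Circular means of the logarithm\<close>

text \<open>The integrand is the real part of \<open>Ln (1 - \<zeta> * w)\<close>, which is
  holomorphic on a disc larger than the unit disc and vanishes at the centre.\<close>

lemma circ_log_ball:
  assumes "cmod \<zeta> < 1"
  shows "has_bochner_integral circ (\<lambda>w. ln (cmod (1 - \<zeta> * w))) 0"
proof -
  define r where "r = (if \<zeta> = 0 then 2 else 1 / cmod \<zeta>)"
  have "1 < r" using assms by (simp add: r_def)
  have small: "cmod (\<zeta> * w) < 1" if "w \<in> ball 0 r" for w
  proof (cases "\<zeta> = 0")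
    case False
    then show ?thesis using that by (simp add: r_def norm_mult field_simps)
  qed simp
  have nonpos: "1 - \<zeta> * w \<notin> \<real>\<^sub>\<le>\<^sub>0" if "w \<in> ball 0 r" for w
  proof -
    have "\<bar>Re (\<zeta> * w)\<bar> < 1"
      using small[OF that] abs_Re_le_cmod[of "\<zeta> * w"] by linarith
    then show ?thesis by (auto simp: complex_nonpos_Reals_iff)
  qed
  have "has_bochner_integral circ (\<lambda>w. ln (cmod (1 - \<zeta> * w))) (2 * pi * Re (Ln (1 - \<zeta> * 0)))"
  proof (rule circ_mean_Re_holomorphic[OF _ \<open>1 < r\<close>])
    show "(\<lambda>w. Ln (1 - \<zeta> * w)) holomorphic_on ball 0 r"
      using nonpos by (intro holomorphic_intros) auto
    show "ln (cmod (1 - \<zeta> * w)) = Re (Ln (1 - \<zeta> * w))" if "cmod w = 1" for w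
      using nonpos[of w] that \<open>1 < r\<close> by (subst Re_Ln) auto
  qed measurable
  then show ?thesis by simp
qed

lemma integral_circ_const: "has_bochner_integral circ (\<lambda>_. c :: real) (2 * pi * c)"
  using circ.integrable_const[of c] emeasure_circ_space
  by (simp add: has_bochner_integral_iff measure_def)

text \<open>On the unit circle the larger of \<open>d\<close> and |z| factors out and leaves |1 -
  \<zeta> w| with |\<zeta>| < 1. For |z| < d this uses that the inverse of \<open>w\<close> is its
  conjugate.\<close>

lemma circ_log:
  assumes d: "0 < d" and z: "cmod z \<noteq> d"
  shows "has_bochner_integral circ (\<lambda>w. ln (cmod (of_real d * w - z))) (2 * pi * ln (max d (cmod z)))"
proof -
  have M: "0 < max d (cmod z)" using d by simp
  define \<zeta> where "\<zeta> = (if cmod z < d then cnj z / of_real d else of_real d / z)"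
  have \<zeta>: "cmod \<zeta> < 1"
    using assms by (auto simp: \<zeta>_def norm_divide divide_less_eq)
  have eq: "cmod (of_real d * w - z) = max d (cmod z) * cmod (1 - \<zeta> * w)" if w: "cmod w = 1" for w
  proof (cases "cmod z < d")
    case True
    have "w * cnj w = 1" using w by (simp add: complex_norm_square[symmetric])
    then have "of_real d * w - z = of_real d * w * cnj (1 - \<zeta> * w)"
      using True d by (simp add: \<zeta>_def field_simps)
    then show ?thesis using True w d by (simp add: norm_mult del: complex_cnj_diff complex_cnj_mult)
  next
    case False
    then have "z \<noteq> 0" using d z by auto
    then have "of_real d * w - z = - z * (1 - \<zeta> * w)"
      using False by (simp add: \<zeta>_def field_simps)
    then show ?thesis using False z by (simp add: norm_mult)
  qed
  have nz: "cmod (1 - \<zeta> * w) \<noteq> 0" if "cmod w = 1" for w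
    using \<zeta> that by (metis eq_iff_diff_eq_0 less_irrefl mult.right_neutral norm_eq_zero norm_mult norm_one)
  have "has_bochner_integral circ (\<lambda>w. ln (max d (cmod z)) + ln (cmod (1 - \<zeta> * w))) (2 * pi * ln (max d (cmod z)) + 0)"
    by (intro has_bochner_integral_add integral_circ_const circ_log_ball \<zeta>)
  moreover have "AE w in circ. ln (max d (cmod z)) + ln (cmod (1 - \<zeta> * w)) = ln (cmod (of_real d * w - z))"
    using AE_circ_norm by eventually_elim (use M nz eq in \<open>simp add: ln_mult\<close>)
  ultimately show ?thesis
    by (subst (asm) has_bochner_integral_cong_AE[where g = "\<lambda>w. ln (cmod (of_real d * w - z))"]) auto
qed

lemma nn_integral_polar:
  fixes f :: "complex \<Rightarrow> ennreal"
  assumes [measurable]: "f \<in> borel_measurable borel"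
  shows "(\<integral>\<^sup>+z. f z \<partial>lborel) = (\<integral>\<^sup>+\<rho>. \<integral>\<^sup>+w. f (of_real \<rho> * w) \<partial>circ \<partial>rad)"
  unfolding lborel_complex_polar
  by (subst nn_integral_distr, measurable, subst circ.nn_integral_fst[symmetric]) auto

lemma AE_rad_pos: "AE \<rho> in rad. 0 < \<rho>"
  unfolding rad_def by (subst AE_density) (auto simp: ennreal_neg)

lemma nn_integral_radial:
  fixes g :: "real \<Rightarrow> ennreal"
  assumes [measurable]: "g \<in> borel_measurable borel"
  shows "(\<integral>\<^sup>+z. g (cmod z) \<partial>(lborel :: complex measure)) = ennreal (2 * pi) * (\<integral>\<^sup>+\<rho>. ennreal \<rho> * g \<rho> \<partial>lborel)"
proof -
  have "(\<integral>\<^sup>+z. g (cmod z) \<partial>(lborel :: complex measure)) = (\<integral>\<^sup>+\<rho>. \<integral>\<^sup>+w. g (cmod (of_real \<rho> * w)) \<partial>circ \<partial>rad)"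
    by (rule nn_integral_polar) measurable
  also have "\<dots> = (\<integral>\<^sup>+\<rho>. ennreal (2 * pi) * g \<rho> \<partial>rad)"
  proof (rule nn_integral_cong_AE, use AE_rad_pos in eventually_elim)
    case (elim \<rho>)
    have "(\<integral>\<^sup>+w. g (cmod (of_real \<rho> * w)) \<partial>circ) = (\<integral>\<^sup>+w. g \<rho> \<partial>circ)"
      by (rule nn_integral_cong_AE, use AE_circ_norm in eventually_elim)
        (use elim in \<open>simp add: norm_mult\<close>)
    then show ?case
      by (simp add: emeasure_circ_space mult.commute)
  qed
  also have "\<dots> = ennreal (2 * pi) * (\<integral>\<^sup>+\<rho>. ennreal \<rho> * g \<rho> \<partial>lborel)"
    by (simp add: nn_integral_cmult nn_integral_rad)
  finally show ?thesis .
qed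

lemma has_integral_times_log:
  fixes \<delta> :: real
  assumes "0 < \<delta>"
  shows "((\<lambda>\<rho>. \<rho> * (ln \<delta> - ln \<rho>)) has_integral \<delta>\<^sup>2 / 4) {0..\<delta>}"
proof -
  \<comment> \<open>Found by parts. With \<open>ln 0 = 0\<close> its value at 0 is its limit there,
    so it is continuous up to the endpoint.\<close>
  define F :: "real \<Rightarrow> real" where "F \<rho> = \<rho>\<^sup>2 / 2 * (ln \<delta> - ln \<rho>) + \<rho>\<^sup>2 / 4" for \<rho>
  have "((\<lambda>\<rho>. \<rho> * (ln \<delta> - ln \<rho>)) has_integral (F \<delta> - F 0)) {0..\<delta>}"
  proof (rule fundamental_theorem_of_calculus_interior[where f = F])
    show "continuous_on {0..\<delta>} F"
    proof (rule continuous_on_IccI)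
      show "(F \<longlongrightarrow> F 0) (at_right 0)"
        unfolding F_def by simp real_asymp
      show "(F \<longlongrightarrow> F \<delta>) (at_left \<delta>)"
        unfolding F_def using assms by (intro tendsto_intros) auto
      show "F \<midarrow>x\<rightarrow> F x" if "0 < x" "x < \<delta>" for x
        unfolding F_def using that by (intro tendsto_intros) auto
    qed (fact assms)
    show "(F has_vector_derivative x * (ln \<delta> - ln x)) (at x)" if "x \<in> {0<..<\<delta>}" for x
      unfolding F_def has_real_derivative_iff_has_vector_derivative[symmetric]
      using that by (auto intro!: derivative_eq_intros simp: field_simps power2_eq_square)
  qed (use assms in auto)
  then show ?thesis by (simp add: F_def)
qed

text \<open>The part of the logarithmic singularity inside a disc. It is nonnegative except perhaps
  at \<open>y = x\<close>, where \<open>ln 0 = 0\<close> leaves the value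
  \<open>ln \<delta>\<close>; hence its sign is stated almost everywhere.\<close>

abbreviation log_cut :: "real \<Rightarrow> complex \<Rightarrow> complex \<Rightarrow> real" where
  "log_cut \<delta> x y \<equiv> ln (max \<delta> (cmod (x - y))) - ln (cmod (x - y))"

lemma log_disc_integral:
  assumes "0 < \<delta>"
  shows "has_bochner_integral lborel (\<lambda>y. log_cut \<delta> x y) (pi * \<delta>\<^sup>2 / 2)"
proof -
  define g where "g \<rho> = (if \<rho> = 0 then 0 else ln (max \<delta> \<rho>) - ln \<rho>)" for \<rho>
  have g_nonneg: "0 \<le> g \<rho>" if "0 \<le> \<rho>" for \<rho>
    using that assms by (auto simp: g_def)
  have [measurable]: "g \<in> borel_measurable borel"
    unfolding g_def by measurable
  have "(\<integral>\<^sup>+z. ennreal (g (cmod z)) \<partial>(lborel :: complex measure)) = ennreal (2 * pi) * (\<integral>\<^sup>+\<rho>. ennreal \<rho> * ennreal (g \<rho>) \<partial>lborel)"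
    by (rule nn_integral_radial) measurable
  also have "(\<integral>\<^sup>+\<rho>. ennreal \<rho> * ennreal (g \<rho>) \<partial>lborel) = (\<integral>\<^sup>+\<rho>\<in>{0..\<delta>}. ennreal (\<rho> * (ln \<delta> - ln \<rho>)) \<partial>lborel)"
    using assms by (intro nn_integral_cong)
      (auto simp: indicator_def g_def max_def ennreal_mult' ennreal_neg not_le)
  also have "\<dots> = ennreal (\<delta>\<^sup>2 / 4)"
    using assms by (intro nn_integral_has_integral_lebesgue' has_integral_times_log)
      (auto intro!: mult_nonneg_nonneg simp: zero_le_mult_iff dest!: order_le_imp_less_or_eq)
  finally have I: "(\<integral>\<^sup>+z. ennreal (g (cmod z)) \<partial>(lborel :: complex measure)) = ennreal (pi * \<delta>\<^sup>2 / 2)"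
    by (simp add: ennreal_mult'[symmetric])
  have "(\<integral>\<^sup>+y. ennreal (g (cmod (x - y))) \<partial>lborel) = (\<integral>\<^sup>+z. ennreal (g (cmod z)) \<partial>lborel)"
  proof -
    have "(\<integral>\<^sup>+z. ennreal (g (cmod z)) \<partial>lborel) = (\<integral>\<^sup>+z. ennreal (g (cmod z)) \<partial>(distr lborel borel ((+) (- x))))"
      by (simp only: lborel_distr_plus)
    also have "\<dots> = (\<integral>\<^sup>+y. ennreal (g (cmod (- x + y))) \<partial>lborel)"
      by (subst nn_integral_distr) auto
    finally show ?thesis by (simp add: norm_minus_commute)
  qed
  with I have "has_bochner_integral lborel (\<lambda>y. g (cmod (x - y))) (pi * \<delta>\<^sup>2 / 2)"
    using g_nonneg by (intro has_bochner_integral_nn_integral) auto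
  moreover have "AE y in lborel. g (cmod (x - y)) = log_cut \<delta> x y"
    using AE_lborel_singleton[of x] by eventually_elim (simp add: g_def)
  ultimately show ?thesis
    by (subst (asm) has_bochner_integral_cong_AE[where g = "\<lambda>y. log_cut \<delta> x y"]) auto
qed

text \<open>The singular logarithms of two cuts cancel, and only the two disc integrals
  remain.\<close>

lemma log_max_diff_integral:
  assumes "0 < a" "0 < b"
  shows "has_bochner_integral lborel (\<lambda>y. ln (max b (cmod y)) - ln (max a (cmod y))) (pi / 2 * (b\<^sup>2 - a\<^sup>2))"
  using has_bochner_integral_diff[OF log_disc_integral[OF assms(2), of 0] log_disc_integral[OF assms(1), of 0]]
  by (simp add: algebra_simps diff_divide_distrib)

section \<open>The logarithmic potential of a bounded domain\<close>

definition log_pot :: "complex set \<Rightarrow> complex \<Rightarrow> real" where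
  "log_pot D x = (LINT y|lborel. indicator D y * ln (cmod (x - y)))"

text \<open>This is the mean of \<open>log_pot D\<close> over the circle of radius \<delta> about
  \<open>x\<close>. At \<open>x = 0\<close> it yields the circular mean H, up to the factor 2 pi and
  the rotation term; for \<delta> tending to 0 it regularizes the potential.\<close>

definition log_pot_max :: "complex set \<Rightarrow> real \<Rightarrow> complex \<Rightarrow> real" where
  "log_pot_max D \<delta> x = (LINT y|lborel. indicator D y * ln (max \<delta> (cmod (x - y))))"

lemma abs_ln_max_le:
  fixes \<delta> t R :: real
  assumes "0 < \<delta>" "t \<le> R"
  shows "\<bar>ln (max \<delta> t)\<bar> \<le> \<bar>ln \<delta>\<bar> + \<bar>ln (max \<delta> R)\<bar>"
proof -
  have "ln \<delta> \<le> ln (max \<delta> t)"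
    using assms by (subst ln_le_cancel_iff) auto
  moreover have "ln (max \<delta> t) \<le> ln (max \<delta> R)"
    using assms by (subst ln_le_cancel_iff) auto
  ultimately show ?thesis by linarith
qed

lemma log_disc_nonneg: "0 < \<delta> \<Longrightarrow> AE y in lborel. 0 \<le> log_cut \<delta> x y"
  using AE_lborel_singleton[of x] by eventually_elim simp

context
  fixes D :: "complex set"
  assumes D [measurable]: "D \<in> sets borel" and bdd: "bounded D"
begin

lemma integrable_log_max:
  assumes "0 < \<delta>"
  shows "integrable lborel (\<lambda>y. indicator D y * ln (max \<delta> (cmod (x - y))))"
proof -
  obtain R where R: "\<And>y. y \<in> D \<Longrightarrow> cmod y \<le> R"
    using bdd unfolding bounded_iff by blast
  have "integrable lborel (\<lambda>y. indicator D y *\<^sub>R ln (max \<delta> (cmod (x - y))))"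
  proof (rule integrableI_bounded_set_indicator)
    show "emeasure lborel D < \<infinity>" by (rule emeasure_bounded_finite[OF bdd])
    have "\<bar>ln (max \<delta> (cmod (x - y)))\<bar> \<le> \<bar>ln \<delta>\<bar> + \<bar>ln (max \<delta> (cmod x + R))\<bar>" if "y \<in> D" for y
      using R[OF that] norm_triangle_ineq4[of x y] by (intro abs_ln_max_le assms) linarith
    then show "AE y in lborel. y \<in> D \<longrightarrow> norm (ln (max \<delta> (cmod (x - y)))) \<le> \<bar>ln \<delta>\<bar> + \<bar>ln (max \<delta> (cmod x + R))\<bar>"
      by simp
  qed auto
  then show ?thesis by simp
qed

lemma integrable_log_disc:
  assumes "0 < \<delta>"
  shows "integrable lborel (\<lambda>y. indicator D y * (log_cut \<delta> x y))"
  using integrable_mult_indicator[of D lborel "\<lambda>y. log_cut \<delta> x y"]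
    has_bochner_integral_iff[THEN iffD1, OF log_disc_integral[OF assms, of x]]
  by simp

lemma integrable_log:
  "integrable lborel (\<lambda>y. indicator D y * ln (cmod (x - y)))"
  using Bochner_Integration.integrable_diff[OF integrable_log_max[of 1 x] integrable_log_disc[of 1 x]]
  by (simp add: algebra_simps)

lemma log_disc_restricted_le:
  assumes "0 < \<delta>"
  shows "(LINT y|lborel. indicator D y * (log_cut \<delta> x y)) \<le> pi * \<delta>\<^sup>2 / 2"
    (is "?I \<le> _")
proof -
  have "?I \<le> (LINT y|lborel. log_cut \<delta> x y)"
  proof (rule integral_mono_AE)
    show "AE y in lborel. indicator D y * (log_cut \<delta> x y)
      \<le> log_cut \<delta> x y"
      using log_disc_nonneg[OF assms, of x] by eventually_elim (auto simp: indicator_def)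
  qed (use integrable_log_disc[OF assms] log_disc_integral[OF assms] in \<open>auto simp: has_bochner_integral_iff\<close>)
  then show ?thesis
    using log_disc_integral[OF assms, of x] by (simp add: has_bochner_integral_iff)
qed

lemma log_pot_max_minus_log_pot:
  assumes "0 < \<delta>"
  shows "log_pot_max D \<delta> x - log_pot D x
    = (LINT y|lborel. indicator D y * (log_cut \<delta> x y))"
  unfolding log_pot_max_def log_pot_def
  by (subst Bochner_Integration.integral_diff[symmetric])
    (simp_all add: integrable_log integrable_log_max assms right_diff_distrib)

lemma log_pot_max_bounds:
  assumes "0 < \<delta>"
  shows "0 \<le> log_pot_max D \<delta> x - log_pot D x" "log_pot_max D \<delta> x - log_pot D x \<le> pi * \<delta>\<^sup>2 / 2"
proof -
  show "0 \<le> log_pot_max D \<delta> x - log_pot D x"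
    unfolding log_pot_max_minus_log_pot[OF assms]
    by (rule integral_nonneg_AE, use log_disc_nonneg[OF assms, of x] in eventually_elim) auto
  show "log_pot_max D \<delta> x - log_pot D x \<le> pi * \<delta>\<^sup>2 / 2"
    unfolding log_pot_max_minus_log_pot[OF assms] by (rule log_disc_restricted_le[OF assms])
qed

lemma ln_max_lipschitz:
  fixes \<delta> s t :: real
  assumes "0 < \<delta>"
  shows "\<bar>ln (max \<delta> s) - ln (max \<delta> t)\<bar> \<le> \<bar>s - t\<bar> / \<delta>"
proof -
  have *: "ln (max \<delta> s) - ln (max \<delta> t) \<le> \<bar>s - t\<bar> / \<delta>" for s t :: real
  proof -
    have "ln (max \<delta> s) - ln (max \<delta> t) \<le> (max \<delta> s - max \<delta> t) / max \<delta> t"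
      using assms by (intro ln_diff_le) auto
    also have "\<dots> \<le> \<bar>s - t\<bar> / max \<delta> t"
      using assms by (intro divide_right_mono) auto
    also have "\<dots> \<le> \<bar>s - t\<bar> / \<delta>"
      using assms by (intro divide_left_mono) auto
    finally show ?thesis .
  qed
  show ?thesis using *[of s t] *[of t s] by (simp add: abs_le_iff abs_minus_commute)
qed

lemma continuous_log_pot_max:
  assumes "0 < \<delta>"
  shows "continuous_on UNIV (log_pot_max D \<delta>)"
proof -
  have "\<bar>log_pot_max D \<delta> x - log_pot_max D \<delta> x'\<bar> \<le> (measure lborel D / \<delta>) * cmod (x - x')" for x x'
  proof -
    have "log_pot_max D \<delta> x - log_pot_max D \<delta> x' =
      (LINT y|lborel. indicator D y * (ln (max \<delta> (cmod (x - y))) - ln (max \<delta> (cmod (x' - y)))))"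
      unfolding log_pot_max_def
      by (subst Bochner_Integration.integral_diff[symmetric])
        (simp_all add: integrable_log_max assms right_diff_distrib)
    also have "\<bar>\<dots>\<bar> \<le> (LINT y|lborel. indicator D y * (cmod (x - x') / \<delta>))"
    proof (rule integral_abs_bound_integral)
      show "integrable lborel (\<lambda>y. indicator D y * (cmod (x - x') / \<delta>))"
        using emeasure_bounded_finite[OF bdd] by (intro integrable_mult_left) auto
      fix y
      have "\<bar>ln (max \<delta> (cmod (x - y))) - ln (max \<delta> (cmod (x' - y)))\<bar> \<le> \<bar>cmod (x - y) - cmod (x' - y)\<bar> / \<delta>"
        by (rule ln_max_lipschitz[OF assms])
      also have "\<dots> \<le> cmod (x - x') / \<delta>"
        using norm_triangle_ineq3[of "x - y" "x' - y"] assms by (intro divide_right_mono) auto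
      finally show "\<bar>indicator D y * (ln (max \<delta> (cmod (x - y))) - ln (max \<delta> (cmod (x' - y))))\<bar>
        \<le> indicator D y * (cmod (x - x') / \<delta>)"
        by (auto simp: indicator_def)
    qed (use integrable_log_max[OF assms, of x] integrable_log_max[OF assms, of x'] in \<open>auto simp: right_diff_distrib\<close>)
    also have "\<dots> = (measure lborel D / \<delta>) * cmod (x - x')"
      by simp
    finally show ?thesis .
  qed
  then have "(measure lborel D / \<delta>)-lipschitz_on UNIV (log_pot_max D \<delta>)"
    using assms by (intro lipschitz_onI) (auto simp: dist_norm)
  then show ?thesis by (rule lipschitz_on_continuous_on)
qed

text \<open>The regularized potentials are Lipschitz and differ from the potential by at most pi
  \<delta>^2 / 2, uniformly in the point.\<close>

lemma continuous_log_pot: "continuous_on UNIV (log_pot D)"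
proof (rule uniform_limit_theorem)
  show "\<forall>\<^sub>F n in sequentially. continuous_on UNIV (log_pot_max D (1 / Suc n))"
    by (intro always_eventually allI continuous_log_pot_max) auto
  show "uniform_limit UNIV (\<lambda>n. log_pot_max D (1 / Suc n)) (log_pot D) sequentially"
  proof (rule uniform_limitI)
    fix e :: real assume "0 < e"
    have "(\<lambda>n. pi * (1 / Suc n)\<^sup>2 / 2) \<longlonglongrightarrow> 0"
      by real_asymp
    then have "\<forall>\<^sub>F n in sequentially. pi * (1 / Suc n)\<^sup>2 / 2 < e"
      using \<open>0 < e\<close> by (rule order_tendstoD)
    then show "\<forall>\<^sub>F n in sequentially. \<forall>x\<in>UNIV. dist (log_pot_max D (1 / Suc n) x) (log_pot D x) < e"
    proof eventually_elim
      case (elim n)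
      show ?case
      proof
        fix x
        show "dist (log_pot_max D (1 / Suc n) x) (log_pot D x) < e"
          using log_pot_max_bounds[of "1 / Suc n" x] elim unfolding dist_real_def by simp
      qed
    qed
  qed
qed simp

lemma sphere_null: "AE y in lborel. cmod (x - y) \<noteq> d" for x :: complex
proof -
  have "sphere x d \<in> null_sets lborel"
    using negligible_sphere[of x d] by (simp add: negligible_iff_null_sets null_sets_completion_iff)
  from AE_not_in[OF this] show ?thesis
    by eventually_elim (simp add: dist_norm)
qed

text \<open>Split the logarithm at 1: above, the size of the domain bounds it; below, it is the cut
  with \<delta> = 1. The bound is uniform in \<open>x\<close>, which gives the integrability needed
  for Fubini on a circle.\<close>

lemma abs_log_integral_le:
  assumes R: "\<And>y. y \<in> D \<Longrightarrow> cmod y \<le> R" and x: "cmod x \<le> r"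
  shows "(LINT y|lborel. norm (indicator D y * ln (cmod (x - y)))) \<le> measure lborel D * \<bar>ln (max 1 (r + R))\<bar> + pi / 2"
proof -
  have D_fin: "integrable lborel (\<lambda>y. indicator D y * \<bar>ln (max 1 (r + R))\<bar>)"
    using emeasure_bounded_finite[OF bdd] by (intro integrable_mult_left) auto
  have "(LINT y|lborel. norm (indicator D y * ln (cmod (x - y)))) \<le>
    (LINT y|lborel. indicator D y * \<bar>ln (max 1 (r + R))\<bar>
      + indicator D y * (log_cut 1 x y))"
  proof (rule integral_mono_AE)
    show "AE y in lborel. norm (indicator D y * ln (cmod (x - y))) \<le> indicator D y * \<bar>ln (max 1 (r + R))\<bar>
      + indicator D y * (log_cut 1 x y)"
      using log_disc_nonneg[OF zero_less_one, of x]
    proof eventually_elim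
      case (elim y)
      show ?case
      proof (cases "y \<in> D")
        case True
        then have "cmod (x - y) \<le> r + R"
          using R[of y] x norm_triangle_ineq4[of x y] by linarith
        then have "0 \<le> ln (max 1 (cmod (x - y)))" "ln (max 1 (cmod (x - y))) \<le> \<bar>ln (max 1 (r + R))\<bar>"
          using abs_ln_max_le[of 1 "cmod (x - y)" "r + R"] by simp_all
        then have "\<bar>ln (cmod (x - y))\<bar> \<le> \<bar>ln (max 1 (r + R))\<bar> + (log_cut 1 x y)"
          using elim by linarith
        then show ?thesis using True by simp
      qed simp
    qed
  qed (use integrable_log integrable_log_disc D_fin in \<open>auto simp del: right_diff_distrib\<close>)
  also have "\<dots> = measure lborel D * \<bar>ln (max 1 (r + R))\<bar>
      + (LINT y|lborel. indicator D y * (log_cut 1 x y))"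
    using D_fin integrable_log_disc[of 1 x] by (subst Bochner_Integration.integral_add) auto
  also have "\<dots> \<le> measure lborel D * \<bar>ln (max 1 (r + R))\<bar> + pi / 2"
    using log_disc_restricted_le[of 1 x] by simp
  finally show ?thesis .
qed

text \<open>Fubini reduces the claim to the circular mean of ln |d w - z| with
  \<open>z = y - x0\<close>, which is known unless \<open>y\<close> lies on the circle itself, a
  null set.\<close>

lemma circle_mean_log_pot:
  assumes d: "0 < d"
  shows "has_bochner_integral circ (\<lambda>w. log_pot D (x0 + of_real d * w)) (2 * pi * log_pot_max D d x0)"
proof -
  interpret P: pair_sigma_finite circ "lborel :: complex measure" ..
  obtain R where R: "\<And>y. y \<in> D \<Longrightarrow> cmod y \<le> R"
    using bdd unfolding bounded_iff by blast
  let ?f = "\<lambda>(w, y). indicator D y * ln (cmod (x0 + of_real d * w - y)) :: real"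
  have meas [measurable]: "?f \<in> borel_measurable (circ \<Otimes>\<^sub>M lborel)"
    by measurable
  have bnd: "AE w in circ. (LINT y|lborel. norm (?f (w, y))) \<le> measure lborel D * \<bar>ln (max 1 (cmod x0 + d + R))\<bar> + pi / 2"
    using AE_circ_norm
  proof eventually_elim
    case (elim w)
    have "cmod (x0 + of_real d * w) \<le> cmod x0 + d"
      using elim d norm_triangle_ineq[of x0 "of_real d * w"] by (simp add: norm_mult)
    from abs_log_integral_le[OF R this] show ?case by simp
  qed
  have int: "integrable (circ \<Otimes>\<^sub>M lborel) ?f"
  proof (rule P.Fubini_integrable[OF meas])
    have "(\<lambda>w. LINT y|lborel. norm (?f (w, y))) \<in> borel_measurable circ"
      by measurable
    then show "integrable circ (\<lambda>w. LINT y|lborel. norm (?f (w, y)))"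
      using bnd by (intro circ.integrable_const_bound[where B = "measure lborel D * \<bar>ln (max 1 (cmod x0 + d + R))\<bar> + pi / 2"])
        (auto simp: integral_nonneg_AE)
    show "AE w in circ. integrable lborel (\<lambda>y. ?f (w, y))"
      using integrable_log by simp
  qed
  have "(LINT w|circ. log_pot D (x0 + of_real d * w)) = (LINT w|circ. LINT y|lborel. ?f (w, y))"
    by (simp add: log_pot_def)
  also have "\<dots> = (LINT y|lborel. LINT w|circ. ?f (w, y))"
    using P.Fubini_integral[of "\<lambda>w y. ?f (w, y)"] int by simp
  also have "\<dots> = (LINT y|lborel. 2 * pi * (indicator D y * ln (max d (cmod (x0 - y)))))"
  proof (rule integral_cong_AE)
    show "AE y in lborel. (LINT w|circ. ?f (w, y)) = 2 * pi * (indicator D y * ln (max d (cmod (x0 - y))))"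
      using sphere_null[of x0 d]
    proof eventually_elim
      case (elim y)
      have "has_bochner_integral circ (\<lambda>w. ln (cmod (of_real d * w - (y - x0)))) (2 * pi * ln (max d (cmod (y - x0))))"
        using elim d by (intro circ_log) (simp_all add: norm_minus_commute)
      then show ?case
        by (simp add: has_bochner_integral_iff norm_minus_commute algebra_simps)
    qed
  qed measurable
  also have "\<dots> = 2 * pi * log_pot_max D d x0"
    by (simp add: log_pot_max_def)
  finally have "(LINT w|circ. log_pot D (x0 + of_real d * w)) = 2 * pi * log_pot_max D d x0" .
  moreover have "integrable circ (\<lambda>w. log_pot D (x0 + of_real d * w))"
    using P.integrable_fst'[OF int] by (simp add: log_pot_def)
  ultimately show ?thesis by (simp add: has_bochner_integral_iff)
qed

text \<open>When the disc lies in the domain, the restricted cut integral is the full one. This is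
  the Poisson equation, with Laplacian 2 pi, in mean value form.\<close>

lemma circle_mean_log_pot_interior:
  assumes d: "0 < d" and sub: "ball x0 d \<subseteq> D"
  shows "has_bochner_integral circ (\<lambda>w. log_pot D (x0 + of_real d * w)) (2 * pi * (log_pot D x0 + pi * d\<^sup>2 / 2))"
proof -
  have "log_pot_max D d x0 - log_pot D x0 = (LINT y|lborel. log_cut d x0 y)"
    unfolding log_pot_max_minus_log_pot[OF d]
  proof (rule Bochner_Integration.integral_cong[OF refl])
    fix y
    show "indicator D y * (log_cut d x0 y) = log_cut d x0 y"
    proof (cases "y \<in> D")
      case False
      then have "d \<le> cmod (x0 - y)" using sub by (force simp: dist_norm)
      then show ?thesis by (simp add: max_def)
    qed simp
  qed
  also have "\<dots> = pi * d\<^sup>2 / 2"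
    using log_disc_integral[OF d, of x0] by (simp add: has_bochner_integral_iff)
  finally have "log_pot_max D d x0 = log_pot D x0 + pi * d\<^sup>2 / 2" by simp
  then show ?thesis using circle_mean_log_pot[OF d, of x0] by simp
qed

end

section \<open>Symmetric star-shaped domains\<close>

text \<open>For \<open>x \<noteq> 0\<close> both sides are monic polynomials of degree
  \<open>m\<close> in \<open>y\<close> that agree at the \<open>m\<close> points
  \<open>z * x\<close>.\<close>

lemma prod_roots_of_unity:
  fixes x y :: complex
  assumes m: "0 < m"
  shows "(\<Prod>z | z ^ m = 1. y - z * x) = y ^ m - x ^ m"
proof (cases "x = 0")
  case True
  then show ?thesis using m card_roots_unity_eq[OF m] by (simp add: power_0_left)
next
  case False
  let ?U = "{z::complex. z ^ m = 1}"
  let ?p = "\<Prod>z\<in>?U. [:- (z * x), 1:]" and ?q = "monom 1 m - [:x ^ m:]"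
  have fin: "finite ?U" and card: "card ?U = m"
    using m card_roots_unity_eq[OF m] by (auto intro: finite_roots_unity)
  have deg: "degree ?p = m"
    using fin card by (subst degree_prod_eq_sum_degree) auto
  moreover have "lead_coeff ?p = 1"
    by (simp add: lead_coeff_prod)
  ultimately have "coeff ?p m = 1" by metis
  moreover have "coeff ?q m = 1"
    using m by (cases m) auto
  moreover have "degree ?q \<le> m"
    by (intro degree_diff_le) (auto simp: degree_monom_le)
  moreover have "card ((\<lambda>z. z * x) ` ?U) \<ge> m"
    using False card by (subst card_image) (auto simp: inj_on_def)
  moreover have "poly ?p z = poly ?q z" if "z \<in> (\<lambda>z. z * x) ` ?U" for z
    using that fin by (auto simp: poly_prod poly_monom power_mult_distrib prod_zero_iff)
  ultimately have "?p = ?q"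
    using deg by (intro poly_eqI_degree_lead_coeff[where n = m and A = "(\<lambda>z. z * x) ` ?U"]) auto
  from arg_cong[OF this, of "\<lambda>p. poly p y"] show ?thesis
    by (simp add: poly_prod poly_monom)
qed

lemma lborel_rotation:
  assumes "cmod c = 1"
  shows "distr lborel borel (\<lambda>z. c * z) = lborel"
proof (rule measure_eqI)
  fix A assume "A \<in> sets (distr lborel borel (\<lambda>z. c * z))"
  then have [measurable]: "A \<in> sets borel" by simp
  have "emeasure (distr lborel borel (\<lambda>z. c * z)) A = (\<integral>\<^sup>+z. indicator A (c * z) \<partial>lborel)"
    by (subst nn_integral_indicator[symmetric], simp, subst nn_integral_distr) auto
  also have "\<dots> = (\<integral>\<^sup>+\<rho>. \<integral>\<^sup>+w. indicator A (c * (of_real \<rho> * w)) \<partial>circ \<partial>rad)"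
    by (rule nn_integral_polar) measurable
  also have "\<dots> = (\<integral>\<^sup>+\<rho>. \<integral>\<^sup>+w. indicator A (of_real \<rho> * w) \<partial>circ \<partial>rad)"
  proof (rule nn_integral_cong)
    fix \<rho> :: real
    have "(\<integral>\<^sup>+w. indicator A (of_real \<rho> * w) \<partial>circ) = (\<integral>\<^sup>+w. indicator A (of_real \<rho> * w) \<partial>(distr circ borel (\<lambda>w. c * w)))"
      by (simp only: circ_rotation[OF assms])
    also have "\<dots> = (\<integral>\<^sup>+w. indicator A (c * (of_real \<rho> * w)) \<partial>circ)"
      by (subst nn_integral_distr) (auto simp: mult_ac)
    finally show "(\<integral>\<^sup>+w. indicator A (c * (of_real \<rho> * w)) \<partial>circ) = (\<integral>\<^sup>+w. indicator A (of_real \<rho> * w) \<partial>circ)"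
      by simp
  qed
  also have "\<dots> = (\<integral>\<^sup>+z. indicator A z \<partial>lborel)"
    by (rule nn_integral_polar[symmetric]) measurable
  finally show "emeasure (distr lborel borel (\<lambda>z. c * z)) A = emeasure lborel A" by simp
qed simp

interpretation polar: pair_sigma_finite rad circ ..

abbreviation polar :: "(real \<times> complex) measure" where
  "polar \<equiv> rad \<Otimes>\<^sub>M circ"

lemma AE_polar: "AE p in polar. 0 < fst p \<and> cmod (snd p) = 1"
proof (rule polar.AE_pair_measure)
  show "AE \<rho> in rad. AE w in circ. 0 < fst (\<rho>, w) \<and> cmod (snd (\<rho>, w)) = 1"
    using AE_rad_pos by eventually_elim (use AE_circ_norm in \<open>auto elim: eventually_mono\<close>)
qed measurable

lemma AE_rad_neq: "AE \<rho> in rad. \<rho> \<noteq> r"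
  unfolding rad_def using AE_lborel_singleton[of r] by (subst AE_density) (auto elim: eventually_mono)

lemma AE_polar_radius: "AE p in polar. fst p \<noteq> (r :: real)"
  using AE_rad_neq[of r] by (intro polar.AE_pair_measure) (measurable, auto elim: eventually_mono)

lemma polar_power:
  assumes "0 < m"
  shows "distr polar polar (\<lambda>p. (fst p, snd p ^ m)) = polar"
proof -
  have "distr circ circ (\<lambda>w. w ^ m) = circ"
    using circ_power[OF assms] by (metis distr_cong sets_circ)
  moreover have "distr rad rad (\<lambda>\<rho>. \<rho>) = rad" by simp
  ultimately show ?thesis
    using pair_measure_distr[of "\<lambda>\<rho>. \<rho>" rad rad "\<lambda>w. w ^ m" circ circ] circ.sigma_finite_measure_axioms
    by (simp add: case_prod_unfold)
qed

text \<open>The passage to folded coordinates: in \<open>f\<close> the second variable stands for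
  the \<open>m\<close>-th power of a direction, so the symmetry of \<open>g\<close> is used up here
  once and for all.\<close>

lemma has_bochner_integral_polar_power:
  fixes f :: "real \<times> complex \<Rightarrow> real" and g :: "complex \<Rightarrow> real"
  assumes m: "0 < m" and f [measurable]: "f \<in> borel_measurable (borel \<Otimes>\<^sub>M borel)"
    and g: "has_bochner_integral lborel g I"
    and eq: "\<And>\<rho> w. 0 < \<rho> \<Longrightarrow> cmod w = 1 \<Longrightarrow> g (of_real \<rho> * w) = f (\<rho>, w ^ m)"
  shows "has_bochner_integral polar f I"
proof -
  have [measurable]: "g \<in> borel_measurable borel"
    using g by (auto simp: has_bochner_integral_iff dest: borel_measurable_integrable)
  from g have "has_bochner_integral (distr polar borel (\<lambda>p. of_real (fst p) * snd p)) g I"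
    by (simp only: lborel_complex_polar)
  then have "has_bochner_integral polar (\<lambda>p. g (of_real (fst p) * snd p)) I"
    by (auto simp: has_bochner_integral_iff integrable_distr_eq integral_distr)
  moreover have "AE p in polar. g (of_real (fst p) * snd p) = f (fst p, snd p ^ m)"
    using AE_polar by eventually_elim (auto simp: eq)
  ultimately have "has_bochner_integral polar (\<lambda>p. f (fst p, snd p ^ m)) I"
    by (subst (asm) has_bochner_integral_cong_AE[where g = "\<lambda>p. f (fst p, snd p ^ m)"]) auto
  then have "has_bochner_integral (distr polar polar (\<lambda>p. (fst p, snd p ^ m))) f I"
    by (subst has_bochner_integral_distr) auto
  then show ?thesis by (simp add: polar_power[OF m])
qed

text \<open>An \<open>m\<close>-fold symmetric star-shaped domain whose radius in the direction \<open>w\<close> is an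
  increasing function \<open>s\<close> of \<^term>\<open>Re (w ^ m)\<close>; note that \<open>sgn z = z / cmod z\<close> and \<open>sgn 0 = 0\<close>.\<close>

locale star_patch =
  fixes m :: nat and s :: "real \<Rightarrow> real"
  assumes m_pos: "0 < m" and s_cont: "continuous_on UNIV s" and s_mono: "mono s"
    and s_strict: "strict_mono_on {-1..1} s"
    and s_pos: "0 < s (-1)"
begin

definition D :: "complex set" where
  "D = {z. cmod z < s (Re (sgn z ^ m))}"

definition R1 :: real where "R1 = s (-1)"
definition R2 :: real where "R2 = s 1"

lemma s_measurable [measurable]: "s \<in> borel_measurable borel"
  by (rule borel_measurable_continuous_onI[OF s_cont])

lemma norm_sgn_le_1: "cmod (sgn z) \<le> 1"
  by (simp add: norm_sgn)

lemma sgn_measurable [measurable]: "(sgn :: complex \<Rightarrow> complex) \<in> borel_measurable borel"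
  unfolding sgn_div_norm by measurable

lemma D_borel [measurable]: "D \<in> sets borel"
  unfolding D_def by measurable

lemma Re_power_le: "cmod w \<le> 1 \<Longrightarrow> \<bar>Re (w ^ m)\<bar> \<le> 1"
  using abs_Re_le_cmod[of "w ^ m"] power_le_one[of "cmod w" m] by (simp add: norm_power)

lemma R1_le_s: "cmod w \<le> 1 \<Longrightarrow> R1 \<le> s (Re (w ^ m))"
  unfolding R1_def using Re_power_le[of w] by (intro monoD[OF s_mono]) auto

lemma s_le_R2: "cmod w \<le> 1 \<Longrightarrow> s (Re (w ^ m)) \<le> R2"
  unfolding R2_def using Re_power_le[of w] by (intro monoD[OF s_mono]) auto

lemma R1_pos: "0 < R1"
  using s_pos by (simp add: R1_def)

lemma R1_less_R2: "R1 < R2"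
  using s_strict by (auto simp: R1_def R2_def strict_mono_on_def)

lemma D_subset: "D \<subseteq> ball 0 R2"
proof
  fix z assume "z \<in> D"
  then show "z \<in> ball 0 R2"
    using s_le_R2[OF norm_sgn_le_1, of z] by (auto simp: D_def)
qed

lemma D_bounded: "bounded D"
  using D_subset bounded_ball bounded_subset by blast

lemma ball_subset_D: "ball 0 R1 \<subseteq> D"
proof
  fix z :: complex assume "z \<in> ball 0 R1"
  then show "z \<in> D"
    using R1_le_s[OF norm_sgn_le_1, of z] by (auto simp: D_def)
qed

lemma polar_in_D: "0 < \<rho> \<Longrightarrow> cmod w = 1 \<Longrightarrow> of_real \<rho> * w \<in> D \<longleftrightarrow> \<rho> < s (Re (w ^ m))"
  by (simp add: D_def sgn_mult sgn_of_real norm_mult) (simp add: sgn_div_norm)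

lemma norm_root_of_unity: "c ^ m = 1 \<Longrightarrow> cmod c = 1"
  using m_pos power_eq_1_iff by blast

lemma D_rotation:
  assumes "c ^ m = 1"
  shows "c * z \<in> D \<longleftrightarrow> z \<in> D"
proof -
  have c: "cmod c = 1" using assms by (rule norm_root_of_unity)
  then have "sgn (c * z) ^ m = sgn z ^ m"
    by (simp add: sgn_div_norm norm_mult power_mult_distrib assms)
  then show ?thesis using c by (simp add: D_def norm_mult)
qed

lemma log_pot_rotation:
  assumes "c ^ m = 1"
  shows "log_pot D (c * x) = log_pot D x"
proof -
  have c: "cmod c = 1" using assms by (rule norm_root_of_unity)
  have "log_pot D (c * x) = (LINT y|distr lborel borel (\<lambda>z. c * z). indicator D y * ln (cmod (c * x - y)))"
    by (simp add: log_pot_def lborel_rotation[OF c])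
  also have "\<dots> = (LINT y|lborel. indicator D (c * y) * ln (cmod (c * x - c * y)))"
    by (subst integral_distr) auto
  also have "\<dots> = log_pot D x"
    unfolding log_pot_def using D_rotation[OF assms] c
    by (intro Bochner_Integration.integral_cong refl) (auto simp: indicator_def norm_mult simp flip: right_diff_distrib)
  finally show ?thesis .
qed

text \<open>The potential is unchanged by the rotations of order \<open>m\<close>. Summing the
  kernel over them gives the logarithm of a product over the roots of unity.\<close>

lemma log_pot_power:
  "has_bochner_integral lborel (\<lambda>y. indicator D y * ln (cmod (x ^ m - y ^ m))) (real m * log_pot D x)"
proof -
  let ?U = "{z::complex. z ^ m = 1}"
  have fin: "finite ?U" and card: "card ?U = m"
    using m_pos card_roots_unity_eq[OF m_pos] by (auto intro: finite_roots_unity)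
  have "has_bochner_integral lborel (\<lambda>y. \<Sum>z\<in>?U. indicator D y * ln (cmod (z * x - y))) (\<Sum>z\<in>?U. log_pot D (z * x))"
    using integrable_log[OF D_borel D_bounded]
    by (intro has_bochner_integral_sum) (auto simp: has_bochner_integral_iff log_pot_def)
  also have "(\<Sum>z\<in>?U. log_pot D (z * x)) = real m * log_pot D x"
    using log_pot_rotation card by simp
  finally have I: "has_bochner_integral lborel (\<lambda>y. \<Sum>z\<in>?U. indicator D y * ln (cmod (z * x - y))) (real m * log_pot D x)" .
  have "AE y in lborel. \<forall>z\<in>?U. y \<noteq> z * x"
    using fin by (subst AE_finite_all) (auto intro: AE_lborel_singleton)
  then have "AE y in lborel. (\<Sum>z\<in>?U. indicator D y * ln (cmod (z * x - y))) = indicator D y * ln (cmod (x ^ m - y ^ m))"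
  proof eventually_elim
    case (elim y)
    have "(\<Sum>z\<in>?U. ln (cmod (z * x - y))) = ln (\<Prod>z\<in>?U. cmod (z * x - y))"
      using fin elim by (intro ln_prod[symmetric]) auto
    also have "(\<Prod>z\<in>?U. cmod (z * x - y)) = cmod (\<Prod>z\<in>?U. y - z * x)"
      by (simp add: prod_norm norm_minus_commute)
    also have "\<dots> = cmod (x ^ m - y ^ m)"
      by (simp add: prod_roots_of_unity[OF m_pos] norm_minus_commute)
    finally show ?case by (simp add: sum_distrib_left[symmetric])
  qed
  with I show ?thesis
    by (subst (asm) has_bochner_integral_cong_AE[where g = "\<lambda>y. indicator D y * ln (cmod (x ^ m - y ^ m))"]) auto
qed

text \<open>The indicator of \<open>D\<close> in folded coordinates: \<open>w\<close> is the
  \<open>m\<close>-th power of a direction.\<close>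

definition inside :: "real \<times> complex \<Rightarrow> real" where
  "inside = (\<lambda>(\<rho>, w). if \<rho> < s (Re w) then 1 else 0)"

lemma inside_measurable [measurable]: "inside \<in> borel_measurable (borel \<Otimes>\<^sub>M borel)"
  unfolding inside_def by measurable

definition ratio :: "real \<Rightarrow> real \<Rightarrow> real" where
  "ratio r \<rho> = (min r \<rho> / max r \<rho>) ^ m"

lemma ratio_measurable [measurable]: "ratio r \<in> borel_measurable borel"
  unfolding ratio_def by measurable

lemma ratio_bounds: "0 < r \<Longrightarrow> 0 < \<rho> \<Longrightarrow> \<rho> \<noteq> r \<Longrightarrow> 0 < ratio r \<rho> \<and> ratio r \<rho> < 1"
  unfolding ratio_def using m_pos by (auto simp: power_less_one_iff min_def max_def)

lemma log_pot_max_polar: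
  assumes "0 < r"
  shows "has_bochner_integral polar (\<lambda>p. inside p * ln (max r (fst p))) (log_pot_max D r 0)"
proof (rule has_bochner_integral_polar_power[OF m_pos])
  show "has_bochner_integral lborel (\<lambda>y. indicator D y * ln (max r (cmod y))) (log_pot_max D r 0)"
    using integrable_log_max[OF D_borel D_bounded assms, of 0]
    by (simp add: has_bochner_integral_iff log_pot_max_def)
qed (auto simp: inside_def polar_in_D indicator_def norm_mult)

text \<open>From |x^m - \<rho>^m w| the larger of the two radii, raised to the power
  \<open>m\<close>, factors out; if that is \<rho>, a conjugation brings the remaining factor to the
  same form. The factored part integrates to the circular mean, which is subtracted.\<close>

lemma log_pot_decomposition:
  assumes r: "0 < r" and \<beta>: "cmod \<beta> = 1" and x: "x ^ m = of_real (r ^ m) * \<beta>"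
  shows "has_bochner_integral polar (\<lambda>p. inside p * ln (cmod (1 - of_real (ratio r (fst p)) * snd p * cnj \<beta>)))
    (real m * (log_pot D x - log_pot_max D r 0))"
proof -
  let ?k = "\<lambda>p. ln (cmod (1 - of_real (ratio r (fst p)) * snd p * cnj \<beta>))" and ?g = "\<lambda>p. inside p * ln (cmod (x ^ m - of_real (fst p) ^ m * snd p))"
  have "has_bochner_integral polar (\<lambda>p. ?g p) (real m * log_pot D x)"
    by (rule has_bochner_integral_polar_power[OF m_pos _ log_pot_power])
      (auto simp: inside_def polar_in_D indicator_def power_mult_distrib)
  from has_bochner_integral_diff[OF this has_bochner_integral_mult_right[OF log_pot_max_polar[OF r], of "real m"]]
  have I: "has_bochner_integral polar (\<lambda>p. ?g p - real m * (inside p * ln (max r (fst p))))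
    (real m * (log_pot D x - log_pot_max D r 0))"
    by (simp add: right_diff_distrib)
  have "AE p in polar. ?g p - real m * (inside p * ln (max r (fst p)))
    = inside p * ?k p"
    using AE_polar AE_polar_radius[of r]
  proof eventually_elim
    case (elim p)
    define \<rho> w where "\<rho> = fst p" and "w = snd p"
    have \<rho>: "0 < \<rho>" "\<rho> \<noteq> r" and w: "cmod w = 1" using elim by (auto simp: \<rho>_def w_def)
    have cb: "\<beta> * cnj \<beta> = 1" and cw: "w * cnj w = 1"
      using \<beta> w by (simp_all add: complex_norm_square[symmetric])
    define t where "t = ratio r \<rho>"
    have t: "0 < t" "t < 1" using ratio_bounds[OF r \<rho>] by (auto simp: t_def)
    have "cmod (x ^ m - of_real \<rho> ^ m * w) = max r \<rho> ^ m * cmod (1 - of_real t * w * cnj \<beta>)"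
    proof (cases "\<rho> < r")
      case True
      then have "\<rho> ^ m = r ^ m * t" using r \<rho> by (simp add: t_def ratio_def power_divide)
      then have "x ^ m - of_real \<rho> ^ m * w = of_real (r ^ m) * \<beta> * (1 - of_real t * w * cnj \<beta>)"
        using cb unfolding x of_real_power[symmetric] by (simp add: algebra_simps)
      then show ?thesis using True r \<beta> by (simp add: norm_mult norm_power)
    next
      case False
      then have "r ^ m = \<rho> ^ m * t" using r \<rho> by (simp add: t_def ratio_def power_divide)
      then have "x ^ m - of_real \<rho> ^ m * w = - (of_real (\<rho> ^ m) * w * cnj (1 - of_real t * w * cnj \<beta>))"
        using cw unfolding x of_real_power[symmetric] by (simp add: algebra_simps)
      then have "cmod (x ^ m - of_real \<rho> ^ m * w) = \<rho> ^ m * cmod (1 - of_real t * w * cnj \<beta>)"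
        using \<rho> w by (simp only: norm_minus_cancel norm_mult complex_mod_cnj norm_of_real)
          (simp only: abs_of_pos zero_less_power mult_1_right)
      then show ?thesis using False by (simp add: max_def)
    qed
    moreover have "cmod (1 - of_real t * w * cnj \<beta>) > 0"
    proof -
      have "cmod (of_real t * w * cnj \<beta>) < 1" using t w \<beta> by (simp add: norm_mult)
      then show ?thesis by force
    qed
    moreover have "0 < max r \<rho>" using r by simp
    ultimately show ?case
      using m_pos unfolding \<rho>_def[symmetric] w_def[symmetric] t_def[symmetric]
      by (simp add: ln_mult ln_realpow algebra_simps)
  qed
  with I show ?thesis
    by (subst (asm) has_bochner_integral_cong_AE[where g = "\<lambda>p. inside p * ?k p"]) auto
qed

end

section \<open>Radial size of the folded kernel\<close>

lemma neg_ln_one_minus_nn: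
  assumes "0 \<le> t" "t < (1::real)"
  shows "ennreal (- ln (1 - t)) = (\<Sum>j. ennreal (t ^ Suc j / Suc j))"
proof -
  have "(\<lambda>n. - ((- (- t)) ^ n) / real n) sums ln (1 + (- t))"
    by (rule ln_series') (use assms in auto)
  then have "(\<lambda>n. t ^ n / real n) sums (- ln (1 - t))"
    by (simp add: sums_minus[of "\<lambda>n. - (t ^ n / real n)", simplified])
  then have "(\<lambda>n. t ^ Suc n / real (Suc n)) sums (- ln (1 - t))"
    using sums_Suc_iff[of "\<lambda>n. t ^ n / real n" "- ln (1 - t)"] by simp
  then show ?thesis
    using assms by (intro suminf_ennreal_eq[symmetric]) auto
qed

lemma nn_integral_rad_power_inner:
  assumes "0 < r"
  shows "(\<integral>\<^sup>+\<rho>. ennreal ((\<rho> / r) ^ k) * indicator {0..r} \<rho> \<partial>rad) = ennreal (r\<^sup>2 / (k + 2))"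
proof -
  have "(\<integral>\<^sup>+\<rho>. ennreal ((\<rho> / r) ^ k) * indicator {0..r} \<rho> \<partial>rad)
    = (\<integral>\<^sup>+\<rho>\<in>{0..r}. ennreal (\<rho> * (\<rho> / r) ^ k) \<partial>lborel)"
    by (subst nn_integral_rad, measurable, intro nn_integral_cong)
      (auto simp: indicator_def ennreal_mult'')
  also have "\<dots> = ennreal (r\<^sup>2 / (k + 2))"
  proof (rule nn_integral_has_integral_lebesgue')
    define F :: "real \<Rightarrow> real" where "F \<rho> = \<rho> ^ (k + 2) / (r ^ k * (k + 2))" for \<rho>
    have "((\<lambda>\<rho>. \<rho> * (\<rho> / r) ^ k) has_integral (F r - F 0)) {0..r}"
    proof (rule fundamental_theorem_of_calculus)
      fix x
      have "(F has_real_derivative (real (k + 2) * x ^ Suc k) / (r ^ k * (k + 2))) (at x within {0..r})"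
        unfolding F_def using DERIV_pow[of "k + 2" x] by (intro DERIV_cdivide) simp
      also have "(real (k + 2) * x ^ Suc k) / (r ^ k * (k + 2)) = x * (x / r) ^ k"
        using assms by (simp add: power_divide del: of_nat_add)
      finally show "(F has_vector_derivative x * (x / r) ^ k) (at x within {0..r})"
        by (simp add: has_real_derivative_iff_has_vector_derivative)
    qed (use assms in auto)
    then show "((\<lambda>\<rho>. \<rho> * (\<rho> / r) ^ k) has_integral r\<^sup>2 / (k + 2)) {0..r}"
      using assms by (simp add: F_def power_add power2_eq_square)
  qed (use assms in auto)
  finally show ?thesis .
qed

lemma nn_integral_rad_power_outer:
  assumes "0 < r" "r \<le> R" "3 \<le> k"
  shows "(\<integral>\<^sup>+\<rho>. ennreal ((r / \<rho>) ^ k) * indicator {r..R} \<rho> \<partial>rad) \<le> ennreal (r\<^sup>2 / (k - 2))"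
proof -
  have "(\<integral>\<^sup>+\<rho>. ennreal ((r / \<rho>) ^ k) * indicator {r..R} \<rho> \<partial>rad)
    = (\<integral>\<^sup>+\<rho>\<in>{r..R}. ennreal (\<rho> * (r / \<rho>) ^ k) \<partial>lborel)"
    using assms by (subst nn_integral_rad, measurable, intro nn_integral_cong)
      (auto simp: indicator_def ennreal_mult'')
  also have "\<dots> = ennreal (r\<^sup>2 / (k - 2) - r ^ k / (real (k - 2) * R ^ (k - 2)))"
  proof (rule nn_integral_has_integral_lebesgue')
    define F :: "real \<Rightarrow> real" where
      "F \<rho> = - (r ^ k / (real (k - 2) * \<rho> ^ (k - 2)))" for \<rho>
    obtain j where k: "k = j + 3" using assms(3) by (metis add.commute le_Suc_ex)
    have "((\<lambda>\<rho>. \<rho> * (r / \<rho>) ^ k) has_integral (F R - F r)) {r..R}"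
    proof (rule fundamental_theorem_of_calculus[OF assms(2)])
      fix x assume x: "x \<in> {r..R}"
      then have "0 < x" using assms by auto
      have F_eq: "F = (\<lambda>\<rho>. - (r ^ k) / Suc j * inverse (\<rho> ^ Suc j))"
        by (rule ext) (simp add: F_def k divide_inverse eval_nat_numeral)
      have "(F has_real_derivative - (r ^ k) / Suc j * - (inverse (x ^ Suc j) * (Suc j * x ^ j) * inverse (x ^ Suc j)))
        (at x within {r..R})"
        unfolding F_eq using \<open>0 < x\<close> DERIV_pow[of "Suc j" x]
        by (intro DERIV_cmult DERIV_inverse') auto
      also have "- (r ^ k) / Suc j * - (inverse (x ^ Suc j) * (Suc j * x ^ j) * inverse (x ^ Suc j))
        = r ^ k * (inverse (x ^ Suc j) * x ^ j * inverse (x ^ Suc j))"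
        by (simp del: power_Suc of_nat_Suc)
      also have "\<dots> = x * (r / x) ^ k"
        using \<open>0 < x\<close> by (simp add: k power_divide field_simps eval_nat_numeral)
      finally show "(F has_vector_derivative x * (r / x) ^ k) (at x within {r..R})"
        by (simp add: has_real_derivative_iff_has_vector_derivative)
    qed
    moreover have "F r = - (r\<^sup>2 / (k - 2))"
      using assms(1) by (simp add: F_def k eval_nat_numeral)
    ultimately show "((\<lambda>\<rho>. \<rho> * (r / \<rho>) ^ k) has_integral r\<^sup>2 / (k - 2) - r ^ k / (real (k - 2) * R ^ (k - 2))) {r..R}"
      by (simp add: F_def)
  qed (use assms in auto)
  also have "\<dots> \<le> ennreal (r\<^sup>2 / (k - 2))"
    using assms by (intro ennreal_leI) (auto intro!: divide_nonneg_nonneg mult_nonneg_nonneg)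
  finally show ?thesis .
qed

lemma integral_nonpos_AE:
  fixes f :: "'a \<Rightarrow> real"
  assumes "AE x in M. f x \<le> 0"
  shows "integral\<^sup>L M f \<le> 0"
  using integral_nonneg_AE[of "\<lambda>x. - f x" M] assms by simp

context star_patch
begin

text \<open>In the power series of -ln (1 - t) the j-th power of the ratio has exponent
  \<open>k = m * Suc j\<close>, and its radial integral is at most 4 R^2 / k. With the coefficient
  \<open>1 / Suc j\<close> this sums to (4 R^2 / m) pi^2 / 6.\<close>

lemma nn_integral_log_ratio_le:
  assumes r: "0 < r" "r \<le> R" and m: "3 \<le> m"
  shows "(\<integral>\<^sup>+\<rho>. ennreal (- ln (1 - ratio r \<rho>)) * indicator {0<..<R} \<rho> \<partial>rad) \<le> ennreal (12 * R\<^sup>2 / m)"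
proof -
  let ?t = "\<lambda>j \<rho>. ennreal (1 / Suc j) * (ennreal ((\<rho> / r) ^ (m * Suc j)) * indicator {0..r} \<rho>
    + ennreal ((r / \<rho>) ^ (m * Suc j)) * indicator {r..R} \<rho>)"
  have "(\<integral>\<^sup>+\<rho>. ennreal (- ln (1 - ratio r \<rho>)) * indicator {0<..<R} \<rho> \<partial>rad)
    \<le> (\<integral>\<^sup>+\<rho>. (\<Sum>j. ?t j \<rho>) \<partial>rad)"
  proof (rule nn_integral_mono_AE)
    show "AE \<rho> in rad. ennreal (- ln (1 - ratio r \<rho>)) * indicator {0<..<R} \<rho>
      \<le> (\<Sum>j. ?t j \<rho>)"
      using AE_rad_neq[of r]
    proof eventually_elim
      case (elim \<rho>)
      show ?case
      proof (cases "0 < \<rho> \<and> \<rho> < R")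
        case True
        then have t: "0 \<le> ratio r \<rho>" "ratio r \<rho> < 1"
          using ratio_bounds[of r \<rho>] r elim by auto
        have "ennreal (ratio r \<rho> ^ Suc j / Suc j) \<le> ?t j \<rho>" for j
          using True elim r
          by (cases "\<rho> < r") (auto simp: ratio_def ennreal_mult''[symmetric] power_mult power_add)
        then have "(\<Sum>j. ennreal (ratio r \<rho> ^ Suc j / Suc j)) \<le> (\<Sum>j. ?t j \<rho>)"
          by (intro suminf_le) auto
        then show ?thesis using True by (simp add: neg_ln_one_minus_nn[OF t])
      qed simp
    qed
  qed
  also have "\<dots> = (\<Sum>j. \<integral>\<^sup>+\<rho>. ?t j \<rho> \<partial>rad)"
    by (intro nn_integral_suminf) measurable
  also have "\<dots> \<le> (\<Sum>j. ennreal (4 * R\<^sup>2 / m * (1 / (real j + 1)\<^sup>2)))"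
  proof (rule suminf_le)
    fix j
    define k where "k = m * Suc j"
    have k: "3 \<le> k" "real k = real m * (real j + 1)"
      using m by (auto simp: k_def algebra_simps intro: order_trans[OF m])
    have "(\<integral>\<^sup>+\<rho>. ennreal (1 / Suc j) * (ennreal ((\<rho> / r) ^ k) * indicator {0..r} \<rho>
       + ennreal ((r / \<rho>) ^ k) * indicator {r..R} \<rho>) \<partial>rad)
      = ennreal (1 / Suc j) * ((\<integral>\<^sup>+\<rho>. ennreal ((\<rho> / r) ^ k) * indicator {0..r} \<rho> \<partial>rad)
        + (\<integral>\<^sup>+\<rho>. ennreal ((r / \<rho>) ^ k) * indicator {r..R} \<rho> \<partial>rad))"
      by (subst nn_integral_cmult, measurable, subst nn_integral_add) auto
    also have "\<dots> \<le> ennreal (1 / Suc j) * (ennreal (r\<^sup>2 / (k + 2)) + ennreal (r\<^sup>2 / (k - 2)))"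
      using nn_integral_rad_power_inner[OF r(1), of k] nn_integral_rad_power_outer[OF r k(1)]
      by (intro mult_left_mono add_mono) auto
    also have "\<dots> = ennreal (1 / Suc j * (r\<^sup>2 / (k + 2) + r\<^sup>2 / (k - 2)))"
      by (subst ennreal_mult') (simp_all del: of_nat_Suc)
    also have "\<dots> \<le> ennreal (4 * R\<^sup>2 / m * (1 / (real j + 1)\<^sup>2))"
    proof (rule ennreal_leI)
      have rR: "r\<^sup>2 \<le> R\<^sup>2" using r by (intro power_mono) auto
      have "r\<^sup>2 / (k + 2) \<le> R\<^sup>2 / k"
        using rR k by (intro frac_le) auto
      \<comment> \<open>Here \<open>k - 2 \<ge> k / 3\<close>, because
        \<open>3 \<le> k\<close>.\<close>
      moreover have "r\<^sup>2 / (k - 2) \<le> R\<^sup>2 / (k / 3)"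
        using rR k by (intro frac_le) auto
      ultimately have "r\<^sup>2 / (k + 2) + r\<^sup>2 / (k - 2) \<le> 4 * R\<^sup>2 / k" by simp
      then have "1 / Suc j * (r\<^sup>2 / (k + 2) + r\<^sup>2 / (k - 2)) \<le> 1 / Suc j * (4 * R\<^sup>2 / k)"
        by (intro mult_left_mono) auto
      also have "\<dots> = 4 * R\<^sup>2 / m * (1 / (real j + 1)\<^sup>2)"
        by (simp add: k(2) power2_eq_square add.commute)
      finally show "1 / Suc j * (r\<^sup>2 / (k + 2) + r\<^sup>2 / (k - 2)) \<le> 4 * R\<^sup>2 / m * (1 / (real j + 1)\<^sup>2)" .
    qed
    finally show "(\<integral>\<^sup>+\<rho>. ?t j \<rho> \<partial>rad) \<le> ennreal (4 * R\<^sup>2 / m * (1 / (real j + 1)\<^sup>2))"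
      unfolding k_def .
  qed auto
  also have "\<dots> = ennreal (4 * R\<^sup>2 / m * (pi\<^sup>2 / 6))"
    using sums_mult[OF inverse_squares_sums, of "4 * R\<^sup>2 / m"]
    by (intro suminf_ennreal_eq) (auto simp: add.commute)
  also have "\<dots> \<le> ennreal (12 * R\<^sup>2 / m)"
  proof (rule ennreal_leI)
    have "pi\<^sup>2 \<le> 4\<^sup>2" using pi_less_4 by (intro power_mono) auto
    then have "4 * R\<^sup>2 / m * (pi\<^sup>2 / 6) \<le> 4 * R\<^sup>2 / m * 3"
      by (intro mult_left_mono) auto
    then show "4 * R\<^sup>2 / m * (pi\<^sup>2 / 6) \<le> 12 * R\<^sup>2 / m" by simp
  qed
  finally show ?thesis .
qed

lemma integrable_circ_inside:
  assumes "0 < t" "t < 1" "cmod b = 1"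
  shows "integrable circ (\<lambda>w. inside (\<rho>, w) * ln (cmod (1 - of_real t * w * b)))"
proof -
  have "has_bochner_integral circ (\<lambda>w. ln (cmod (1 - (of_real t * b) * w))) 0"
    using assms by (intro circ_log_ball) (simp add: norm_mult)
  then have "integrable circ (\<lambda>w. indicator {w. \<rho> < s (Re w)} w *\<^sub>R ln (cmod (1 - (of_real t * b) * w)))"
    by (intro integrable_mult_indicator) (auto simp: has_bochner_integral_iff)
  then show ?thesis
    by (rule Bochner_Integration.integrable_cong[THEN iffD1, rotated 2]) (auto simp: inside_def indicator_def mult_ac)
qed

text \<open>On the unit circle |1 - t w|^2 = 1 + t (t - 2 Re w). The second alternative accounts for
  \<open>ln 0 = 0\<close>.\<close>

lemma log_kernel_sign:
  assumes "cmod w = 1" "0 < t"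
  shows "ln (cmod (1 - of_real t * w)) \<le> 0 \<longleftrightarrow> t / 2 \<le> Re w \<or> cmod (1 - of_real t * w) = 0"
proof (cases "cmod (1 - of_real t * w) = 0")
  case False
  have "(Re w)\<^sup>2 + (Im w)\<^sup>2 = 1"
    using assms(1) by (simp add: cmod_def)
  then have sq: "(cmod (1 - of_real t * w))\<^sup>2 = 1 + t * (t - 2 * Re w)"
    unfolding cmod_power2 by (simp add: power2_eq_square algebra_simps) algebra
  have "ln (cmod (1 - of_real t * w)) \<le> 0 \<longleftrightarrow> (cmod (1 - of_real t * w))\<^sup>2 \<le> 1"
    using False by (simp add: abs_square_le_1)
  also have "\<dots> \<longleftrightarrow> t / 2 \<le> Re w"
    unfolding sq using assms(2) by (auto simp: mult_le_0_iff)
  finally show ?thesis using False by simp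
qed simp

text \<open>Compare two arcs centred at 1: the one where the kernel is nonpositive and the one
  inside the domain. If the domain contains the first, then leaving out its complement drops only
  nonnegative values from an integral that is 0; otherwise the integrand is nonpositive
  throughout.\<close>

lemma inside_circ_le_0:
  assumes t: "0 < t" "t < 1"
  shows "(LINT w|circ. inside (\<rho>, w) * ln (cmod (1 - of_real t * w))) \<le> 0"
proof -
  let ?k = "\<lambda>w. ln (cmod (1 - of_real t * w))"
  have k: "has_bochner_integral circ (\<lambda>w. ?k w) 0"
    using t by (intro circ_log_ball) simp
  have int: "integrable circ (\<lambda>w. inside (\<rho>, w) * ?k w)"
    using integrable_circ_inside[OF t, of 1 \<rho>] by simp
  show ?thesis
  proof (cases "\<rho> < s (t / 2)")
    case True
    have "(LINT w|circ. inside (\<rho>, w) * ?k w) \<le> (LINT w|circ. ?k w)"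
    proof (rule integral_mono_AE)
      show "AE w in circ. inside (\<rho>, w) * ?k w \<le> ?k w"
        using AE_circ_norm
      proof eventually_elim
        case (elim w)
        show ?case
        proof (cases "inside (\<rho>, w) = 1")
          case False
          then have "s (Re w) \<le> \<rho>" by (auto simp: inside_def split: if_splits)
          then have "\<not> t / 2 \<le> Re w" using True monoD[OF s_mono, of "t/2" "Re w"] by auto
          then have "0 \<le> ?k w"
            using log_kernel_sign[OF elim t(1)] by (cases "cmod (1 - of_real t * w) = 0") (auto simp: not_le)
          then show ?thesis using False by (auto simp: inside_def split: if_splits)
        qed simp
      qed
    qed (use int k in \<open>auto simp: has_bochner_integral_iff\<close>)
    then show ?thesis using k by (simp add: has_bochner_integral_iff)
  next
    case False
    have "AE w in circ. inside (\<rho>, w) * ?k w \<le> 0"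
      using AE_circ_norm
    proof eventually_elim
      case (elim w)
      have "t / 2 \<le> Re w" if "\<rho> < s (Re w)"
        using that False monoD[OF s_mono, of "Re w" "t/2"] by linarith
      then show ?case
        using log_kernel_sign[OF elim t(1)] by (auto simp: inside_def)
    qed
    then show ?thesis by (rule integral_nonpos_AE)
  qed
qed

text \<open>The mirrored comparison: the kernel is now nonnegative on an arc centred at 1 that ends
  where \<open>Re w = - t / 2\<close>. Either the complement of the domain carries only nonpositive
  values, or the domain only nonnegative ones.\<close>

lemma inside_circ_ge_0:
  assumes t: "0 < t" "t < 1"
  shows "0 \<le> (LINT w|circ. inside (\<rho>, w) * ln (cmod (1 + of_real t * w)))"
proof -
  let ?k = "\<lambda>w. ln (cmod (1 + of_real t * w))"
  have k: "has_bochner_integral circ (\<lambda>w. ?k w) 0"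
    using t circ_log_ball[of "- of_real t"] by simp
  have int: "integrable circ (\<lambda>w. inside (\<rho>, w) * ?k w)"
    using integrable_circ_inside[OF t, of "-1" \<rho>] by simp
  have sgn: "?k w \<le> 0 \<longleftrightarrow> Re w \<le> - t / 2 \<or> cmod (1 + of_real t * w) = 0" if "cmod w = 1" for w
    using log_kernel_sign[of "- w" t] that t by auto
  show ?thesis
  proof (cases "\<rho> < s (- t / 2)")
    case True
    have "(LINT w|circ. ?k w) \<le> (LINT w|circ. inside (\<rho>, w) * ?k w)"
    proof (rule integral_mono_AE)
      show "AE w in circ. ?k w \<le> inside (\<rho>, w) * ?k w"
        using AE_circ_norm
      proof eventually_elim
        case (elim w)
        show ?case
        proof (cases "inside (\<rho>, w) = 1")
          case False
          then have "s (Re w) \<le> \<rho>" by (auto simp: inside_def split: if_splits)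
          then have "Re w \<le> - t / 2" using True monoD[OF s_mono, of "-t/2" "Re w"] by linarith
          then have "?k w \<le> 0"
            using sgn[OF elim] by auto
          then show ?thesis using False by (auto simp: inside_def split: if_splits)
        qed simp
      qed
    qed (use int k in \<open>auto simp: has_bochner_integral_iff\<close>)
    then show ?thesis using k by (simp add: has_bochner_integral_iff)
  next
    case False
    have "AE w in circ. 0 \<le> inside (\<rho>, w) * ?k w"
      using AE_circ_norm
    proof eventually_elim
      case (elim w)
      have "\<not> Re w \<le> - t / 2" if "\<rho> < s (Re w)"
        using that False monoD[OF s_mono, of "Re w" "-t/2"] by auto
      then have "0 \<le> ?k w" if "\<rho> < s (Re w)"
        using that sgn[OF elim] by (cases "cmod (1 + of_real t * w) = 0") (auto simp: not_le)
      then show ?case by (auto simp: inside_def)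
    qed
    then show ?thesis by (rule integral_nonneg_AE)
  qed
qed

lemma log_pot_iterated:
  assumes r: "0 < r" and \<beta>: "cmod \<beta> = 1" and x: "x ^ m = of_real (r ^ m) * \<beta>"
  shows "has_bochner_integral rad (\<lambda>\<rho>. LINT w|circ. inside (\<rho>, w) * ln (cmod (1 - of_real (ratio r \<rho>) * w * cnj \<beta>)))
    (real m * (log_pot D x - log_pot_max D r 0))"
proof -
  note I = log_pot_decomposition[OF assms, unfolded has_bochner_integral_iff]
  let ?f = "\<lambda>p. inside p * ln (cmod (1 - of_real (ratio r (fst p)) * snd p * cnj \<beta>))"
  show ?thesis
    using polar.integrable_fst'[of ?f] polar.integral_fst'[of ?f] I
    by (simp add: has_bochner_integral_iff)
qed

lemma AE_rad_ratio: "0 < r \<Longrightarrow> AE \<rho> in rad. 0 < \<rho> \<and> 0 < ratio r \<rho> \<and> ratio r \<rho> < 1"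
  using AE_rad_neq[of r] AE_rad_pos by eventually_elim (use ratio_bounds in auto)

lemma log_pot_tip_le:
  assumes r: "0 < r" and x: "x ^ m = of_real (r ^ m)"
  shows "log_pot D x \<le> log_pot_max D r 0"
proof -
  have "(LINT \<rho>|rad. LINT w|circ. inside (\<rho>, w) * ln (cmod (1 - of_real (ratio r \<rho>) * w * cnj 1))) \<le> 0"
  proof (rule integral_nonpos_AE)
    show "AE \<rho> in rad. (LINT w|circ. inside (\<rho>, w) * ln (cmod (1 - of_real (ratio r \<rho>) * w * cnj 1))) \<le> 0"
      using AE_rad_ratio[OF r] by eventually_elim (simp add: inside_circ_le_0)
  qed
  then have "real m * (log_pot D x - log_pot_max D r 0) \<le> 0"
    using log_pot_iterated[OF r, of 1 x] x by (simp add: has_bochner_integral_iff)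
  then show ?thesis using m_pos by (simp add: mult_le_0_iff)
qed

lemma log_pot_trough_ge:
  assumes r: "0 < r" and x: "x ^ m = - of_real (r ^ m)"
  shows "log_pot_max D r 0 \<le> log_pot D x"
proof -
  have "0 \<le> (LINT \<rho>|rad. LINT w|circ. inside (\<rho>, w) * ln (cmod (1 - of_real (ratio r \<rho>) * w * cnj (-1))))"
  proof (rule integral_nonneg_AE)
    show "AE \<rho> in rad. 0 \<le> (LINT w|circ. inside (\<rho>, w) * ln (cmod (1 - of_real (ratio r \<rho>) * w * cnj (-1))))"
      using AE_rad_ratio[OF r] by eventually_elim (simp add: inside_circ_ge_0)
  qed
  then have "0 \<le> real m * (log_pot D x - log_pot_max D r 0)"
    using log_pot_iterated[OF r, of "-1" x] x by (simp add: has_bochner_integral_iff)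
  then show ?thesis using m_pos by (simp add: zero_le_mult_iff)
qed

end

section \<open>Variation of the potential near the axis between two fingers\<close>

lemma cos_gt_near_0:
  assumes "\<bar>y\<bar> < a" "a \<le> pi"
  shows "cos a < cos (y :: real)"
  using cos_monotone_0_pi[of "\<bar>y\<bar>" a] assms by simp

lemma cos_gt_imp_near_ends:
  assumes X: "0 \<le> X" "X \<le> 2 * pi" and a: "0 \<le> a" "a \<le> pi" and gt: "cos a < cos X"
  shows "X < a \<or> 2 * pi - a < X"
proof (rule ccontr)
  assume "\<not> ?thesis"
  then have "a \<le> X" "X \<le> 2 * pi - a" by auto
  then have "cos X \<le> cos a"
  proof (cases "X \<le> pi")
    case True
    then show ?thesis using a \<open>a \<le> X\<close> by (intro cos_monotone_0_pi_le) auto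
  next
    case False
    then have "cos (2 * pi - X) \<le> cos a"
      using a \<open>X \<le> 2 * pi - a\<close> by (intro cos_monotone_0_pi_le) auto
    then show ?thesis by (simp add: cos_diff)
  qed
  then show False using gt by simp
qed

text \<open>Cut at angle 0, the arc consists of the two end pieces of the interval from 0 to 2 pi.
  The points of either piece that the rotation carries out of the arc lie in an interval of length
  \<delta>; these intervals are \<open>I\<close> and \<open>J\<close>.\<close>

lemma emeasure_circ_window:
  assumes a: "0 \<le> a" "a \<le> pi" and \<delta>: "0 \<le> \<delta>" and \<sigma>: "\<sigma> = \<delta> \<or> \<sigma> = - \<delta>"
  shows "emeasure circ {w. cos a < Re w \<and> Re (w * cis \<sigma>) \<le> cos a} \<le> ennreal (2 * \<delta>)"
proof -
  let ?A = "{w. cos a < Re w \<and> Re (w * cis \<sigma>) \<le> cos a}"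
  define I where "I = (if \<sigma> = \<delta> then {a - \<delta>..a} else {0..\<delta>})"
  define J where "J = (if \<sigma> = \<delta> then {2*pi - \<delta>..2*pi} else {2*pi - a..2*pi - a + \<delta>})"
  have [measurable]: "?A \<in> sets borel" by measurable
  have "emeasure circ ?A = (\<integral>\<^sup>+X. indicator ?A (cis X) * indicator {0..2*pi} X \<partial>lborel)"
    by (subst nn_integral_indicator[symmetric], simp, subst nn_integral_circ) auto
  also have "\<dots> \<le> (\<integral>\<^sup>+X. indicator (I \<union> J) X \<partial>lborel)"
  proof (rule nn_integral_mono)
    fix X :: real
    have "X \<in> I \<union> J" if A: "cis X \<in> ?A" and X: "0 \<le> X" "X \<le> 2 * pi"
    proof -
      from A have 1: "cos a < cos X" and 2: "cos (X + \<sigma>) \<le> cos a"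
        by (auto simp: cos_add)
      have 3: "\<not> \<bar>X + \<sigma>\<bar> < a"
        using cos_gt_near_0[of "X + \<sigma>" a] 2 a by auto
      have "cos (X + \<sigma> - 2 * pi) = cos (X + \<sigma>)" by (simp add: cos_diff)
      then have 4: "\<not> \<bar>X + \<sigma> - 2 * pi\<bar> < a"
        using cos_gt_near_0[of "X + \<sigma> - 2 * pi" a] 2 a by auto
      show ?thesis
        using cos_gt_imp_near_ends[OF X a 1] 3 4 X a \<delta> \<sigma> by (auto simp: I_def J_def)
    qed
    then show "indicator ?A (cis X) * indicator {0..2*pi} X \<le> (indicator (I \<union> J) X :: ennreal)"
      by (auto simp: indicator_def)
  qed
  also have "\<dots> = emeasure lborel (I \<union> J)"
    by (intro nn_integral_indicator) (auto simp: I_def J_def)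
  also have "\<dots> \<le> emeasure lborel I + emeasure lborel J"
    by (intro emeasure_subadditive) (auto simp: I_def J_def)
  also have "\<dots> = ennreal (2 * \<delta>)"
    using \<delta> by (auto simp: I_def J_def ennreal_plus[symmetric] simp del: ennreal_plus)
  finally show ?thesis .
qed

context star_patch
begin

text \<open>Strict monotonicity turns the condition \<rho> < s (Re w) into membership in an arc
  \<open>c < Re w\<close> with \<open>s c = \<rho>\<close>. For other \<rho> the whole circle is
  inside the domain, or none of it, and nothing is lost by rotating.\<close>

lemma measure_rotated_level_set:
  assumes \<delta>: "0 \<le> \<delta>" and \<sigma>: "\<sigma> = \<delta> \<or> \<sigma> = - \<delta>"
  shows "measure circ {w. cmod w = 1 \<and> \<rho> < s (Re w) \<and> \<not> \<rho> < s (Re (w * cis \<sigma>))} \<le> 2 * \<delta>"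
proof -
  let ?A = "{w. cmod w = 1 \<and> \<rho> < s (Re w) \<and> \<not> \<rho> < s (Re (w * cis \<sigma>))}"
  have Re1: "\<bar>Re w\<bar> \<le> 1" if "cmod w = 1" for w using that abs_Re_le_cmod[of w] by simp
  show ?thesis
  proof (cases "R1 \<le> \<rho> \<and> \<rho> < R2")
    case True
    then obtain c where c: "-1 \<le> c" "c \<le> 1" "s c = \<rho>"
      using IVT'[of s "-1" \<rho> 1] continuous_on_subset[OF s_cont] by (auto simp: R1_def R2_def)
    define a where "a = arccos c"
    have a: "0 \<le> a" "a \<le> pi" "cos a = c"
      using c arccos_lbound arccos_ubound by (auto simp: a_def)
    have "s x \<le> s y \<longleftrightarrow> x \<le> y" if "\<bar>x\<bar> \<le> 1" "\<bar>y\<bar> \<le> 1" for x y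
      using that strict_mono_on_less_eq[OF s_strict, of x y] by (simp add: abs_le_iff)
    then have iff: "s x \<le> \<rho> \<longleftrightarrow> x \<le> c" if "\<bar>x\<bar> \<le> 1" for x
      using that c by force
    have "?A \<subseteq> {w. cos a < Re w \<and> Re (w * cis \<sigma>) \<le> cos a}"
    proof
      fix w assume w: "w \<in> ?A"
      then have "\<bar>Re w\<bar> \<le> 1" "\<bar>Re (w * cis \<sigma>)\<bar> \<le> 1"
        by (auto intro!: Re1 simp: norm_mult simp del: times_complex.sel)
      then show "w \<in> {w. cos a < Re w \<and> Re (w * cis \<sigma>) \<le> cos a}"
        using w iff[of "Re w"] iff[of "Re (w * cis \<sigma>)"] unfolding a(3) by (auto simp: not_less not_le)
    qed
    then have "emeasure circ ?A \<le> emeasure circ {w. cos a < Re w \<and> Re (w * cis \<sigma>) \<le> cos a}"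
      by (intro emeasure_mono) auto
    also have "\<dots> \<le> ennreal (2 * \<delta>)"
      by (rule emeasure_circ_window[OF a(1,2) assms])
    finally show ?thesis
      using \<delta> by (simp add: circ.emeasure_eq_measure)
  next
    case False
    have bounds: "R1 \<le> s (Re w)" "s (Re w) \<le> R2" if "cmod w = 1" for w
      using Re1[OF that] by (auto simp: R1_def R2_def intro!: monoD[OF s_mono])
    have "w \<notin> ?A" for w
    proof
      assume w: "w \<in> ?A"
      then have "cmod w = 1" "cmod (w * cis \<sigma>) = 1" by (auto simp: norm_mult)
      from bounds(2)[OF this(1)] bounds(1)[OF this(2)] w False show False by auto
    qed
    then have "?A = {}" by blast
    then show ?thesis using \<delta> by (simp only: measure_empty)
  qed
qed

text \<open>Rotation invariance moves the rotation from the kernel to the domain. The difference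
  then lives where the domain and its rotated copy differ, namely on \<open>A\<close> and
  \<open>B'\<close> of measure at most 2 \<delta> each, and the kernel is bounded there by -ln (1 -
  t).\<close>

lemma inside_circ_rotation_diff:
  assumes t: "0 < t" "t < 1" and \<delta>: "0 \<le> \<delta>"
  shows "(LINT w|circ. inside (\<rho>, w) * ln (cmod (1 + of_real t * w)))
    - (LINT w|circ. inside (\<rho>, w) * ln (cmod (1 + of_real t * w * cis \<delta>))) \<le> 4 * \<delta> * (- ln (1 - t))"
proof -
  define k where "k w = ln (cmod (1 + of_real t * w))" for w :: complex
  have k_meas [measurable]: "k \<in> borel_measurable borel" unfolding k_def by measurable
  have k_le: "\<bar>k w\<bar> \<le> - ln (1 - t)" if "cmod w = 1" for w
  proof -
    have "1 - t \<le> cmod (1 + of_real t * w)"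
      using norm_diff_ineq[of 1 "of_real t * w"] that t by (simp add: norm_mult)
    moreover have "cmod (1 + of_real t * w) \<le> 1 + t"
      using norm_triangle_ineq[of 1 "of_real t * w"] that t by (simp add: norm_mult)
    moreover have "1 + t \<le> 1 / (1 - t)"
      using t by (simp add: field_simps)
    ultimately have "ln (1 - t) \<le> k w" "k w \<le> ln (1 / (1 - t))"
      using t unfolding k_def by (auto intro!: ln_mono)
    then show ?thesis using t by (simp add: ln_div)
  qed
  have int1: "integrable circ (\<lambda>w. inside (\<rho>, w) * k w)"
    using integrable_circ_inside[OF t, of "-1" \<rho>] by (simp add: k_def)
  have int2: "integrable circ (\<lambda>w. inside (\<rho>, w) * k (w * cis \<delta>))"
    using integrable_circ_inside[OF t, of "- cis \<delta>" \<rho>] by (simp add: k_def mult_ac)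
  have rot: "distr circ borel (\<lambda>w. cis \<delta> * w) = circ" by (rule circ_rotation) simp
  have "integrable (distr circ borel (\<lambda>w. cis \<delta> * w)) (\<lambda>w. inside (\<rho>, w * cis (- \<delta>)) * k w)"
    using int2 by (subst integrable_distr_eq) (auto simp: mult_ac cis_mult)
  then have int3: "integrable circ (\<lambda>w. inside (\<rho>, w * cis (- \<delta>)) * k w)" by (simp add: rot)
  have "(LINT w|circ. inside (\<rho>, w * cis (- \<delta>)) * k w) =
    (LINT w|distr circ borel (\<lambda>w. cis \<delta> * w). inside (\<rho>, w * cis (- \<delta>)) * k w)" by (simp add: rot)
  also have "\<dots> = (LINT w|circ. inside (\<rho>, w) * k (w * cis \<delta>))"
    by (subst integral_distr) (auto simp: mult_ac cis_mult)
  finally have eq: "(LINT w|circ. inside (\<rho>, w) * k (w * cis \<delta>)) = (LINT w|circ. inside (\<rho>, w * cis (- \<delta>)) * k w)"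
    by simp
  define A where "A = {w. cmod w = 1 \<and> \<rho> < s (Re w) \<and> \<not> \<rho> < s (Re (w * cis (- \<delta>)))}"
  define B where "B = {w. cmod w = 1 \<and> \<rho> < s (Re w) \<and> \<not> \<rho> < s (Re (w * cis \<delta>))}"
  define B' where "B' = {w. cmod w = 1 \<and> \<rho> < s (Re (w * cis (- \<delta>))) \<and> \<not> \<rho> < s (Re w)}"
  have [measurable]: "A \<in> sets borel" "B \<in> sets borel" "B' \<in> sets borel"
    unfolding A_def B_def B'_def by measurable
  have "measure circ B' = measure (distr circ borel (\<lambda>w. cis \<delta> * w)) B'" by (simp add: rot)
  also have "\<dots> = measure circ ((\<lambda>w. cis \<delta> * w) -` B')"
    by (subst measure_distr) auto
  also have "(\<lambda>w. cis \<delta> * w) -` B' = B"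
  proof -
    have "cis \<delta> * w * cis (- \<delta>) = w" for w
      using cis_mult[of \<delta> "- \<delta>"] by (metis add.right_inverse cis_zero mult.commute mult.left_commute mult_1_right)
    then show ?thesis
      unfolding B'_def B_def vimage_def mem_Collect_eq by (simp only: norm_mult norm_cis mult_1_left) (simp only: mult.commute)
  qed
  finally have mB': "measure circ B' \<le> 2 * \<delta>"
    using measure_rotated_level_set[OF \<delta>, of \<delta> \<rho>] by (simp add: B_def)
  have mA: "measure circ A \<le> 2 * \<delta>"
    using measure_rotated_level_set[OF \<delta>, of "-\<delta>" \<rho>] by (simp add: A_def)
  have "(LINT w|circ. inside (\<rho>, w) * k w) - (LINT w|circ. inside (\<rho>, w * cis (- \<delta>)) * k w)
    = (LINT w|circ. inside (\<rho>, w) * k w - inside (\<rho>, w * cis (- \<delta>)) * k w)"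
    using int1 int3 by simp
  also have "\<dots> \<le> (LINT w|circ. (- ln (1 - t)) * (indicator A w + indicator B' w))"
  proof (rule integral_mono_AE)
    show "AE w in circ. inside (\<rho>, w) * k w - inside (\<rho>, w * cis (- \<delta>)) * k w
      \<le> (- ln (1 - t)) * (indicator A w + indicator B' w)"
      using AE_circ_norm
    proof eventually_elim
      case (elim w)
      show ?case
        using k_le[OF elim] elim by (auto simp: inside_def A_def B'_def indicator_def abs_le_iff)
    qed
  next
    have "integrable circ (\<lambda>w. indicator A w + indicator B' w :: real)"
      by (intro Bochner_Integration.integrable_add integrable_real_indicator) (auto simp: circ.emeasure_eq_measure)
    then show "integrable circ (\<lambda>w. (- ln (1 - t)) * (indicator A w + indicator B' w))"
      by (rule integrable_mult_right)
  qed (use int1 int3 in auto)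
  also have "\<dots> = (- ln (1 - t)) * (measure circ A + measure circ B')"
    by (subst integral_mult_right_zero) (simp add: circ.emeasure_eq_measure)
  also have "\<dots> \<le> (- ln (1 - t)) * (2 * \<delta> + 2 * \<delta>)"
    using mA mB' t by (intro mult_left_mono add_mono) auto
  finally show ?thesis
    using eq unfolding k_def by (simp add: mult_ac)
qed

text \<open>After folding, \<open>y\<close> is at angle \<delta> from the axis between two fingers.
  One factor 1/m comes from the folding and one from the radial integral of the kernel; 48 is 4
  times 12.\<close>

lemma log_pot_near_trough:
  assumes r: "0 < r" "r \<le> R2" and m: "3 \<le> m" and \<delta>: "0 \<le> \<delta>"
    and x: "x ^ m = - of_real (r ^ m)" and y: "y ^ m = of_real (r ^ m) * cis (pi - \<delta>)"
  shows "log_pot D x - log_pot D y \<le> 48 * \<delta> * R2\<^sup>2 / m\<^sup>2"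
proof -
  have cb: "cnj (cis (pi - \<delta>)) = - cis \<delta>"
    by (simp add: complex_eq_iff)
  define f g where "f \<rho> = (LINT w|circ. inside (\<rho>, w) * ln (cmod (1 + of_real (ratio r \<rho>) * w)))"
    and "g \<rho> = (LINT w|circ. inside (\<rho>, w) * ln (cmod (1 + of_real (ratio r \<rho>) * w * cis \<delta>)))" for \<rho>
  define L where "L \<rho> = - ln (1 - ratio r \<rho>) * indicator {0<..<R2} \<rho>" for \<rho>
  have f: "has_bochner_integral rad f (real m * (log_pot D x - log_pot_max D r 0))"
    using log_pot_iterated[OF r(1), of "-1" x] x by (simp add: f_def[abs_def])
  have g: "has_bochner_integral rad g (real m * (log_pot D y - log_pot_max D r 0))"
    using log_pot_iterated[OF r(1), of "cis (pi - \<delta>)" y] y unfolding cb by (simp add: g_def[abs_def])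
  have [measurable]: "L \<in> borel_measurable borel" unfolding L_def by measurable
  have L0: "AE \<rho> in rad. 0 \<le> L \<rho>"
    using AE_rad_ratio[OF r(1)] by eventually_elim (auto simp: L_def indicator_def)
  have "(\<integral>\<^sup>+\<rho>. ennreal (L \<rho>) \<partial>rad) = (\<integral>\<^sup>+\<rho>. ennreal (- ln (1 - ratio r \<rho>)) * indicator {0<..<R2} \<rho> \<partial>rad)"
    by (intro nn_integral_cong) (auto simp: L_def indicator_def)
  then have L_le: "(\<integral>\<^sup>+\<rho>. ennreal (L \<rho>) \<partial>rad) \<le> ennreal (12 * R2\<^sup>2 / m)"
    using nn_integral_log_ratio_le[OF r m] by simp
  then have L_int: "integrable rad L"
    using L0 by (intro integrableI_nonneg) (auto simp: top_unique less_top[symmetric])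
  then have "ennreal (LINT \<rho>|rad. L \<rho>) \<le> ennreal (12 * R2\<^sup>2 / m)"
    using L_le nn_integral_eq_integral[OF L_int L0] by simp
  then have L_I: "(LINT \<rho>|rad. L \<rho>) \<le> 12 * R2\<^sup>2 / m"
    by (subst (asm) ennreal_le_iff) auto
  have "real m * (log_pot D x - log_pot D y) = (LINT \<rho>|rad. f \<rho> - g \<rho>)"
    using f g by (simp add: has_bochner_integral_iff algebra_simps)
  also have "\<dots> \<le> (LINT \<rho>|rad. 4 * \<delta> * L \<rho>)"
  proof (rule integral_mono_AE)
    show "AE \<rho> in rad. f \<rho> - g \<rho> \<le> 4 * \<delta> * L \<rho>"
      using AE_rad_ratio[OF r(1)]
    proof eventually_elim
      case (elim \<rho>)
      show ?case
      proof (cases "\<rho> < R2")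
        case True
        then show ?thesis
          using inside_circ_rotation_diff[of "ratio r \<rho>" \<delta> \<rho>] elim \<delta> by (simp add: f_def g_def L_def)
      next
        case False
        \<comment> \<open>Beyond \<open>R2\<close> circles miss the domain, and both inner integrals
          vanish; this justifies cutting \<open>L\<close> off at \<open>R2\<close>.\<close>
        have "AE w in circ. inside (\<rho>, w) = 0"
          using AE_circ_norm
        proof eventually_elim
          case (elim w)
          have "s (Re w) \<le> R2"
            unfolding R2_def using elim abs_Re_le_cmod[of w] by (intro monoD[OF s_mono]) auto
          then show ?case using False by (auto simp: inside_def)
        qed
        then have "f \<rho> = 0" "g \<rho> = 0"
          unfolding f_def g_def by (auto intro!: integral_eq_zero_AE elim: eventually_mono)
        then show ?thesis using False by (simp add: L_def)
      qed
    qed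
  qed (use f g L_int in \<open>auto simp: has_bochner_integral_iff\<close>)
  also have "\<dots> = 4 * \<delta> * (LINT \<rho>|rad. L \<rho>)" by simp
  also have "\<dots> \<le> 4 * \<delta> * (12 * R2\<^sup>2 / m)"
    using L_I \<delta> by (intro mult_left_mono) auto
  finally have "real m * (log_pot D x - log_pot D y) \<le> 48 * \<delta> * R2\<^sup>2 / m" by simp
  then show ?thesis using m_pos by (simp add: field_simps power2_eq_square)
qed

end

section \<open>Rotating star-shaped domains\<close>

text \<open>At a minimum point with value below \<open>b\<close>, the mean over the circle would be
  at least the value at its centre. As the inequality is strict, this single circle is contradictory
  and the minimum need not be propagated.\<close>

lemma circle_mean_min_principle:
  fixes f :: "complex \<Rightarrow> real"
  assumes K: "compact K" "continuous_on K f"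
    and step: "\<And>x. x \<in> K \<Longrightarrow> b \<le> f x \<or> (\<exists>d. (\<forall>w. cmod w = 1 \<longrightarrow> x + of_real d * w \<in> K) \<and>
      (\<exists>I. has_bochner_integral circ (\<lambda>w. f (x + of_real d * w)) I \<and> I < 2 * pi * f x))"
    and x: "x \<in> K"
  shows "b \<le> f x"
proof -
  obtain x0 where x0: "x0 \<in> K" "\<And>y. y \<in> K \<Longrightarrow> f x0 \<le> f y"
    using continuous_attains_inf[OF K(1) _ K(2)] x by blast
  have "b \<le> f x0"
  proof (rule ccontr)
    assume "\<not> b \<le> f x0"
    then obtain d I where d: "\<And>w. cmod w = 1 \<Longrightarrow> x0 + of_real d * w \<in> K"
      and I: "has_bochner_integral circ (\<lambda>w. f (x0 + of_real d * w)) I" "I < 2 * pi * f x0"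
      using step[OF x0(1)] by blast
    have "(LINT w|circ. f x0) \<le> (LINT w|circ. f (x0 + of_real d * w))"
    proof (rule integral_mono_AE)
      show "AE w in circ. f x0 \<le> f (x0 + of_real d * w)"
        using AE_circ_norm by eventually_elim (intro x0(2) d)
    qed (use I in \<open>auto simp: has_bochner_integral_iff\<close>)
    moreover have "(LINT w|circ. f x0) = 2 * pi * f x0"
      using integral_circ_const[of "f x0"] unfolding has_bochner_integral_iff ..
    moreover have "(LINT w|circ. f (x0 + of_real d * w)) = I"
      using I(1) unfolding has_bochner_integral_iff ..
    ultimately show False using I(2) by linarith
  qed
  then show ?thesis using x0(2)[OF x] by linarith
qed

lemma circ_mean_norm_sq:
  "has_bochner_integral circ (\<lambda>w. (cmod (x + of_real d * w))\<^sup>2) (2 * pi * ((cmod x)\<^sup>2 + d\<^sup>2))"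
proof -
  have "has_bochner_integral circ (\<lambda>w. Re (2 * of_real d * cnj x * w)) (2 * pi * Re (2 * of_real d * cnj x * 0))"
    by (rule circ_mean_Re_holomorphic[of "\<lambda>w. 2 * of_real d * cnj x * w" 2]) (auto intro!: holomorphic_intros)
  from has_bochner_integral_add[OF integral_circ_const[of "(cmod x)\<^sup>2 + d\<^sup>2"] this]
  have I: "has_bochner_integral circ (\<lambda>w. (cmod x)\<^sup>2 + d\<^sup>2 + Re (2 * of_real d * cnj x * w)) (2 * pi * ((cmod x)\<^sup>2 + d\<^sup>2))"
    by simp
  have "AE w in circ. (cmod x)\<^sup>2 + d\<^sup>2 + Re (2 * of_real d * cnj x * w) = (cmod (x + of_real d * w))\<^sup>2"
    using AE_circ_norm
  proof eventually_elim
    case (elim w)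
    then have w: "(Re w)\<^sup>2 + (Im w)\<^sup>2 = 1" by (simp add: cmod_def)
    have "(cmod (x + of_real d * w))\<^sup>2 = (cmod x)\<^sup>2 + d\<^sup>2 * ((Re w)\<^sup>2 + (Im w)\<^sup>2) + Re (2 * of_real d * cnj x * w)"
      unfolding cmod_power2 by (simp add: power2_eq_square algebra_simps)
    then show ?case by (simp add: w)
  qed
  with I show ?thesis
    by (subst (asm) has_bochner_integral_cong_AE[where g = "\<lambda>w. (cmod (x + of_real d * w))\<^sup>2"]) auto
qed

lemma circ_mean_inverse_power:
  assumes "0 < d" "d < cmod x"
  shows "has_bochner_integral circ (\<lambda>w. Re (inverse ((x + of_real d * w) ^ k))) (2 * pi * Re (inverse (x ^ k)))"
proof -
  have "x + of_real d * w \<noteq> 0" if "w \<in> ball 0 (cmod x / d)" for w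
  proof
    assume "x + of_real d * w = 0"
    then have "cmod x = d * cmod w" using assms by (metis add_eq_0_iff norm_minus_cancel norm_mult norm_of_real abs_of_pos)
    then show False using that assms by (simp add: field_simps)
  qed
  then have "(\<lambda>w. inverse ((x + of_real d * w) ^ k)) holomorphic_on ball 0 (cmod x / d)"
    by (intro holomorphic_intros) auto
  moreover have "1 < cmod x / d" using assms by (simp add: field_simps)
  moreover have "(\<lambda>w. Re (inverse ((x + of_real d * w) ^ k))) \<in> borel_measurable borel" by measurable
  ultimately show ?thesis
    using circ_mean_Re_holomorphic[of "\<lambda>w. inverse ((x + of_real d * w) ^ k)" "cmod x / d" "\<lambda>w. Re (inverse ((x + of_real d * w) ^ k))"]
    by simp
qed

lemma measure_rad_interval:
  assumes "0 \<le> a" "a \<le> b"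
  shows "emeasure rad {a..b} = ennreal ((b\<^sup>2 - a\<^sup>2) / 2)"
proof -
  have "emeasure rad {a..b} = (\<integral>\<^sup>+\<rho>. ennreal \<rho> * indicator {a..b} \<rho> \<partial>lborel)"
    by (subst nn_integral_indicator[symmetric], simp, subst nn_integral_rad) auto
  also have "\<dots> = ennreal ((b\<^sup>2 - a\<^sup>2) / 2)"
  proof (rule nn_integral_has_integral_lebesgue')
    show "((\<lambda>\<rho>. \<rho>) has_integral (b\<^sup>2 - a\<^sup>2) / 2) {a..b}"
      using ident_has_integral[OF assms(2)] by simp
  qed (use assms in auto)
  finally show ?thesis .
qed

locale rotating_star_patch = star_patch +
  fixes \<Omega> C :: real
  assumes \<Omega>: "0 < \<Omega>" "\<Omega> < 1/2" and m_ge: "4 \<le> m" and D_open: "open D"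
    and boundary: "\<And>x. x \<in> frontier D \<Longrightarrow> log_pot D x / (2 * pi) - \<Omega> / 2 * (cmod x)\<^sup>2 = C"
begin

definition psi :: "complex \<Rightarrow> real" where
  "psi x = log_pot D x / (2 * pi) - \<Omega> / 2 * (cmod x)\<^sup>2"

text \<open>A quarter of the Laplacian of \<open>psi\<close> in \<open>D\<close>: over a circle of
  radius d whose disc lies in \<open>D\<close>, the mean exceeds the central value by e d^2.\<close>

definition e :: real where "e = (1 - 2 * \<Omega>) / 4"

lemma e_pos: "0 < e" using \<Omega> by (simp add: e_def)

lemma psi_cont: "continuous_on A psi"
  unfolding psi_def
  by (intro continuous_intros continuous_on_subset[OF continuous_log_pot[OF D_borel D_bounded]]) auto

lemma boundary_point:
  assumes "cmod w = 1"
  shows "of_real (s (Re (w ^ m))) * w \<in> frontier D"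
proof -
  define S where "S = s (Re (w ^ m))"
  have S: "0 < S" using R1_le_s[of w] R1_pos assms by (simp add: S_def)
  have "of_real S * w \<notin> D"
    using polar_in_D[OF S assms] by (simp add: S_def)
  moreover have "of_real S * w \<in> closure D"
    unfolding closure_approachable
  proof (intro allI impI)
    fix \<epsilon> :: real assume \<epsilon>: "0 < \<epsilon>"
    define h where "h = min (\<epsilon> / 2) (S / 2)"
    have h: "0 < h" "h < \<epsilon>" "h < S" using \<epsilon> S by (auto simp: h_def)
    have "of_real (S - h) * w \<in> D"
      using h polar_in_D[of "S - h" w] assms by (simp add: S_def)
    moreover have "dist (of_real (S - h) * w) (of_real S * w) < \<epsilon>"
      using h assms by (simp add: dist_norm norm_mult flip: left_diff_distrib of_real_diff)
    ultimately show "\<exists>y\<in>D. dist y (of_real S * w) < \<epsilon>" by blast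
  qed
  ultimately show ?thesis
    using D_open by (simp add: frontier_def interior_open S_def)
qed

lemma psi_boundary: "x \<in> frontier D \<Longrightarrow> psi x = C"
  using boundary by (simp add: psi_def)

lemma psi_circle_mean:
  assumes d: "0 < d" and sub: "ball x d \<subseteq> D"
  shows "has_bochner_integral circ (\<lambda>w. psi (x + of_real d * w)) (2 * pi * (psi x + e * d\<^sup>2))"
proof -
  have "has_bochner_integral circ (\<lambda>w. log_pot D (x + of_real d * w) / (2 * pi) - \<Omega> / 2 * (cmod (x + of_real d * w))\<^sup>2)
    (2 * pi * (log_pot D x + pi * d\<^sup>2 / 2) / (2 * pi) - \<Omega> / 2 * (2 * pi * ((cmod x)\<^sup>2 + d\<^sup>2)))"
    by (intro has_bochner_integral_diff has_bochner_integral_divide_zero has_bochner_integral_mult_right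
      circle_mean_log_pot_interior D_borel D_bounded d sub circ_mean_norm_sq)
  moreover have "2 * pi * (log_pot D x + pi * d\<^sup>2 / 2) / (2 * pi) - \<Omega> / 2 * (2 * pi * ((cmod x)\<^sup>2 + d\<^sup>2))
    = 2 * pi * (psi x + e * d\<^sup>2)"
    by (simp add: psi_def e_def field_simps)
  ultimately show ?thesis unfolding psi_def by simp
qed

text \<open>Subtracting twice \<open>e\<close> times |x|^2, rather than once, makes the function
  strictly superharmonic: its circular means fall e d^2 below the central value. On the frontier
  \<open>psi\<close> is the constant \<open>C\<close>, and |x| is at most \<open>R2\<close>.\<close>

lemma psi_lower_bound:
  assumes "x \<in> closure D"
  shows "C - 2 * e * (R2\<^sup>2 - (cmod x)\<^sup>2) \<le> psi x"
proof -
  define f where "f x = psi x - 2 * e * (cmod x)\<^sup>2" for x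
  have cl: "cmod y \<le> R2" if "y \<in> closure D" for y
    using closure_mono[OF D_subset] that R1_pos R1_less_R2 by (auto simp: dist_norm)
  have "C - 2 * e * R2\<^sup>2 \<le> f x"
  proof (rule circle_mean_min_principle[OF _ _ _ assms])
    show "compact (closure D)" using D_bounded by (simp add: compact_closure)
    show "continuous_on (closure D) f"
      unfolding f_def by (intro continuous_intros psi_cont)
    fix y assume y: "y \<in> closure D"
    show "C - 2 * e * R2\<^sup>2 \<le> f y \<or> (\<exists>d. (\<forall>w. cmod w = 1 \<longrightarrow> y + of_real d * w \<in> closure D) \<and>
      (\<exists>I. has_bochner_integral circ (\<lambda>w. f (y + of_real d * w)) I \<and> I < 2 * pi * f y))"
    proof (cases "y \<in> D")
      case False
      then have "y \<in> frontier D" using y D_open by (simp add: frontier_def interior_open)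
      moreover have "(cmod y)\<^sup>2 \<le> R2\<^sup>2" using cl[OF y] by (intro power_mono) auto
      ultimately have "C - 2 * e * R2\<^sup>2 \<le> f y"
        using e_pos by (simp add: f_def psi_boundary)
      then show ?thesis ..
    next
      case True
      then obtain d where d: "0 < d" "cball y d \<subseteq> D"
        using D_open by (auto simp: open_contains_cball)
      have "\<forall>w. cmod w = 1 \<longrightarrow> y + of_real d * w \<in> closure D"
        using d closure_subset by (force simp: dist_norm norm_mult)
      moreover have "has_bochner_integral circ (\<lambda>w. f (y + of_real d * w))
        (2 * pi * (psi y + e * d\<^sup>2) - 2 * e * (2 * pi * ((cmod y)\<^sup>2 + d\<^sup>2)))"
        unfolding f_def using d ball_subset_cball
        by (intro has_bochner_integral_diff psi_circle_mean has_bochner_integral_mult_right circ_mean_norm_sq) auto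
      moreover have "2 * pi * (psi y + e * d\<^sup>2) - 2 * e * (2 * pi * ((cmod y)\<^sup>2 + d\<^sup>2)) < 2 * pi * f y"
        using d e_pos by (simp add: f_def algebra_simps)
      ultimately show ?thesis by blast
    qed
  qed
  then show ?thesis by (simp add: f_def algebra_simps)
qed

text \<open>A closed sector of the patch, with its boundary, outside the open disc of radius
  \<open>R1\<close>. Since \<open>s (-1) = R1\<close>, the sides of the sector meet it only on the
  inner circle; its boundary is thus part of the frontier of \<open>D\<close> together with an arc
  of that circle.\<close>

definition finger :: "complex set" where
  "finger = (\<lambda>p. of_real (fst p) * cis (snd p)) `
     {p \<in> {R1..R2} \<times> {- pi / m..pi / m}. fst p \<le> s (cos (real m * snd p))}"

lemma finger_compact: "compact finger"
proof -
  have "compact (({R1..R2} \<times> {- pi / m..pi / m}) \<inter> {p :: real \<times> real. fst p \<le> s (cos (real m * snd p))})"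
    by (intro compact_Int_closed compact_Times compact_Icc closed_Collect_le continuous_intros
      continuous_on_compose2[OF s_cont]) auto
  then show ?thesis
    unfolding finger_def by (intro compact_continuous_image continuous_intros) (simp add: Int_def conj_commute)
qed

lemma Re_cis_power: "Re (cis \<theta> ^ m) = cos (real m * \<theta>)"
  by (simp add: Complex.DeMoivre)

lemma finger_dist:
  assumes "x \<in> finger"
  shows "cmod (x - of_real R1) \<le> (R2 - R1) + R1 * (pi / m)"
proof -
  obtain \<rho> \<theta> where x: "x = of_real \<rho> * cis \<theta>" and \<rho>: "R1 \<le> \<rho>" "\<rho> \<le> R2" and \<theta>: "\<bar>\<theta>\<bar> \<le> pi / m"
    using assms by (auto simp: finger_def abs_le_iff)
  have "cmod (cis \<theta> - 1) = 2 * \<bar>sin (\<theta> / 2)\<bar>"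
    using dist_exp_i_1[of \<theta>] by (simp add: cis_conv_exp)
  also have "\<dots> \<le> \<bar>\<theta>\<bar>"
    using abs_sin_x_le_abs_x[of "\<theta> / 2"] by simp
  finally have c: "cmod (cis \<theta> - 1) \<le> pi / m" using \<theta> by linarith
  have "x - of_real R1 = of_real (\<rho> - R1) * cis \<theta> + of_real R1 * (cis \<theta> - 1)"
    by (simp add: x algebra_simps)
  then have "cmod (x - of_real R1) \<le> cmod (of_real (\<rho> - R1) * cis \<theta>) + cmod (of_real R1 * (cis \<theta> - 1))"
    by (metis norm_triangle_ineq)
  also have "\<dots> = (\<rho> - R1) + R1 * cmod (cis \<theta> - 1)"
    using \<rho> R1_pos by (simp add: norm_mult del: of_real_diff)
  also have "\<dots> \<le> (R2 - R1) + R1 * (pi / m)"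
    using \<rho> R1_pos c by (intro add_mono mult_left_mono) auto
  finally show ?thesis .
qed

text \<open>The sides of the sector are ruled out, because there the patch ends at
  \<open>R1\<close>. The clause \<open>d < \<rho>\<close> keeps the disc away from the origin, where
  the barrier is singular.\<close>

lemma finger_interior:
  assumes "\<bar>\<theta>\<bar> \<le> pi / m" "R1 < \<rho>" "\<rho> < s (cos (real m * \<theta>))"
  shows "\<exists>d>0. cball (of_real \<rho> * cis \<theta>) d \<subseteq> finger \<inter> D \<and> d < \<rho>"
proof -
  define O' where "O' = D \<inter> (- cball 0 R1) \<inter> {z \<in> - \<real>\<^sub>\<le>\<^sub>0. Arg z \<in> {- pi / m<..<pi / m}}"
  have "continuous_on (- \<real>\<^sub>\<le>\<^sub>0) Arg"
    by (simp add: continuous_at_Arg continuous_at_imp_continuous_on)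
  then have "open {z \<in> - \<real>\<^sub>\<le>\<^sub>0. Arg z \<in> {- pi / m<..<pi / m}}"
    using continuous_open_preimage[of "- \<real>\<^sub>\<le>\<^sub>0" Arg "{- pi / m<..<pi / m}"]
    by (simp add: closed_nonpos_Reals_complex open_Compl Int_def vimage_def conj_commute)
  then have "open O'"
    unfolding O'_def using D_open by (intro open_Int) auto
  have \<rho>: "0 < \<rho>" using assms(2) R1_pos by linarith
  have pm: "pi / m < pi" using m_ge by (simp add: field_simps)
  have "\<bar>\<theta>\<bar> \<noteq> pi / m"
  proof
    assume "\<bar>\<theta>\<bar> = pi / m"
    then have "\<bar>real m * \<theta>\<bar> = pi" using m_pos by (simp add: abs_mult)
    then have "cos \<bar>real m * \<theta>\<bar> = -1" by simp
    then have "cos (real m * \<theta>) = -1" by (simp only: cos_abs_real)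
    then show False using assms by (simp add: R1_def)
  qed
  then have \<theta>: "\<bar>\<theta>\<bar> < pi / m" using assms(1) by simp
  have Arg: "Arg (of_real \<rho> * cis \<theta>) = \<theta>"
    using \<theta> pm \<rho> by (intro Arg_unique[of \<rho>]) (auto simp: cis_conv_exp)
  have "of_real \<rho> * cis \<theta> \<in> O'"
  proof -
    have "of_real \<rho> * cis \<theta> \<in> D"
      using polar_in_D[OF \<rho>, of "cis \<theta>"] assms(3) by (simp add: Re_cis_power)
    moreover have "of_real \<rho> * cis \<theta> \<notin> \<real>\<^sub>\<le>\<^sub>0"
    proof
      assume "of_real \<rho> * cis \<theta> \<in> \<real>\<^sub>\<le>\<^sub>0"
      then obtain c where c: "of_real \<rho> * cis \<theta> = of_real c" "c \<le> 0" by (rule nonpos_Reals_cases)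
      moreover have "of_real \<rho> * cis \<theta> \<noteq> 0" using \<rho> by simp
      ultimately have "c < 0" by (cases "c = 0") auto
      then have "Arg (of_real \<rho> * cis \<theta>) = pi" unfolding c by (simp add: Arg_of_real)
      then show False using Arg \<theta> pm by auto
    qed
    ultimately show ?thesis
      using assms(2) \<rho> \<theta> Arg by (auto simp: O'_def norm_mult abs_less_iff)
  qed
  then obtain d where d: "0 < d" "cball (of_real \<rho> * cis \<theta>) d \<subseteq> O'"
    using \<open>open O'\<close> by (auto simp: open_contains_cball)
  have "O' \<subseteq> finger \<inter> D"
  proof
    fix z assume z: "z \<in> O'"
    then have zD: "z \<in> D" and zR: "R1 < cmod z" and zA: "\<bar>Arg z\<bar> < pi / m" by (auto simp: O'_def)
    have z0: "z \<noteq> 0" using zR R1_pos by auto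
    have zz: "z = of_real (cmod z) * cis (Arg z)"
      using rcis_cmod_Arg[of z] by (simp add: rcis_def)
    have "cmod z < s (cos (real m * Arg z))"
      using polar_in_D[of "cmod z" "cis (Arg z)"] zD z0 zz by (simp add: Re_cis_power)
    moreover have "cmod z \<le> R2" using zD D_subset by force
    ultimately have "z \<in> finger"
      unfolding finger_def using zR zA zz by (intro image_eqI[of _ _ "(cmod z, Arg z)"]) (auto simp: abs_less_iff)
    then show "z \<in> finger \<inter> D" using zD by blast
  qed
  show ?thesis
  proof (intro exI[of _ "min d (\<rho> / 2)"] conjI)
    have "cball (of_real \<rho> * cis \<theta>) (min d (\<rho> / 2)) \<subseteq> cball (of_real \<rho> * cis \<theta>) d" by auto
    then show "cball (of_real \<rho> * cis \<theta>) (min d (\<rho> / 2)) \<subseteq> finger \<inter> D"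
      using d \<open>O' \<subseteq> finger \<inter> D\<close> by blast
  qed (use d \<rho> in auto)
qed

lemma Re_inverse_power_polar:
  assumes "0 < \<rho>"
  shows "Re (inverse ((of_real \<rho> * cis \<theta>) ^ k)) = cos (real k * \<theta>) / \<rho> ^ k"
proof -
  have "inverse ((of_real \<rho> * cis \<theta>) ^ k) = of_real (inverse (\<rho> ^ k)) * cis (- (real k * \<theta>))"
    by (simp add: power_mult_distrib Complex.DeMoivre)
  moreover have "Re (of_real a * cis b) = a * cos b" for a b by simp
  ultimately have "Re (inverse ((of_real \<rho> * cis \<theta>) ^ k)) = inverse (\<rho> ^ k) * cos (- (real k * \<theta>))"
    by metis
  then show ?thesis by (simp add: divide_inverse mult.commute)
qed

text \<open>The exponent \<open>m div 4\<close> keeps the argument of the cosine within pi/4 on the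
  sector, so the barrier is positive there. \<open>M\<close> bounds the deficit of
  \<open>psi\<close> on the inner arc, and \<open>sqrt 2\<close> compensates for the cosine.
  Centring the square at \<open>R1\<close> makes the correction cost only d0^2, with
  \<open>d0\<close> of the size of the finger.\<close>

lemma psi_finger_lower_bound:
  assumes r: "R1 \<le> r" "r \<le> R2" and d0: "(R2 - R1) + R1 * (pi / m) \<le> d0"
  shows "C - 2 * e * d0\<^sup>2 - 2 * e * (R2\<^sup>2 - R1\<^sup>2) * sqrt 2 * (R1 / r) ^ (m div 4) \<le> psi (of_real r)"
proof -
  define k M where "k = m div 4" and "M = 2 * e * (R2\<^sup>2 - R1\<^sup>2)"
  define f where "f x = psi x - 2 * e * (cmod (x - of_real R1))\<^sup>2 + M * sqrt 2 * R1 ^ k * Re (inverse (x ^ k))" for x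
  have "R1\<^sup>2 \<le> R2\<^sup>2" using R1_pos R1_less_R2 by (intro power_mono) auto
  then have M: "0 \<le> M" using e_pos by (simp add: M_def)
  have finger_nz: "R1 \<le> cmod x" if "x \<in> finger" for x
    using that R1_pos by (auto simp: finger_def norm_mult)
  have d0_bound: "(cmod (x - of_real R1))\<^sup>2 \<le> d0\<^sup>2" if "x \<in> finger" for x
    using finger_dist[OF that] d0 by (intro power_mono) auto
  have ck: "1 / sqrt 2 \<le> cos (real k * \<theta>)" if "\<bar>\<theta>\<bar> \<le> pi / m" for \<theta>
  proof -
    have "real k \<le> real m / 4" unfolding k_def by linarith
    then have "\<bar>real k * \<theta>\<bar> \<le> real m / 4 * (pi / m)"
      unfolding abs_mult using that by (intro mult_mono) auto
    then have "\<bar>real k * \<theta>\<bar> \<le> pi / 4" using m_pos by simp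
    then have "cos (pi / 4) \<le> cos \<bar>real k * \<theta>\<bar>"
      by (intro cos_monotone_0_pi_le) auto
    moreover have "1 / sqrt 2 = sqrt 2 / (2 :: real)"
      using real_div_sqrt[of 2] by (simp add: field_simps)
    ultimately show ?thesis by (simp add: cos_45)
  qed
  have rf: "of_real r \<in> finger"
    unfolding finger_def using r by (intro image_eqI[of _ _ "(r, 0)"]) (auto simp: R2_def)
  have "C - 2 * e * d0\<^sup>2 \<le> f (of_real r)"
  proof (rule circle_mean_min_principle[OF finger_compact _ _ rf])
    show "continuous_on finger f"
      unfolding f_def using finger_nz R1_pos by (intro continuous_intros psi_cont) force
    fix x assume x: "x \<in> finger"
    obtain \<rho> \<theta> where xp: "x = of_real \<rho> * cis \<theta>" and \<rho>: "R1 \<le> \<rho>" "\<rho> \<le> s (cos (real m * \<theta>))" and \<theta>: "\<bar>\<theta>\<bar> \<le> pi / m"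
      using x by (auto simp: finger_def abs_le_iff)
    have \<rho>0: "0 < \<rho>" using \<rho> R1_pos by linarith
    have b: "2 * e * (cmod (x - of_real R1))\<^sup>2 \<le> 2 * e * d0\<^sup>2"
      using d0_bound[OF x] e_pos by simp
    have Re_x: "Re (inverse (x ^ k)) = cos (real k * \<theta>) / \<rho> ^ k"
      unfolding xp by (rule Re_inverse_power_polar[OF \<rho>0])
    have sq: "1 \<le> sqrt 2 * cos (real k * \<theta>)"
    proof -
      have "sqrt 2 * (1 / sqrt 2) \<le> sqrt 2 * cos (real k * \<theta>)"
        by (intro mult_left_mono ck \<theta>) auto
      moreover have "sqrt 2 * (1 / sqrt 2) = (1 :: real)" by simp
      ultimately show ?thesis by linarith
    qed
    have pos: "0 \<le> M * sqrt 2 * R1 ^ k * Re (inverse (x ^ k))"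
    proof -
      have "0 \<le> 1 / sqrt 2" by simp
      then have "0 \<le> cos (real k * \<theta>)" using ck[OF \<theta>] by linarith
      then show ?thesis
        unfolding Re_x using M R1_pos \<rho>0
        by (intro mult_nonneg_nonneg divide_nonneg_nonneg zero_le_power) auto
    qed
    have bdry: "of_real (s (cos (real m * \<theta>))) * cis \<theta> \<in> frontier D"
      using boundary_point[of "cis \<theta>"] by (simp add: Re_cis_power)
    consider "\<rho> = s (cos (real m * \<theta>))" | "\<rho> = R1" "\<rho> < s (cos (real m * \<theta>))"
      | "R1 < \<rho>" "\<rho> < s (cos (real m * \<theta>))"
      using \<rho> by linarith
    then show "C - 2 * e * d0\<^sup>2 \<le> f x \<or> (\<exists>d. (\<forall>w. cmod w = 1 \<longrightarrow> x + of_real d * w \<in> finger) \<and>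
      (\<exists>I. has_bochner_integral circ (\<lambda>w. f (x + of_real d * w)) I \<and> I < 2 * pi * f x))"
    proof cases
      case 1
      then have "psi x = C" using bdry xp by (simp add: psi_boundary)
      then have "C - 2 * e * d0\<^sup>2 \<le> f x" using b pos by (simp add: f_def)
      then show ?thesis ..
    next
      \<comment> \<open>On the inner arc the barrier is at least \<open>M\<close> and absorbs the
        deficit allowed by \<open>psi_lower_bound\<close>.\<close>
      case 2
      then have "x \<in> D"
        using polar_in_D[OF \<rho>0, of "cis \<theta>"] by (simp add: xp Re_cis_power)
      then have "C - M \<le> psi x"
        using psi_lower_bound[of x] closure_subset \<rho>0 2 by (auto simp: M_def xp norm_mult)
      moreover have "M * sqrt 2 * R1 ^ k * Re (inverse (x ^ k)) = M * (sqrt 2 * cos (real k * \<theta>))"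
        unfolding Re_x using 2 R1_pos by simp
      moreover have "M * 1 \<le> M * (sqrt 2 * cos (real k * \<theta>))"
        by (intro mult_left_mono sq M)
      ultimately have "C - 2 * e * d0\<^sup>2 \<le> f x" using b by (simp add: f_def)
      then show ?thesis ..
    next
      case 3
      obtain d where d: "0 < d" "cball x d \<subseteq> finger \<inter> D" "d < \<rho>"
        using finger_interior[OF \<theta> 3] by (auto simp: xp)
      have dx: "d < cmod x" using d \<rho>0 by (simp add: xp norm_mult)
      have "\<forall>w. cmod w = 1 \<longrightarrow> x + of_real d * w \<in> finger"
        using d by (force simp: dist_norm norm_mult)
      moreover have "has_bochner_integral circ (\<lambda>w. f (x + of_real d * w))
        (2 * pi * (psi x + e * d\<^sup>2) - 2 * e * (2 * pi * ((cmod (x - of_real R1))\<^sup>2 + d\<^sup>2))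
          + M * sqrt 2 * R1 ^ k * (2 * pi * Re (inverse (x ^ k))))"
      proof -
        have "ball x d \<subseteq> D" using d ball_subset_cball by blast
        moreover have "has_bochner_integral circ (\<lambda>w. (cmod (x + of_real d * w - of_real R1))\<^sup>2)
          (2 * pi * ((cmod (x - of_real R1))\<^sup>2 + d\<^sup>2))"
          using circ_mean_norm_sq[of "x - of_real R1" d] by (simp only: diff_add_eq)
        ultimately show ?thesis
          unfolding f_def
          by (intro has_bochner_integral_add has_bochner_integral_diff has_bochner_integral_mult_right
            circ_mean_inverse_power psi_circle_mean d dx)
      qed
      moreover have "2 * pi * (psi x + e * d\<^sup>2) - 2 * e * (2 * pi * ((cmod (x - of_real R1))\<^sup>2 + d\<^sup>2))
          + M * sqrt 2 * R1 ^ k * (2 * pi * Re (inverse (x ^ k))) < 2 * pi * f x"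
      proof -
        have "0 < 2 * pi * (e * d\<^sup>2)" using d e_pos by simp
        then show ?thesis by (simp add: f_def algebra_simps)
      qed
      ultimately show ?thesis by blast
    qed
  qed
  moreover have "f (of_real r) = psi (of_real r) - 2 * e * (r - R1)\<^sup>2 + M * sqrt 2 * R1 ^ k * (1 / r ^ k)"
  proof -
    have "0 < r" using r R1_pos by linarith
    have "Re (inverse (of_real r ^ k)) = 1 / r ^ k"
      using Re_inverse_power_polar[OF \<open>0 < r\<close>, of 0 k] by (simp only: cis_zero mult_1_right mult_zero_right cos_zero)
    moreover have "(cmod (of_real r - of_real R1))\<^sup>2 = (r - R1)\<^sup>2"
      by (simp flip: of_real_diff)
    ultimately show ?thesis by (simp only: f_def)
  qed
  moreover have "0 \<le> 2 * e * (r - R1)\<^sup>2" using e_pos by simp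
  moreover have "M * sqrt 2 * R1 ^ k * (1 / r ^ k) = M * sqrt 2 * (R1 / r) ^ k"
    by (simp add: power_divide)
  ultimately have "C - 2 * e * d0\<^sup>2 \<le> psi (of_real r) + M * sqrt 2 * (R1 / r) ^ k" by linarith
  then show ?thesis unfolding M_def k_def by linarith
qed

lemma psi_tip: "psi (of_real R2) = C"
  using boundary_point[of 1] psi_boundary by (simp add: R2_def)

lemma cis_pi_power: "cis (pi / m) ^ m = -1"
  using m_pos by (simp add: Complex.DeMoivre)

lemma psi_trough: "psi (of_real R1 * cis (pi / m)) = C"
  using boundary_point[of "cis (pi / m)"] psi_boundary by (simp add: R1_def cis_pi_power)

text \<open>For the whole plane the increment is explicit, so that of the patch is governed by what
  the patch leaves out.\<close>

lemma log_pot_max_increment: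
  assumes "0 < a" "0 < b"
  shows "has_bochner_integral polar (\<lambda>p. (1 - inside p) * (ln (max b (fst p)) - ln (max a (fst p))))
    (pi / 2 * (b\<^sup>2 - a\<^sup>2) - (log_pot_max D b 0 - log_pot_max D a 0))"
proof -
  have "has_bochner_integral polar (\<lambda>p. ln (max b (fst p)) - ln (max a (fst p))) (pi / 2 * (b\<^sup>2 - a\<^sup>2))"
    by (rule has_bochner_integral_polar_power[OF m_pos _ log_max_diff_integral[OF assms]])
      (auto simp: norm_mult)
  from has_bochner_integral_diff[OF this has_bochner_integral_diff[OF log_pot_max_polar[OF assms(2)] log_pot_max_polar[OF assms(1)]]]
  show ?thesis by (simp add: algebra_simps)
qed

definition outside_measure :: "real \<Rightarrow> real" where
  "outside_measure r = measure circ {w. s (Re w) \<le> r}"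

lemma measure_polar_rectangle:
  assumes "0 \<le> a" "a \<le> b"
  shows "has_bochner_integral polar (indicator ({a..b} \<times> {w. s (Re w) \<le> r})) ((b\<^sup>2 - a\<^sup>2) / 2 * outside_measure r)"
proof -
  have "a\<^sup>2 \<le> b\<^sup>2" using assms by (intro power_mono) auto
  then have E: "emeasure polar ({a..b} \<times> {w. s (Re w) \<le> r}) = ennreal ((b\<^sup>2 - a\<^sup>2) / 2 * outside_measure r)"
    unfolding outside_measure_def using assms
    by (subst circ.emeasure_pair_measure_Times, simp, simp, subst ennreal_mult)
      (auto simp: measure_rad_interval circ.emeasure_eq_measure)
  have "has_bochner_integral polar (indicator ({a..b} \<times> {w. s (Re w) \<le> r})) (measure polar ({a..b} \<times> {w. s (Re w) \<le> r}))"
    by (rule has_bochner_integral_real_indicator) (auto simp: E)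
  moreover have "measure polar ({a..b} \<times> {w. s (Re w) \<le> r}) = (b\<^sup>2 - a\<^sup>2) / 2 * outside_measure r"
    using \<open>a\<^sup>2 \<le> b\<^sup>2\<close> by (intro measure_eq_emeasure_eq_ennreal E) (auto simp: outside_measure_def)
  ultimately show ?thesis by simp
qed

text \<open>Directions along which the patch ends before \<open>r2\<close> miss it on the whole
  range from \<open>r2\<close> to \<open>r3\<close>, where the integrand is at least
  \<open>ln (R2 / r3)\<close>. All other contributions are nonnegative.\<close>

lemma log_pot_max_tip_increment:
  assumes r: "R1 \<le> r2" "r2 \<le> r3" "r3 \<le> R2"
  shows "log_pot_max D R2 0 - log_pot_max D R1 0 \<le> pi / 2 * (R2\<^sup>2 - R1\<^sup>2)
    - ln (R2 / r3) * ((r3\<^sup>2 - r2\<^sup>2) / 2 * outside_measure r2)"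
proof -
  have pos: "0 < R2" "0 < r3" "0 < r2" using R1_pos r by auto
  note I = log_pot_max_increment[OF R1_pos pos(1)]
  note J = has_bochner_integral_mult_right[OF measure_polar_rectangle[of r2 r3 r2], of "ln (R2 / r3)"]
  have J': "has_bochner_integral polar (\<lambda>p. ln (R2 / r3) * indicator ({r2..r3} \<times> {w. s (Re w) \<le> r2}) p)
    (ln (R2 / r3) * ((r3\<^sup>2 - r2\<^sup>2) / 2 * outside_measure r2))"
    using J pos r by simp
  have "ln (R2 / r3) * ((r3\<^sup>2 - r2\<^sup>2) / 2 * outside_measure r2)
    = (LINT p|polar. ln (R2 / r3) * indicator ({r2..r3} \<times> {w. s (Re w) \<le> r2}) p)"
    using J' unfolding has_bochner_integral_iff by (elim conjE) (rule sym)
  also have "\<dots> \<le> (LINT p|polar. (1 - inside p) * (ln (max R2 (fst p)) - ln (max R1 (fst p))))"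
  proof (rule integral_mono_AE)
    show "AE p in polar. ln (R2 / r3) * indicator ({r2..r3} \<times> {w. s (Re w) \<le> r2}) p
      \<le> (1 - inside p) * (ln (max R2 (fst p)) - ln (max R1 (fst p)))"
    proof (rule AE_I2)
      fix p :: "real \<times> complex"
      obtain \<rho> w where p: "p = (\<rho>, w)" by force
      show "ln (R2 / r3) * indicator ({r2..r3} \<times> {w. s (Re w) \<le> r2}) p
        \<le> (1 - inside p) * (ln (max R2 (fst p)) - ln (max R1 (fst p)))"
      proof (cases "p \<in> {r2..r3} \<times> {w. s (Re w) \<le> r2}")
        case True
        then have \<rho>: "r2 \<le> \<rho>" "\<rho> \<le> r3" "s (Re w) \<le> r2" by (auto simp: p)
        then have "inside p = 0" "max R2 \<rho> = R2" "max R1 \<rho> = \<rho>" using r by (auto simp: inside_def p)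
        moreover have "ln \<rho> \<le> ln r3" using \<rho> pos by simp
        ultimately show ?thesis using True pos by (simp add: p ln_div)
      next
        case False
        have "ln (max R1 \<rho>) \<le> ln (max R2 \<rho>)"
          using R1_pos R1_less_R2 by (intro ln_mono) auto
        then show ?thesis using False by (simp add: p inside_def)
      qed
    qed
  qed (use I J' in \<open>unfold has_bochner_integral_iff, blast+\<close>)
  also have "\<dots> = pi / 2 * (R2\<^sup>2 - R1\<^sup>2) - (log_pot_max D R2 0 - log_pot_max D R1 0)"
    using I unfolding has_bochner_integral_iff by blast
  finally show ?thesis by simp
qed

text \<open>Here the missing part is bounded from above: the integrand vanishes beyond
  \<open>r2\<close> and is at most \<open>ln (r2 / r1)\<close>, and points missing below
  \<open>r2\<close> lie above \<open>R1\<close> in directions counted by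
  \<open>outside_measure r2\<close>.\<close>

lemma log_pot_max_root_increment:
  assumes r: "R1 \<le> r1" "r1 \<le> r2"
  shows "pi / 2 * (r2\<^sup>2 - r1\<^sup>2) - ln (r2 / r1) * ((r2\<^sup>2 - R1\<^sup>2) / 2 * outside_measure r2)
    \<le> log_pot_max D r2 0 - log_pot_max D r1 0"
proof -
  have pos: "0 < r1" "0 < r2" using R1_pos r by auto
  note I = log_pot_max_increment[OF pos]
  have J: "has_bochner_integral polar (\<lambda>p. ln (r2 / r1) * indicator ({R1..r2} \<times> {w. s (Re w) \<le> r2}) p)
    (ln (r2 / r1) * ((r2\<^sup>2 - R1\<^sup>2) / 2 * outside_measure r2))"
    using has_bochner_integral_mult_right[OF measure_polar_rectangle[of R1 r2 r2], of "ln (r2 / r1)"] R1_pos r by simp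
  have "(LINT p|polar. (1 - inside p) * (ln (max r2 (fst p)) - ln (max r1 (fst p))))
    \<le> (LINT p|polar. ln (r2 / r1) * indicator ({R1..r2} \<times> {w. s (Re w) \<le> r2}) p)"
  proof (rule integral_mono_AE)
    show "AE p in polar. (1 - inside p) * (ln (max r2 (fst p)) - ln (max r1 (fst p)))
      \<le> ln (r2 / r1) * indicator ({R1..r2} \<times> {w. s (Re w) \<le> r2}) p"
      using AE_polar
    proof eventually_elim
      case (elim p)
      obtain \<rho> w where p: "p = (\<rho>, w)" by force
      have w: "\<bar>Re w\<bar> \<le> 1" using elim abs_Re_le_cmod[of w] by (simp add: p)
      have R1s: "R1 \<le> s (Re w)" using w unfolding R1_def by (intro monoD[OF s_mono]) auto
      have l: "ln r1 \<le> ln r2" using r pos by simp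
      consider "\<rho> < s (Re w)" | "s (Re w) \<le> \<rho>" "r2 \<le> \<rho>" | "s (Re w) \<le> \<rho>" "\<rho> < r2" by linarith
      then show ?case
      proof cases
        case 1
        then show ?thesis using l pos by (simp add: p inside_def ln_div)
      next
        case 2
        then show ?thesis using l pos r by (simp add: p inside_def ln_div max_def)
      next
        case 3
        have "ln r1 \<le> ln (max r1 \<rho>)" using pos by (intro ln_mono) auto
        then show ?thesis using 3 l pos r R1s by (simp add: p inside_def ln_div)
      qed
    qed
  qed (use I J in \<open>unfold has_bochner_integral_iff, blast+\<close>)
  then have "pi / 2 * (r2\<^sup>2 - r1\<^sup>2) - (log_pot_max D r2 0 - log_pot_max D r1 0)
    \<le> ln (r2 / r1) * ((r2\<^sup>2 - R1\<^sup>2) / 2 * outside_measure r2)"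
    using I J unfolding has_bochner_integral_iff by metis
  then show ?thesis by simp
qed

end

text \<open>Here \<open>\<eta> = 100/m\<close>. The first inequality yields \<open>\<nu> \<eta> \<le> 0.27 e\<close>; this makes the right-hand side of the second
  one smaller than \<open>e (r2^2 - r1^2) \<ge> 2 e \<eta> R^2\<close>.\<close>

lemma incompatible_growth_bounds:
  fixes R e \<nu> \<eta> T :: real
  assumes R: "0 < R" and e: "0 < e" and \<nu>: "0 \<le> \<nu>" and \<eta>: "0 < \<eta>" "\<eta> \<le> 1 / 10^5"
    and T: "0 \<le> T" "T \<le> 1 / 1000"
    and tip: "\<nu> * (16 * \<eta>) * (((R * exp (18 * \<eta>))\<^sup>2 - (R * exp (2 * \<eta>))\<^sup>2) / 2) \<le> e * ((R * exp (34 * \<eta>))\<^sup>2 - R\<^sup>2)"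
    and root: "e * ((R * exp (2 * \<eta>))\<^sup>2 - (R * exp \<eta>)\<^sup>2) - \<nu> * \<eta> * (((R * exp (2 * \<eta>))\<^sup>2 - R\<^sup>2) / 2)
      \<le> 48 * \<nu> * (R * exp (34 * \<eta>))\<^sup>2 * (\<eta> / 100)\<^sup>2
        + 2 * e * ((R * exp (34 * \<eta>) - R) + R * (pi * \<eta> / 100))\<^sup>2
        + 2 * e * ((R * exp (34 * \<eta>))\<^sup>2 - R\<^sup>2) * sqrt 2 * T"
  shows False
proof -
  have sq: "(R * exp a)\<^sup>2 = R\<^sup>2 * exp (2 * a)" for a
    by (simp add: power_mult_distrib exp_double)
  have s18: "(R * exp (18 * \<eta>))\<^sup>2 = R\<^sup>2 * exp (36 * \<eta>)" and s2: "(R * exp (2 * \<eta>))\<^sup>2 = R\<^sup>2 * exp (4 * \<eta>)"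
    and s34: "(R * exp (34 * \<eta>))\<^sup>2 = R\<^sup>2 * exp (68 * \<eta>)" and s1: "(R * exp \<eta>)\<^sup>2 = R\<^sup>2 * exp (2 * \<eta>)"
    unfolding sq by simp_all
  have R2: "0 < R\<^sup>2" using R by simp
  have small: "\<eta>\<^sup>2 \<le> \<eta> / 10^5"
    using \<eta> mult_left_mono[of \<eta> "1/10^5" \<eta>] by (simp add: power2_eq_square)
  \<comment> \<open>The quadratic remainder is absorbed into a small multiple of \<eta>, so all
    later exponentials become linear.\<close>
  have ex: "exp (k * \<eta>) - 1 \<le> k * \<eta> + k\<^sup>2 * (\<eta> / 10^5)" if "0 \<le> k" "k \<le> 100" for k
  proof -
    have "k * \<eta> \<le> 100 * (1 / 10^5)" using that \<eta> by (intro mult_mono) auto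
    then have "exp (k * \<eta>) \<le> 1 + k * \<eta> + (k * \<eta>)\<^sup>2"
      using that \<eta> by (intro exp_bound) auto
    moreover have "(k * \<eta>)\<^sup>2 \<le> k\<^sup>2 * (\<eta> / 10^5)"
      unfolding power_mult_distrib using small by (intro mult_left_mono) auto
    ultimately show ?thesis by linarith
  qed
  have e68: "exp (68 * \<eta>) - 1 \<le> 68.1 * \<eta>"
    using ex[of 68] \<eta> by simp
  have e34: "exp (34 * \<eta>) - 1 \<le> 34.1 * \<eta>"
    using ex[of 34] \<eta> by simp
  have e4: "exp (4 * \<eta>) - 1 \<le> 4.1 * \<eta>"
    using ex[of 4] \<eta> by simp
  have "32 * \<eta> \<le> exp (32 * \<eta>) - 1" using exp_ge_add_one_self[of "32 * \<eta>"] by linarith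
  also have "\<dots> \<le> exp (4 * \<eta>) * (exp (32 * \<eta>) - 1)"
    using \<eta> by (simp add: mult_le_cancel_right1)
  also have "\<dots> = exp (36 * \<eta>) - exp (4 * \<eta>)"
    by (simp add: right_diff_distrib mult_exp_exp)
  finally have d36: "32 * \<eta> \<le> exp (36 * \<eta>) - exp (4 * \<eta>)" .
  have "2 * \<eta> \<le> exp (2 * \<eta>) - 1" using exp_ge_add_one_self[of "2 * \<eta>"] by linarith
  also have "\<dots> \<le> exp (2 * \<eta>) * (exp (2 * \<eta>) - 1)"
    using \<eta> by (simp add: mult_le_cancel_right1)
  also have "\<dots> = exp (4 * \<eta>) - exp (2 * \<eta>)"
    by (simp add: right_diff_distrib mult_exp_exp)
  finally have d4: "2 * \<eta> \<le> exp (4 * \<eta>) - exp (2 * \<eta>)" .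
  have "R\<^sup>2 * (\<nu> * (8 * \<eta>) * (exp (36 * \<eta>) - exp (4 * \<eta>))) \<le> R\<^sup>2 * (e * (exp (68 * \<eta>) - 1))"
    using tip unfolding s18 s2 s34 by (simp add: algebra_simps diff_divide_distrib)
  then have "\<nu> * (8 * \<eta>) * (exp (36 * \<eta>) - exp (4 * \<eta>)) \<le> e * (exp (68 * \<eta>) - 1)"
    using R2 by simp
  moreover have "\<nu> * (8 * \<eta>) * (32 * \<eta>) \<le> \<nu> * (8 * \<eta>) * (exp (36 * \<eta>) - exp (4 * \<eta>))"
    using d36 \<nu> \<eta> by (intro mult_left_mono) auto
  moreover have "e * (exp (68 * \<eta>) - 1) \<le> e * (68.1 * \<eta>)"
    using e68 e by (intro mult_left_mono) auto
  ultimately have "\<eta> * (256 * (\<nu> * \<eta>)) \<le> \<eta> * (68.1 * e)" by (simp add: algebra_simps)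
  \<comment> \<open>68.1 / 256 is below 0.27.\<close>
  then have \<nu>\<eta>: "\<nu> * \<eta> \<le> 0.27 * e" using \<eta> e by simp
  define d where "d = (exp (34 * \<eta>) - 1) + pi * \<eta> / 100"
  have "pi * \<eta> \<le> 4 * \<eta>" using pi_less_4 \<eta> by (intro mult_right_mono) auto
  then have d: "0 \<le> d" "d \<le> 35 * \<eta>" using e34 \<eta> unfolding d_def by (simp, linarith)
  have "d\<^sup>2 \<le> (35 * \<eta>)\<^sup>2" using d by (intro power_mono)
  also have "\<dots> \<le> 0.02 * \<eta>" using small \<eta> by (simp add: power2_eq_square)
  finally have d2: "d\<^sup>2 \<le> 0.02 * \<eta>" .
  have dd: "((R * exp (34 * \<eta>) - R) + R * (pi * \<eta> / 100))\<^sup>2 = R\<^sup>2 * d\<^sup>2"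
    by (simp add: d_def power2_eq_square algebra_simps)
  have "R\<^sup>2 * (e * (exp (4 * \<eta>) - exp (2 * \<eta>)) - \<nu> * \<eta> * ((exp (4 * \<eta>) - 1) / 2))
    \<le> R\<^sup>2 * (48 * \<nu> * exp (68 * \<eta>) * (\<eta> / 100)\<^sup>2 + 2 * e * d\<^sup>2 + 2 * e * (exp (68 * \<eta>) - 1) * sqrt 2 * T)"
    using root unfolding dd s1 s2 s34 by (simp add: algebra_simps diff_divide_distrib)
  then have f1: "e * (exp (4 * \<eta>) - exp (2 * \<eta>)) - \<nu> * \<eta> * ((exp (4 * \<eta>) - 1) / 2)
    \<le> 48 * \<nu> * exp (68 * \<eta>) * (\<eta> / 100)\<^sup>2 + 2 * e * d\<^sup>2 + 2 * e * (exp (68 * \<eta>) - 1) * sqrt 2 * T"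
    using R2 by simp
  have f2: "e * (2 * \<eta>) \<le> e * (exp (4 * \<eta>) - exp (2 * \<eta>))"
    using d4 e by (intro mult_left_mono) auto
  have f3: "\<nu> * \<eta> * ((exp (4 * \<eta>) - 1) / 2) \<le> 0.27 * e * (4.1 * \<eta> / 2)"
    using e4 \<nu> \<eta> e by (intro mult_mono[OF \<nu>\<eta>]) auto
  have f4: "48 * \<nu> * exp (68 * \<eta>) * (\<eta> / 100)\<^sup>2 \<le> 0.01 * (e * \<eta>)"
  proof -
    have "48 * \<nu> * exp (68 * \<eta>) * (\<eta> / 100)\<^sup>2 = (\<nu> * \<eta>) * (exp (68 * \<eta>) * (48 * \<eta> / 10000))"
      by (simp add: power2_eq_square)
    also have "\<dots> \<le> (0.27 * e) * (2 * (48 * \<eta> / 10000))"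
    proof (rule mult_mono[OF \<nu>\<eta>])
      show "exp (68 * \<eta>) * (48 * \<eta> / 10000) \<le> 2 * (48 * \<eta> / 10000)"
        using e68 \<eta> by (intro mult_right_mono) auto
    qed (use e \<eta> in auto)
    also have "\<dots> \<le> 0.01 * (e * \<eta>)" using e \<eta> by simp
    finally show ?thesis .
  qed
  have f5: "2 * e * d\<^sup>2 \<le> 2 * e * (0.02 * \<eta>)"
    using d2 e by (intro mult_left_mono) auto
  have f6: "2 * e * (exp (68 * \<eta>) - 1) * sqrt 2 * T \<le> 2 * e * (68.1 * \<eta>) * 2 * (1 / 1000)"
  proof -
    have "sqrt 2 \<le> 2" by (simp add: real_le_lsqrt real_sqrt_le_iff)
    then show ?thesis
      using e68 e \<eta> T by (intro mult_mono mult_nonneg_nonneg) auto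
  qed
  \<comment> \<open>Divided by \<eta> and \<open>e\<close>, the six bounds force 2 to be at most
    0.56 + 0.01 + 0.04 + 0.28, which is absurd.\<close>
  have "p \<le> q + x + y + z" if "P - Q \<le> X + Y + Z" "p \<le> P" "Q \<le> q" "X \<le> x" "Y \<le> y" "Z \<le> z"
    for P Q X Y Z p q x y z :: real
    using that by linarith
  from this[OF f1 f2 f3 f4 f5 f6]
  have "\<eta> * e \<le> 0"
    by (simp add: mult_ac)
  then show False using mult_pos_pos[OF \<eta>(1) e] by linarith
qed

section \<open>Excluding one ratio of the radii\<close>

context rotating_star_patch
begin

lemma R2_pos: "0 < R2" using R1_pos R1_less_R2 by linarith

lemma tip_inequality:
  assumes r: "R1 \<le> r2" "r2 \<le> r3" "r3 \<le> R2"
  shows "outside_measure r2 / (2 * pi) * ln (R2 / r3) * ((r3\<^sup>2 - r2\<^sup>2) / 2) \<le> e * (R2\<^sup>2 - R1\<^sup>2)"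
proof -
  have "log_pot D (of_real R2) \<le> log_pot_max D R2 0"
    by (rule log_pot_tip_le[OF R2_pos]) simp
  moreover have "log_pot_max D R1 0 \<le> log_pot D (of_real R1 * cis (pi / m))"
    by (rule log_pot_trough_ge[OF R1_pos]) (simp add: power_mult_distrib cis_pi_power)
  moreover note log_pot_max_tip_increment[OF r]
  ultimately have "log_pot D (of_real R2) - log_pot D (of_real R1 * cis (pi / m)) \<le> pi / 2 * (R2\<^sup>2 - R1\<^sup>2)
    - ln (R2 / r3) * ((r3\<^sup>2 - r2\<^sup>2) / 2 * outside_measure r2)" by linarith
  from divide_right_mono[OF this, of "2 * pi"]
  have "(log_pot D (of_real R2) - log_pot D (of_real R1 * cis (pi / m))) / (2 * pi)
    \<le> (pi / 2 * (R2\<^sup>2 - R1\<^sup>2) - ln (R2 / r3) * ((r3\<^sup>2 - r2\<^sup>2) / 2 * outside_measure r2)) / (2 * pi)" by simp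
  moreover have "(pi / 2 * (R2\<^sup>2 - R1\<^sup>2) - ln (R2 / r3) * ((r3\<^sup>2 - r2\<^sup>2) / 2 * outside_measure r2)) / (2 * pi)
    = (R2\<^sup>2 - R1\<^sup>2) / 4 - outside_measure r2 / (2 * pi) * ln (R2 / r3) * ((r3\<^sup>2 - r2\<^sup>2) / 2)"
    by (simp add: field_simps)
  ultimately have "log_pot D (of_real R2) / (2 * pi) - log_pot D (of_real R1 * cis (pi / m)) / (2 * pi)
    \<le> (R2\<^sup>2 - R1\<^sup>2) / 4 - outside_measure r2 / (2 * pi) * ln (R2 / r3) * ((r3\<^sup>2 - r2\<^sup>2) / 2)"
    by (simp only: diff_divide_distrib)
  moreover have "log_pot D (of_real R2) / (2 * pi) - \<Omega> / 2 * R2\<^sup>2 = C"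
    using psi_tip R2_pos by (simp add: psi_def)
  moreover have "log_pot D (of_real R1 * cis (pi / m)) / (2 * pi) - \<Omega> / 2 * R1\<^sup>2 = C"
    using psi_trough R1_pos by (simp add: psi_def norm_mult)
  \<comment> \<open>The full disc contributes a quarter of the squared radius to the mean, the
    rotation takes away \<Omega>/2 of it, and \<open>e\<close> is what remains.\<close>
  moreover have "e * (R2\<^sup>2 - R1\<^sup>2) = (R2\<^sup>2 - R1\<^sup>2) / 4 - \<Omega> / 2 * R2\<^sup>2 + \<Omega> / 2 * R1\<^sup>2"
    by (simp add: e_def field_simps)
  ultimately show ?thesis by linarith
qed

text \<open>The angle \<delta> is half the folded gap between two fingers at radius
  \<open>r2\<close>; only the half on one side of the axis is measured, which suffices for the upper
  bound.\<close>

lemma boundary_angle: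
  assumes r: "R1 < r2" "r2 < R2"
  obtains \<delta> where "0 \<le> \<delta>" "s (cos (pi - \<delta>)) = r2" "\<delta> \<le> outside_measure r2"
proof -
  obtain c where c: "-1 \<le> c" "c \<le> 1" "s c = r2"
    using IVT'[of s "-1" r2 1] continuous_on_subset[OF s_cont] r by (auto simp: R1_def R2_def)
  define X where "X = arccos c"
  have X: "0 \<le> X" "X \<le> pi" "cos X = c"
    using c arccos_lbound arccos_ubound by (auto simp: X_def)
  have "ennreal (pi - X) = (\<integral>\<^sup>+y. indicator {X..pi} y \<partial>lborel)"
    using X by simp
  also have "\<dots> \<le> (\<integral>\<^sup>+y. indicator {w. s (Re w) \<le> r2} (cis y) * indicator {0..2*pi} y \<partial>lborel)"
  proof (rule nn_integral_mono)
    fix y :: real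
    have "s (cos y) \<le> r2" if "X \<le> y" "y \<le> pi"
      using that X c cos_monotone_0_pi_le[of X y] monoD[OF s_mono, of "cos y" c] by auto
    then show "indicator {X..pi} y \<le> (indicator {w. s (Re w) \<le> r2} (cis y) * indicator {0..2*pi} y :: ennreal)"
      using X by (auto simp: indicator_def)
  qed
  also have "\<dots> = emeasure circ {w. s (Re w) \<le> r2}"
    by (subst nn_integral_circ[symmetric]) auto
  finally have "pi - X \<le> outside_measure r2"
    by (simp add: circ.emeasure_eq_measure outside_measure_def)
  then show thesis
    using X c by (intro that[of "pi - X"]) auto
qed

text \<open>Let \<open>x\<close> and \<open>y\<close> be the points of radius \<open>r2\<close> on
  the axis between two fingers and on the frontier. Then H r2 \<le> psi x \<le> C + error, the error
  coming from the small angle between \<open>x\<close> and \<open>y\<close>, while H r1 \<ge> psi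
  r1, which the finger bound keeps close to \<open>C\<close>. So H grows little from
  \<open>r1\<close> to \<open>r2\<close>.\<close>

lemma root_inequality:
  assumes r: "R1 \<le> r1" "r1 \<le> r2" "R1 < r2" "r2 < R2"
    and d0: "(R2 - R1) + R1 * (pi / m) \<le> d0"
  shows "e * (r2\<^sup>2 - r1\<^sup>2) - outside_measure r2 / (2 * pi) * ln (r2 / r1) * ((r2\<^sup>2 - R1\<^sup>2) / 2)
    \<le> 48 * (outside_measure r2 / (2 * pi)) * R2\<^sup>2 / m\<^sup>2 + 2 * e * d0\<^sup>2
      + 2 * e * (R2\<^sup>2 - R1\<^sup>2) * sqrt 2 * (R1 / r1) ^ (m div 4)"
proof -
  obtain \<delta> where \<delta>: "0 \<le> \<delta>" "s (cos (pi - \<delta>)) = r2" "\<delta> \<le> outside_measure r2"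
    using boundary_angle[OF r(3,4)] by blast
  have pos: "0 < r1" "0 < r2" using r R1_pos by auto
  define x y where "x = of_real r2 * cis (pi / m)" and "y = of_real r2 * cis ((pi - \<delta>) / m)"
  have xm: "x ^ m = - of_real (r2 ^ m)"
    by (simp add: x_def power_mult_distrib cis_pi_power)
  have cym: "cis ((pi - \<delta>) / m) ^ m = cis (pi - \<delta>)"
    using m_pos by (simp add: Complex.DeMoivre)
  then have ym: "y ^ m = of_real (r2 ^ m) * cis (pi - \<delta>)"
    by (simp add: y_def power_mult_distrib)
  have "y \<in> frontier D"
    using boundary_point[of "cis ((pi - \<delta>) / m)"] \<delta>(2) unfolding cym by (simp add: y_def)
  then have psi_y: "log_pot D y / (2 * pi) - \<Omega> / 2 * r2\<^sup>2 = C"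
    using psi_boundary[of y] pos by (simp add: psi_def y_def norm_mult)
  have "log_pot D x - log_pot D y \<le> 48 * \<delta> * R2\<^sup>2 / m\<^sup>2"
    using r m_ge by (intro log_pot_near_trough[OF pos(2) _ _ \<delta>(1) xm ym]) auto
  also have "\<dots> \<le> 48 * outside_measure r2 * R2\<^sup>2 / m\<^sup>2"
    using \<delta>(3) by (intro divide_right_mono mult_right_mono mult_left_mono) auto
  finally have 1: "log_pot D x - log_pot D y \<le> 48 * outside_measure r2 * R2\<^sup>2 / m\<^sup>2" .
  have 2: "log_pot_max D r2 0 \<le> log_pot D x"
    by (rule log_pot_trough_ge[OF pos(2) xm])
  have 3: "log_pot D (of_real r1) \<le> log_pot_max D r1 0"
    by (rule log_pot_tip_le[OF pos(1)]) simp
  have "pi / 2 * (r2\<^sup>2 - r1\<^sup>2) - ln (r2 / r1) * ((r2\<^sup>2 - R1\<^sup>2) / 2 * outside_measure r2)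
    \<le> 48 * outside_measure r2 * R2\<^sup>2 / m\<^sup>2 + log_pot D y - log_pot D (of_real r1)"
    using 1 2 3 log_pot_max_root_increment[OF r(1,2)] by linarith
  from divide_right_mono[OF this, of "2 * pi"]
  have "(pi / 2 * (r2\<^sup>2 - r1\<^sup>2) - ln (r2 / r1) * ((r2\<^sup>2 - R1\<^sup>2) / 2 * outside_measure r2)) / (2 * pi)
    \<le> (48 * outside_measure r2 * R2\<^sup>2 / m\<^sup>2 + log_pot D y - log_pot D (of_real r1)) / (2 * pi)" by simp
  moreover have "(pi / 2 * (r2\<^sup>2 - r1\<^sup>2) - ln (r2 / r1) * ((r2\<^sup>2 - R1\<^sup>2) / 2 * outside_measure r2)) / (2 * pi)
    = (r2\<^sup>2 - r1\<^sup>2) / 4 - outside_measure r2 / (2 * pi) * ln (r2 / r1) * ((r2\<^sup>2 - R1\<^sup>2) / 2)"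
    by (simp add: field_simps)
  moreover have "(48 * outside_measure r2 * R2\<^sup>2 / m\<^sup>2 + log_pot D y - log_pot D (of_real r1)) / (2 * pi)
    = 48 * (outside_measure r2 / (2 * pi)) * R2\<^sup>2 / m\<^sup>2 + log_pot D y / (2 * pi) - log_pot D (of_real r1) / (2 * pi)"
    by (simp add: diff_divide_distrib add_divide_distrib)
  ultimately have "(r2\<^sup>2 - r1\<^sup>2) / 4 - outside_measure r2 / (2 * pi) * ln (r2 / r1) * ((r2\<^sup>2 - R1\<^sup>2) / 2)
    \<le> 48 * (outside_measure r2 / (2 * pi)) * R2\<^sup>2 / m\<^sup>2 + log_pot D y / (2 * pi) - log_pot D (of_real r1) / (2 * pi)"
    by linarith
  moreover have "psi (of_real r1) = log_pot D (of_real r1) / (2 * pi) - \<Omega> / 2 * r1\<^sup>2"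
    using pos by (simp add: psi_def)
  moreover have "C - 2 * e * d0\<^sup>2 - 2 * e * (R2\<^sup>2 - R1\<^sup>2) * sqrt 2 * (R1 / r1) ^ (m div 4) \<le> psi (of_real r1)"
    using r by (intro psi_finger_lower_bound d0) auto
  moreover have "e * (r2\<^sup>2 - r1\<^sup>2) = (r2\<^sup>2 - r1\<^sup>2) / 4 - \<Omega> / 2 * r2\<^sup>2 + \<Omega> / 2 * r1\<^sup>2"
    by (simp add: e_def field_simps)
  ultimately show ?thesis using psi_y by linarith
qed

theorem radius_ratio_neq:
  assumes m: "10^7 \<le> m"
  shows "R2 \<noteq> R1 * exp (3400 / m)"
proof
  assume R2: "R2 = R1 * exp (3400 / m)"
  define \<eta> where "\<eta> = 100 / real m"
  have mr: "10^7 \<le> real m" using m by (metis of_nat_le_iff of_nat_numeral of_nat_power)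
  then have \<eta>: "0 < \<eta>" "\<eta> \<le> 1 / 10^5"
    using m_pos by (auto simp: \<eta>_def field_simps)
  have m\<eta>: "1 / real m = \<eta> / 100" "real m * \<eta> = 100" using m_pos by (simp_all add: \<eta>_def)
  have R2': "R2 = R1 * exp (34 * \<eta>)" by (simp add: R2 \<eta>_def)
  define T where "T = (R1 / (R1 * exp \<eta>)) ^ (m div 4)"
  have "T = exp (- (\<eta> * real (m div 4)))"
  proof -
    have "R1 / (R1 * exp \<eta>) = exp (- \<eta>)" using R1_pos by (simp add: exp_minus divide_inverse)
    then show ?thesis by (simp add: T_def exp_of_nat_mult[symmetric] mult.commute)
  qed
  also have "\<dots> \<le> exp (- 24)"
  proof -
    \<comment> \<open>Rounding costs at most one unit of the exponent, so the total stays at least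
      25 - \<eta>.\<close>
    have "real m / 4 - 1 \<le> real (m div 4)" by linarith
    then have "\<eta> * (real m / 4 - 1) \<le> \<eta> * real (m div 4)" using \<eta> by (intro mult_left_mono) auto
    then have "24 \<le> \<eta> * real (m div 4)" using m\<eta> \<eta> by (simp add: algebra_simps)
    then show ?thesis by simp
  qed
  also have "\<dots> \<le> 1 / 1000"
  proof -
    have "(1000::real) \<le> 2 ^ 24" by simp
    also have "\<dots> \<le> exp 1 ^ 24" using exp_ge_add_one_self[of 1] by (intro power_mono) auto
    also have "\<dots> = exp 24" by (simp flip: exp_of_nat_mult)
    finally show ?thesis by (simp add: exp_minus field_simps)
  qed
  finally have T: "T \<le> 1 / 1000" .
  have lne: "ln (R1 * exp a / (R1 * exp b)) = a - b" for a b
    using R1_pos by (simp add: exp_diff[symmetric])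
  have ineq: "R1 * exp a < R1 * exp b \<longleftrightarrow> a < b" "R1 * exp a \<le> R1 * exp b \<longleftrightarrow> a \<le> b"
     "R1 < R1 * exp b \<longleftrightarrow> 0 < b" "R1 \<le> R1 * exp b \<longleftrightarrow> 0 \<le> b" for a b
    using R1_pos by simp_all
  show False
  proof (rule incompatible_growth_bounds[OF R1_pos e_pos _ \<eta> _ T])
    let ?\<nu> = "outside_measure (R1 * exp (2 * \<eta>)) / (2 * pi)"
    show "0 \<le> ?\<nu>" by (simp add: outside_measure_def)
    show "0 \<le> T" using R1_pos by (simp add: T_def)
    show "?\<nu> * (16 * \<eta>) * (((R1 * exp (18 * \<eta>))\<^sup>2 - (R1 * exp (2 * \<eta>))\<^sup>2) / 2) \<le> e * ((R1 * exp (34 * \<eta>))\<^sup>2 - R1\<^sup>2)"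
      using tip_inequality[of "R1 * exp (2 * \<eta>)" "R1 * exp (18 * \<eta>)"] \<eta> unfolding R2' ineq lne by simp
    have "(R2 - R1) + R1 * (pi / m) \<le> (R1 * exp (34 * \<eta>) - R1) + R1 * (pi * \<eta> / 100)"
      using m_pos by (simp add: R2' \<eta>_def)
    from root_inequality[OF _ _ _ _ this, of "R1 * exp \<eta>" "R1 * exp (2 * \<eta>)"]
    have "e * ((R1 * exp (2 * \<eta>))\<^sup>2 - (R1 * exp \<eta>)\<^sup>2) - ?\<nu> * \<eta> * (((R1 * exp (2 * \<eta>))\<^sup>2 - R1\<^sup>2) / 2)
      \<le> 48 * ?\<nu> * (R1 * exp (34 * \<eta>))\<^sup>2 / m\<^sup>2
        + 2 * e * ((R1 * exp (34 * \<eta>) - R1) + R1 * (pi * \<eta> / 100))\<^sup>2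
        + 2 * e * ((R1 * exp (34 * \<eta>))\<^sup>2 - R1\<^sup>2) * sqrt 2 * T"
      using \<eta> unfolding R2' ineq lne T_def by simp
    moreover have "48 * ?\<nu> * (R1 * exp (34 * \<eta>))\<^sup>2 / m\<^sup>2 = 48 * ?\<nu> * (R1 * exp (34 * \<eta>))\<^sup>2 * (\<eta> / 100)\<^sup>2"
      unfolding m\<eta>(1)[symmetric] by (simp add: power_divide)
    ultimately show "e * ((R1 * exp (2 * \<eta>))\<^sup>2 - (R1 * exp \<eta>)\<^sup>2) - ?\<nu> * \<eta> * (((R1 * exp (2 * \<eta>))\<^sup>2 - R1\<^sup>2) / 2)
      \<le> 48 * ?\<nu> * (R1 * exp (34 * \<eta>))\<^sup>2 * (\<eta> / 100)\<^sup>2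
        + 2 * e * ((R1 * exp (34 * \<eta>) - R1) + R1 * (pi * \<eta> / 100))\<^sup>2
        + 2 * e * ((R1 * exp (34 * \<eta>))\<^sup>2 - R1\<^sup>2) * sqrt 2 * T" by simp
  qed
qed

end

section \<open>Cosine series without constant term\<close>

lemma sum_by_parts:
  fixes c w :: "nat \<Rightarrow> real"
  shows "(\<Sum>n<K. c n * w n) = (\<Sum>i<K. c i) * w K + (\<Sum>n<K. (\<Sum>i<Suc n. c i) * (w n - w (Suc n)))"
  by (induction K) (simp_all add: algebra_simps)

text \<open>Abel summation averages the partial sums \<open>T\<close> with the decrements of the
  weights. Beyond \<open>N\<close> they exceed S/2; the earlier ones are bounded by \<open>B\<close>
  and carry total weight at most \<open>1 - w h N\<close>, which tends to 0 with
  \<open>h\<close>.\<close>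

lemma regularized_series_pos:
  fixes c :: "nat \<Rightarrow> real"
  assumes c: "c sums S" and S: "0 < S"
  obtains h where "0 < h" "0 < (\<Sum>n. c n / (1 + (real (Suc n))\<^sup>2 * h\<^sup>2))"
proof -
  define T where "T n = (\<Sum>i<n. c i)" for n
  have T: "T \<longlonglongrightarrow> S" using c by (simp add: sums_def T_def[abs_def])
  then obtain N where N: "\<And>n. N \<le> n \<Longrightarrow> S / 2 < T n"
    using order_tendstoD(1)[OF T, of "S / 2"] S by (auto simp: eventually_sequentially)
  obtain B where B: "0 < B" "\<And>n. \<bar>T n\<bar> \<le> B"
    using convergent_imp_Bseq[of T] T by (auto simp: convergent_def Bseq_def)
  define w where "w h n = 1 / (1 + (real (Suc n))\<^sup>2 * h\<^sup>2)" for h :: real and n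
  have "((\<lambda>h. - B * (1 - w h N) + S / 2 * w h N) \<longlongrightarrow> - B * (1 - 1 / (1 + (real (Suc N))\<^sup>2 * 0\<^sup>2)) + S / 2 * (1 / (1 + (real (Suc N))\<^sup>2 * 0\<^sup>2))) (at_right 0)"
    unfolding w_def by (intro tendsto_intros) auto
  then have "\<forall>\<^sub>F h in at_right 0. 0 < - B * (1 - w h N) + S / 2 * w h N"
    using S by (intro order_tendstoD(1)[where y = "- B * (1 - 1 / (1 + (real (Suc N))\<^sup>2 * 0\<^sup>2)) + S / 2 * (1 / (1 + (real (Suc N))\<^sup>2 * 0\<^sup>2))"]) simp_all
  then have "\<forall>\<^sub>F h in at_right 0. 0 < h \<and> 0 < - B * (1 - w h N) + S / 2 * w h N"
    using eventually_at_right_less by (rule eventually_conj[rotated])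
  then obtain h where h: "0 < h" "0 < - B * (1 - w h N) + S / 2 * w h N"
    using eventually_happens[of _ "at_right (0::real)"] by (auto simp: trivial_limit_at_right_real)
  have w_pos: "0 < w h n" and w_le1: "w h n \<le> 1" for n
    by (auto simp: w_def add_pos_nonneg)
  have w_dec: "w h (Suc n) \<le> w h n" for n
    unfolding w_def by (intro divide_left_mono add_left_mono mult_right_mono power_mono mult_pos_pos add_pos_nonneg) auto
  have lower: "- B * (1 - w h N) + S / 2 * w h N \<le> (\<Sum>n<K. c n * w h n)" if K: "N < K" for K
  proof -
    have *: "(\<Sum>n<j. T (Suc n) * (w h n - w h (Suc n))) \<ge> - B * (w h 0 - w h j)" for j
    proof (induction j)
      case (Suc j)
      have "- B * (w h j - w h (Suc j)) \<le> T (Suc j) * (w h j - w h (Suc j))"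
        using B(2)[of "Suc j"] w_dec[of j] by (intro mult_right_mono) auto
      then show ?case using Suc by (simp add: algebra_simps)
    qed simp
    have **: "(\<Sum>n<N + j. T (Suc n) * (w h n - w h (Suc n)))
      \<ge> - B * (w h 0 - w h N) + S / 2 * (w h N - w h (N + j))" for j
    proof (induction j)
      case 0
      show ?case using *[of N] by simp
    next
      case (Suc j)
      have "S / 2 * (w h (N + j) - w h (Suc (N + j))) \<le> T (Suc (N + j)) * (w h (N + j) - w h (Suc (N + j)))"
        using N[of "Suc (N + j)"] w_dec[of "N + j"] by (intro mult_right_mono) auto
      then show ?case using Suc by (simp add: algebra_simps)
    qed
    have "S / 2 * w h K \<le> T K * w h K"
      using N[of K] K w_pos[of K] by (intro mult_right_mono) auto
    moreover have "- B * (w h 0 - w h N) + S / 2 * (w h N - w h K) \<le> (\<Sum>n<K. T (Suc n) * (w h n - w h (Suc n)))"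
      using **[of "K - N"] K by simp
    moreover have "- B * (1 - w h N) \<le> - B * (w h 0 - w h N)"
      using B(1) w_le1[of 0] by simp
    moreover have "(\<Sum>n<K. c n * w h n) = T K * w h K + (\<Sum>n<K. T (Suc n) * (w h n - w h (Suc n)))"
      unfolding T_def by (rule sum_by_parts)
    moreover have "S / 2 * (w h N - w h K) = S / 2 * w h N - S / 2 * w h K" by (rule right_diff_distrib)
    ultimately show ?thesis by linarith
  qed
  have "summable (\<lambda>n. c n * w h n)"
  proof -
    have "Bseq c" using c by (intro convergent_imp_Bseq) (meson convergent_def summable_LIMSEQ_zero sums_summable)
    then obtain b where b: "0 < b" "\<And>n. \<bar>c n\<bar> \<le> b" by (auto simp: Bseq_def)
    have "summable (\<lambda>n. b / h\<^sup>2 * (1 / (real n + 1)\<^sup>2))"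
      using inverse_squares_sums by (intro summable_mult) (auto dest: sums_summable simp: add.commute)
    moreover have "norm (c n * w h n) \<le> b / h\<^sup>2 * (1 / (real n + 1)\<^sup>2)" for n
    proof -
      have "norm (c n * w h n) \<le> b * w h n"
        using b(2)[of n] w_pos[of n] by (auto simp: abs_mult intro: mult_right_mono)
      also have "\<dots> \<le> b * (1 / ((real (Suc n))\<^sup>2 * h\<^sup>2))"
        unfolding w_def using b h by (intro mult_left_mono divide_left_mono) (auto intro!: mult_pos_pos add_pos_pos)
      finally show ?thesis by (simp add: field_simps)
    qed
    ultimately show ?thesis by (rule summable_comparison_test'[where N = 0])
  qed
  then have "(\<lambda>K. \<Sum>n<K. c n * w h n) \<longlonglongrightarrow> (\<Sum>n. c n * w h n)"
    by (rule summable_LIMSEQ)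
  then have "- B * (1 - w h N) + S / 2 * w h N \<le> (\<Sum>n. c n * w h n)"
    by (rule Lim_bounded2[where N = "Suc N"]) (metis Suc_le_eq lower)
  then have "0 < (\<Sum>n. c n * w h n)" using h(2) by linarith
  then show thesis using that[OF h(1)] by (simp add: w_def)
qed

lemma second_derivative_at_max:
  fixes f f' :: "real \<Rightarrow> real"
  assumes f: "\<And>x. (f has_real_derivative f' x) (at x)" and f': "(f' has_real_derivative D) (at x)"
    and max: "\<And>y. f y \<le> f x"
  shows "D \<le> 0"
proof (rule ccontr)
  assume "\<not> D \<le> 0"
  have "f' x = 0"
    using DERIV_local_max[OF f zero_less_one] max by blast
  obtain d where d: "0 < d" "\<And>h. 0 < h \<Longrightarrow> h < d \<Longrightarrow> f' x < f' (x + h)"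
    using DERIV_pos_inc_right[OF f'] \<open>\<not> D \<le> 0\<close> by auto
  have "f x < f (x + d / 2)"
  proof (rule DERIV_pos_imp_increasing_open[where f = f])
    fix y assume "x < y" "y < x + d / 2"
    then have "0 < f' y" using d(2)[of "y - x"] \<open>f' x = 0\<close> d(1) by simp
    then show "\<exists>z. (f has_real_derivative z) (at y) \<and> 0 < z" using f by blast
  qed (use d DERIV_continuous_on[OF DERIV_subset[OF f]] in \<open>auto\<close>)
  then show False using max[of "x + d / 2"] by simp
qed

lemma periodic_attains_max:
  fixes f :: "real \<Rightarrow> real"
  assumes "continuous_on UNIV f" and per: "\<And>x. f (x + 2 * pi) = f x"
  obtains x0 where "\<And>y. f y \<le> f x0"
proof -
  have "continuous_on {0..2 * pi} f" using assms(1) continuous_on_subset by blast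
  then have "\<exists>x\<in>{0..2 * pi}. \<forall>y\<in>{0..2 * pi}. f y \<le> f x"
    by (intro continuous_attains_sup) auto
  then obtain x0 where x0: "\<And>y. y \<in> {0..2 * pi} \<Longrightarrow> f y \<le> f x0" by blast
  have shift: "f (y + of_int k * (2 * pi)) = f y" for y and k :: int
  proof (induction k rule: int_induct[where k = 0])
    case (step1 i)
    then show ?case using per[of "y + of_int i * (2 * pi)"] by (simp add: algebra_simps)
  next
    case (step2 i)
    then show ?case using per[of "y + of_int (i - 1) * (2 * pi)"] by (simp add: algebra_simps)
  qed simp
  have "f y \<le> f x0" for y
  proof -
    define k where "k = \<lfloor>y / (2 * pi)\<rfloor>"
    have "of_int k \<le> y / (2 * pi)" "y / (2 * pi) < of_int k + 1"
      unfolding k_def by linarith+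
    then have "y + of_int (- k) * (2 * pi) \<in> {0..2 * pi}" by (simp add: field_simps)
    then have "f (y + of_int (- k) * (2 * pi)) \<le> f x0" by (rule x0)
    then show ?thesis by (simp only: shift)
  qed
  then show thesis by (rule that)
qed

text \<open>Riemann's argument with the resolvent in place of second differences: let
  \<open>F = - (\<Sum>n. b_n cos (n x) / n^2)\<close> and let \<open>f\<close> solve \<open>f - h^2 f'' = F\<close>. At a maximum \<open>x0\<close> of \<open>F\<close> the maximum
  principle gives \<open>h^2 f'' x0 = f x0 - F x0 \<le> 0\<close>, and \<open>f'' x0\<close> is a regularization of the given series
  with weights \<open>1 / (1 + n^2 h^2)\<close>.\<close>

lemma cosine_series_nonpos:
  fixes b :: "nat \<Rightarrow> real"
  assumes sums: "\<And>x. (\<lambda>n. b n * cos (real (Suc n) * x)) sums u x"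
  shows "\<exists>x. u x \<le> 0"
proof -
  have "b \<longlonglongrightarrow> 0"
    using summable_LIMSEQ_zero[OF sums_summable[OF sums[of 0]]] by simp
  then obtain B where B: "0 < B" "\<And>n. \<bar>b n\<bar> \<le> B"
    using convergent_imp_Bseq[of b] by (auto simp: convergent_def Bseq_def)
  have sq_summable: "summable (\<lambda>n. K * (1 / (real (Suc n))\<^sup>2))" for K :: real
    using inverse_squares_sums by (intro summable_mult) (auto dest: sums_summable simp: add.commute)
  define k where "k n = real (Suc n)" for n
  have k: "1 \<le> k n" for n by (simp add: k_def)
  have k_summable: "summable (\<lambda>n. K / (k n)\<^sup>2)" for K
    using sq_summable[of K] by (simp add: k_def)
  define F where "F x = (\<Sum>n. - b n * cos (k n * x) / (k n)\<^sup>2)" for x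
  have bcos: "\<bar>b n * cos y\<bar> \<le> B" "\<bar>b n * sin y\<bar> \<le> B" for n y
    unfolding abs_mult using B(2)[of n] mult_mono[OF B(2)[of n] abs_cos_le_one[of y]] mult_mono[OF B(2)[of n] abs_sin_le_one[of y]] by auto
  have F_term: "norm (- b n * cos (k n * x) / (k n)\<^sup>2) \<le> B / (k n)\<^sup>2" for n x
    using bcos(1)[of n "k n * x"] k[of n] by (auto simp: divide_right_mono)
  have F_summable: "summable (\<lambda>n. - b n * cos (k n * x) / (k n)\<^sup>2)" for x
    by (rule summable_comparison_test'[where N = 0, OF k_summable F_term])
  have "uniform_limit UNIV (\<lambda>N x. \<Sum>n<N. - b n * cos (k n * x) / (k n)\<^sup>2) F sequentially"
    unfolding F_def[abs_def] by (rule Weierstrass_m_test[OF F_term k_summable])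
  then have F_cont: "continuous_on UNIV F"
    by (rule uniform_limit_theorem[rotated]) (auto intro!: always_eventually continuous_intros simp: k_def)
  have cos_per: "cos (k n * (x + 2 * pi)) = cos (k n * x)" for n x
  proof -
    have "k n * (x + 2 * pi) = k n * x + 2 * real (Suc n) * pi" by (simp add: k_def algebra_simps)
    then show ?thesis using cos_2npi[of "Suc n"] sin_2npi[of "Suc n"] by (simp add: cos_add)
  qed
  have "F (x + 2 * pi) = F x" for x by (simp add: F_def cos_per)
  then obtain x0 where x0: "\<And>y. F y \<le> F x0"
    using periodic_attains_max[OF F_cont] by blast
  have reg: "(\<Sum>n. b n * cos (k n * x0) / (1 + (k n)\<^sup>2 * h\<^sup>2)) \<le> 0" if h: "0 < h" for h
  proof -
    define q where "q n = 1 + (k n)\<^sup>2 * h\<^sup>2" for n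
    have q: "(k n)\<^sup>2 * h\<^sup>2 < q n" "1 < q n" for n using k[of n] h by (auto simp: q_def)
    have q_inv: "1 / q n \<le> 1 / h\<^sup>2 / (k n)\<^sup>2" for n
      using q[of n] k[of n] h by (auto simp: field_simps)
    let ?f = "\<lambda>n x. - b n * cos (k n * x) / ((k n)\<^sup>2 * q n)" and ?f1 = "\<lambda>n x. b n * sin (k n * x) / (k n * q n)" and ?f2 = "\<lambda>n x. b n * cos (k n * x) / q n"
    define f f1 f2 where "f x = (\<Sum>n. ?f n x)"
      and "f1 x = (\<Sum>n. ?f1 n x)"
      and "f2 x = (\<Sum>n. ?f2 n x)" for x
    have le: "y / q n \<le> B / h\<^sup>2 / (k n)\<^sup>2" if "0 \<le> y" "y \<le> B" for y n
    proof -
      have "y * (1 / q n) \<le> B * (1 / h\<^sup>2 / (k n)\<^sup>2)"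
        using that q[of n] by (intro mult_mono q_inv) auto
      then show ?thesis by simp
    qed
    have t2: "norm (?f2 n x) \<le> B / h\<^sup>2 / (k n)\<^sup>2" for n x
      using le[OF abs_ge_zero bcos(1)[of n "k n * x"], of n] q[of n] by (simp add: abs_divide)
    have t1: "norm (?f1 n x) \<le> B / h\<^sup>2 / (k n)\<^sup>2" for n x
    proof -
      have "\<bar>b n * sin (k n * x) / k n\<bar> \<le> \<bar>b n * sin (k n * x)\<bar> / 1"
        unfolding abs_divide using k[of n] by (intro divide_left_mono) auto
      then have "\<bar>b n * sin (k n * x) / k n\<bar> \<le> B" using bcos(2)[of n "k n * x"] by simp
      from le[OF abs_ge_zero this, of n] show ?thesis using q[of n] k[of n] by (simp add: abs_mult abs_divide)
    qed
    have t0: "summable (\<lambda>n. ?f n x)" for x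
    proof (rule summable_comparison_test'[where N = 0, OF k_summable])
      fix n
      have "norm (?f n x) = norm (- b n * cos (k n * x) / (k n)\<^sup>2) / q n"
        using q[of n] by (simp add: abs_mult abs_divide)
      also have "\<dots> \<le> B / (k n)\<^sup>2 / 1"
        using q[of n] F_term[of n x] B(1) by (intro frac_le) auto
      finally show "norm (?f n x) \<le> B / (k n)\<^sup>2" by simp
    qed
    have s2: "summable (\<lambda>n. ?f2 n x)" for x
      by (rule summable_comparison_test'[where N = 0, OF k_summable t2])
    have s1: "summable (\<lambda>n. ?f1 n x)" for x
      by (rule summable_comparison_test'[where N = 0, OF k_summable t1])
    have d1: "(f has_real_derivative f1 x) (at x)" for x
      unfolding f_def[abs_def] f1_def
    proof (rule has_field_derivative_series'(2)[where S = UNIV and ?x0.0 = 0])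
      show "((\<lambda>x. ?f n x) has_real_derivative ?f1 n x) (at x within UNIV)" for n x
        using k[of n] q[of n] by (auto intro!: derivative_eq_intros simp: power2_eq_square field_simps)
      show "uniformly_convergent_on UNIV (\<lambda>N x. \<Sum>n<N. ?f1 n x)"
        by (rule Weierstrass_m_test'[OF t1 k_summable])
      show "summable (\<lambda>n. - b n * cos (k n * 0) / ((k n)\<^sup>2 * q n))" by (rule t0)
    qed auto
    have d2: "(f1 has_real_derivative f2 x) (at x)" for x
      unfolding f1_def[abs_def] f2_def
    proof (rule has_field_derivative_series'(2)[where S = UNIV and ?x0.0 = 0])
      show "((\<lambda>x. ?f1 n x) has_real_derivative ?f2 n x) (at x within UNIV)" for n x
        using k[of n] q[of n] by (auto intro!: derivative_eq_intros)
      show "uniformly_convergent_on UNIV (\<lambda>N x. \<Sum>n<N. ?f2 n x)"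
        by (rule Weierstrass_m_test'[OF t2 k_summable])
      show "summable (\<lambda>n. b n * sin (k n * 0) / (k n * q n))" by (rule s1)
    qed auto
    have eqn: "f x - h\<^sup>2 * f2 x = F x" for x
    proof -
      have "f x - h\<^sup>2 * f2 x = (\<Sum>n. ?f n x - h\<^sup>2 * (?f2 n x))"
        unfolding f_def f2_def suminf_mult[OF s2, symmetric] suminf_diff[OF t0 summable_mult[OF s2]] ..
      also have "\<dots> = F x"
        unfolding F_def
      proof (rule suminf_cong)
        fix n
        have "?f n x - h\<^sup>2 * (?f2 n x)
          = - b n * cos (k n * x) * (1 + (k n)\<^sup>2 * h\<^sup>2) / ((k n)\<^sup>2 * q n)"
          using k[of n] q[of n] by (simp add: field_simps)
        also have "\<dots> = - b n * cos (k n * x) / (k n)\<^sup>2"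
          using q[of n] unfolding q_def[symmetric] by simp
        finally show "?f n x - h\<^sup>2 * (?f2 n x) = - b n * cos (k n * x) / (k n)\<^sup>2" .
      qed
      finally show ?thesis .
    qed
    have "continuous_on UNIV f" using d1 by (intro DERIV_continuous_on) auto
    moreover have "f (x + 2 * pi) = f x" for x by (simp add: f_def cos_per)
    ultimately obtain x1 where x1: "\<And>y. f y \<le> f x1"
      using periodic_attains_max by blast
    have "f2 x1 \<le> 0" by (rule second_derivative_at_max[OF d1 d2 x1])
    then have "h\<^sup>2 * f2 x1 \<le> 0" by (simp add: mult_nonneg_nonpos)
    then have "h\<^sup>2 * f2 x0 \<le> 0"
      using eqn[of x0] eqn[of x1] x1[of x0] x0[of x1] by linarith
    then show ?thesis using h by (simp add: f2_def q_def mult_le_0_iff)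
  qed
  have "\<not> 0 < u x0"
  proof
    assume "0 < u x0"
    then obtain h where "0 < h" "0 < (\<Sum>n. b n * cos (real (Suc n) * x0) / (1 + (real (Suc n))\<^sup>2 * h\<^sup>2))"
      by (rule regularized_series_pos[OF sums])
    then show False using reg[of h] by (simp add: k_def)
  qed
  then show ?thesis by (intro exI[of _ x0]) simp
qed

text \<open>The series is known to converge only pointwise, so it cannot be integrated term by term
  to show that the mean of \<open>u\<close> is 0. Instead neither \<open>u\<close> nor its negative
  is positive everywhere.\<close>

lemma cosine_series_zero:
  fixes b :: "nat \<Rightarrow> real"
  assumes sums: "\<And>x. (\<lambda>n. b n * cos (real (Suc n) * x)) sums u x" and cont: "continuous_on UNIV u"
  shows "\<exists>x. u x = 0"
proof -
  obtain x where x: "u x \<le> 0" using cosine_series_nonpos[OF sums] by blast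
  have "\<exists>x. - u x \<le> 0"
    using sums_minus[OF sums] by (intro cosine_series_nonpos[of "\<lambda>n. - b n"]) simp
  then obtain y where y: "0 \<le> u y" by auto
  have "connected (range u)" using cont by (intro connected_continuous_image) auto
  then have "0 \<in> range u"
    using x y by (auto intro: connectedD_interval)
  then show ?thesis by (metis imageE)
qed

section \<open>Curves of patches\<close>

lemma periodic_deriv:
  fixes f :: "real \<Rightarrow> real"
  assumes "\<And>x. f (x + p) = f x"
  shows "deriv f (x + p) = deriv f x"
proof -
  have "(\<lambda>x. f (x + p)) = f" using assms by auto
  then have "(f has_real_derivative D) (at (x + p)) \<longleftrightarrow> (f has_real_derivative D) (at x)" for D
    using DERIV_shift[of f D x p] by simp
  then show ?thesis by (simp add: deriv_def)
qed

lemma periodic_bdd_above: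
  fixes f :: "real \<Rightarrow> real"
  assumes "continuous_on UNIV f" "\<And>x. f (x + 2 * pi) = f x"
  shows "bdd_above (range (\<lambda>x. \<bar>f x\<bar>))"
proof -
  have "continuous_on UNIV (\<lambda>x. \<bar>f x\<bar>)" using assms(1) by (intro continuous_intros)
  then obtain x0 where "\<And>y. \<bar>f y\<bar> \<le> \<bar>f x0\<bar>"
    using periodic_attains_max[of "\<lambda>x. \<bar>f x\<bar>"] assms(2) by auto
  then show ?thesis by (intro bdd_aboveI2)
qed

lemma C2_torus_derivs:
  assumes "u \<in> C2_torus"
  shows "(u has_real_derivative deriv u x) (at x)" "(deriv u has_real_derivative deriv (deriv u) x) (at x)"
    and "continuous_on UNIV u" "continuous_on UNIV (deriv u)" "continuous_on UNIV (deriv (deriv u))"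
    and "u (x + 2 * pi) = u x"
proof -
  have 1: "(u has_real_derivative deriv u x) (at x)" "(deriv u has_real_derivative deriv (deriv u) x) (at x)" for x
    using assms by (auto simp: C2_torus_def DERIV_deriv_iff_real_differentiable)
  show "(u has_real_derivative deriv u x) (at x)" "(deriv u has_real_derivative deriv (deriv u) x) (at x)"
    by (rule 1)+
  show "continuous_on UNIV u" "continuous_on UNIV (deriv u)"
    using 1 by (auto intro!: DERIV_continuous_on)
  show "continuous_on UNIV (deriv (deriv u))" "u (x + 2 * pi) = u x"
    using assms by (auto simp: C2_torus_def)
qed

lemma C2_torus_diff:
  assumes u: "u \<in> C2_torus" and v: "v \<in> C2_torus"
  shows "(\<lambda>x. u x - v x) \<in> C2_torus"
proof -
  note U = C2_torus_derivs[OF u] and V = C2_torus_derivs[OF v]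
  have d: "deriv (\<lambda>x. u x - v x) = (\<lambda>x. deriv u x - deriv v x)"
    by (rule ext, rule DERIV_imp_deriv) (intro DERIV_diff U V)
  have dd: "deriv (\<lambda>x. deriv u x - deriv v x) = (\<lambda>x. deriv (deriv u) x - deriv (deriv v) x)"
    by (rule ext, rule DERIV_imp_deriv) (intro DERIV_diff U V)
  show ?thesis
    unfolding C2_torus_def mem_Collect_eq d dd
  proof (intro conjI allI)
    fix x
    show "(\<lambda>x. u x - v x) differentiable at x" "(\<lambda>x. deriv u x - deriv v x) differentiable at x"
      using DERIV_diff[OF U(1) V(1)] DERIV_diff[OF U(2) V(2)] unfolding real_differentiable_def by blast+
  qed (use U V in \<open>auto intro!: continuous_on_diff\<close>)
qed

lemma abs_le_C2_norm:
  assumes "u \<in> C2_torus"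
  shows "\<bar>u x\<bar> \<le> C2_norm u"
proof -
  note U = C2_torus_derivs[OF assms]
  have p1: "deriv u (x + 2 * pi) = deriv u x" for x by (rule periodic_deriv) (rule U(6))
  have p2: "deriv (deriv u) (x + 2 * pi) = deriv (deriv u) x" for x by (rule periodic_deriv) (rule p1)
  have "\<bar>u x\<bar> \<le> (SUP \<theta>. \<bar>u \<theta>\<bar>)"
    by (intro cSUP_upper periodic_bdd_above U) auto
  moreover have "0 \<le> (SUP \<theta>. \<bar>deriv u \<theta>\<bar>)"
    by (rule order_trans[OF abs_ge_zero cSUP_upper[of 0]]) (auto intro!: periodic_bdd_above U p1)
  moreover have "0 \<le> (SUP \<theta>. \<bar>deriv (deriv u) \<theta>\<bar>)"
    by (rule order_trans[OF abs_ge_zero cSUP_upper[of 0]]) (auto intro!: periodic_bdd_above U p2)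
  ultimately show ?thesis by (simp add: C2_norm_def)
qed

text \<open>The continuity argument along the curve looks only at the values for the angles 0 and
  pi/m.\<close>

lemma C2_continuous_on_imp_pointwise:
  assumes U: "\<And>s. s \<in> S \<Longrightarrow> U s \<in> C2_torus" and cont: "C2_continuous_on S U"
  shows "continuous_on S (\<lambda>s. U s \<theta>)"
  unfolding continuous_on_def
proof
  fix s assume s: "s \<in> S"
  have "((\<lambda>t. U t \<theta> - U s \<theta>) \<longlongrightarrow> 0) (at s within S)"
  proof (rule Lim_null_comparison)
    show "((\<lambda>t. C2_norm (\<lambda>\<theta>. U t \<theta> - U s \<theta>)) \<longlongrightarrow> 0) (at s within S)"
      using cont s by (auto simp: C2_continuous_on_def)
    show "\<forall>\<^sub>F t in at s within S. norm (U t \<theta> - U s \<theta>) \<le> C2_norm (\<lambda>\<theta>. U t \<theta> - U s \<theta>)"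
      using abs_le_C2_norm[OF C2_torus_diff[OF U U[OF s]], of _ \<theta>]
      by (auto simp: eventually_at_filter)
  qed
  then show "((\<lambda>s. U s \<theta>) \<longlongrightarrow> U s \<theta>) (at s within S)"
    by (rule LIM_zero_cancel)
qed

text \<open>The cosine of a multiple angle is a polynomial in the cosine; the induction is
  Chebyshev's recursion.\<close>

lemma cos_mult_eq:
  assumes "cos x = cos (y :: real)"
  shows "cos (real n * x) = cos (real n * y)"
proof (induction n rule: less_induct)
  case (less n)
  show ?case
  proof (cases "n < 2")
    case True
    then have "n = 0 \<or> n = 1" by auto
    then show ?thesis using assms by auto
  next
    case False
    then obtain j where n: "n = Suc (Suc j)" by (metis add_2_eq_Suc le_Suc_ex not_less)
    have rec: "cos (real n * z) = 2 * cos z * cos (real (Suc j) * z) - cos (real j * z)" for z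
    proof -
      have "real n * z = real (Suc j) * z + z" "real j * z = real (Suc j) * z - z"
        by (simp_all add: n algebra_simps)
      then show ?thesis by (simp only: cos_add cos_diff) (simp add: algebra_simps)
    qed
    show ?thesis
      unfolding rec using less.IH[of j] less.IH[of "Suc j"] assms by (simp add: n)
  qed
qed

lemma norm_vec_of_complex [simp]: "norm (vec_of_complex z) = cmod z"
  by (simp add: vec_of_complex_def norm_vec_def L2_set_def UNIV_2 cmod_def)

lemma vec_of_complex_diff: "vec_of_complex x - vec_of_complex y = vec_of_complex (x - y)"
  by (simp add: vec_of_complex_def vec_eq_iff forall_2)

lemma continuous_on_vec_of_complex: "continuous_on A vec_of_complex"
  unfolding vec_of_complex_eq_axis[abs_def] by (intro continuous_intros)

section \<open>From the polar description to a star-shaped patch\<close>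

locale symmetric_patch =
  fixes m :: nat and u :: "real \<Rightarrow> real" and \<Omega> :: real
  assumes m_ge: "4 \<le> m" and adm: "u \<in> admissible m"
    and dec: "\<And>\<theta>. \<theta> \<in> {0<..<pi / real m} \<Longrightarrow> deriv u \<theta> < 0"
    and \<Omega>: "\<Omega> \<in> {0<..<1/2}" and patch: "rotating_patch (polar_domain u) \<Omega>"
begin

text \<open>The radius as a function of the cosine of \<open>m * \<theta>\<close>. The clamp extends
  it to the whole line as a continuous monotone function, as \<open>star_patch\<close>
  demands.\<close>

definition profile :: "real \<Rightarrow> real" where
  "profile c = 1 + u (arccos (max (-1) (min 1 c)) / m)"

lemma u_C2: "u \<in> C2_torus" and u_gt: "- 1 < u \<theta>"
  using adm by (auto simp: admissible_def)

text \<open>Every term of the cosine series depends on \<open>cos (real m * \<theta>)\<close> alone,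
  which captures evenness and the period 2 pi / m together.\<close>

lemma u_even_symmetric:
  assumes "cos (real m * x) = cos (real m * y)"
  shows "u x = u y"
proof -
  obtain a :: "nat \<Rightarrow> real" where a: "\<And>\<theta>. (\<lambda>n. a (Suc n) * cos (real (Suc n) * real m * \<theta>)) sums u \<theta>"
    using adm by (auto simp: admissible_def)
  have "cos (real (Suc n) * real m * x) = cos (real (Suc n) * real m * y)" for n
    using cos_mult_eq[OF assms, of "Suc n"] by (simp only: mult.assoc)
  then show ?thesis using a[of x] a[of y] sums_unique2 by force
qed

lemma profile_cos: "profile (cos (real m * \<theta>)) = 1 + u \<theta>"
proof -
  have "cos (real m * (arccos (cos (real m * \<theta>)) / m)) = cos (real m * \<theta>)"
    using m_ge by simp
  then show ?thesis
    unfolding profile_def by (subst u_even_symmetric[of _ \<theta>]) auto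
qed

lemma u_zero: "\<exists>\<theta>. u \<theta> = 0"
proof -
  obtain a :: "nat \<Rightarrow> real" where a: "\<And>\<theta>. (\<lambda>n. a (Suc n) * cos (real (Suc n) * real m * \<theta>)) sums u \<theta>"
    using adm by (auto simp: admissible_def)
  have "(\<lambda>n. a (Suc n) * cos (real (Suc n) * x)) sums u (x / m)" for x
  proof -
    have "real (Suc n) * real m * (x / m) = real (Suc n) * x" for n using m_ge by simp
    then show ?thesis using a[of "x / m"] by (simp only:)
  qed
  moreover have "continuous_on UNIV (\<lambda>x. u (x / m))"
    using m_ge by (intro continuous_on_compose2[OF C2_torus_derivs(3)[OF u_C2]] continuous_intros) auto
  ultimately have "\<exists>x. u (x / m) = 0"
    by (rule cosine_series_zero[of "\<lambda>n. a (Suc n)" "\<lambda>x. u (x / m)"])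
  then show ?thesis by blast
qed

lemma u_strict_decreasing:
  assumes "0 \<le> x" "x < y" "y \<le> pi / m"
  shows "u y < u x"
proof (rule DERIV_neg_imp_decreasing_open[OF assms(2)])
  fix z assume "x < z" "z < y"
  then have "deriv u z < 0" using assms by (intro dec) auto
  then show "\<exists>D. (u has_real_derivative D) (at z) \<and> D < 0"
    using C2_torus_derivs(1)[OF u_C2] by blast
qed (use C2_torus_derivs(3)[OF u_C2] continuous_on_subset in blast)

lemma profile_strict:
  assumes "-1 \<le> c" "c < d" "d \<le> 1"
  shows "profile c < profile d"
proof -
  have m0: "0 < real m" using m_ge by simp
  have "arccos d < arccos c" using assms by (intro arccos_less_arccos) auto
  then have "arccos d / m < arccos c / m" using m0 by (intro divide_strict_right_mono)
  moreover have "0 \<le> arccos d / m" "arccos c / m \<le> pi / m"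
    using assms m0 arccos_lbound[of d] arccos_ubound[of c] by (auto intro!: divide_right_mono)
  ultimately show ?thesis
    using assms u_strict_decreasing by (simp add: profile_def)
qed

lemma profile_clamp: "profile c = profile (max (-1) (min 1 c))"
  by (simp add: profile_def)

lemma star_patch_profile: "star_patch m profile"
proof
  show "0 < m" using m_ge by simp
  have "continuous_on UNIV (\<lambda>c. arccos (max (-1) (min 1 c)))"
    by (intro continuous_on_compose2[OF continuous_on_arccos'] continuous_intros) auto
  then show "continuous_on UNIV profile"
    unfolding profile_def[abs_def] using m_ge
    by (intro continuous_intros continuous_on_compose2[OF C2_torus_derivs(3)[OF u_C2]]) auto
  show "strict_mono_on {- 1..1} profile"
    using profile_strict by (intro strict_mono_onI) auto
  show "mono profile"
  proof
    fix c d :: real assume "c \<le> d"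
    then have "max (-1) (min 1 c) \<le> max (-1) (min 1 d)" by auto
    then show "profile c \<le> profile d"
      using profile_strict[of "max (-1) (min 1 c)" "max (-1) (min 1 d)"] profile_clamp[of c] profile_clamp[of d]
      by (cases "max (-1) (min 1 c) = max (-1) (min 1 d)") (auto simp: less_le)
  qed
  show "0 < profile (- 1)"
    using u_gt[of "arccos (max (-1) (min 1 (-1))) / m"] by (simp add: profile_def)
qed

sublocale S: star_patch m profile
  by (rule star_patch_profile)

lemma polar_domain_eq: "polar_domain u = vec_of_complex ` S.D"
proof (intro set_eqI iffI)
  fix x assume "x \<in> polar_domain u"
  then obtain r \<theta> where x: "x = r *\<^sub>R vector [cos \<theta>, sin \<theta>]" and r: "0 \<le> r" "r < 1 + u \<theta>"
    by (auto simp: polar_domain_def)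
  have x': "x = vec_of_complex (of_real r * cis \<theta>)"
    by (simp add: x vec_of_complex_def vec_eq_iff forall_2)
  have "of_real r * cis \<theta> \<in> S.D"
  proof (cases "r = 0")
    case True
    then show ?thesis
      using S.ball_subset_D S.R1_pos by auto
  next
    case False
    then show ?thesis
      using S.polar_in_D[of r "cis \<theta>"] r by (simp add: Complex.DeMoivre profile_cos)
  qed
  then show "x \<in> vec_of_complex ` S.D" using x' by blast
next
  fix x assume "x \<in> vec_of_complex ` S.D"
  then obtain z where z: "z \<in> S.D" "x = vec_of_complex z" by blast
  have zz: "z = of_real (cmod z) * cis (Arg z)"
    using rcis_cmod_Arg[of z] by (simp add: rcis_def)
  have "cmod z < 1 + u (Arg z)"
  proof (cases "z = 0")
    case True
    then show ?thesis using u_gt[of "Arg z"] by simp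
  next
    case False
    then show ?thesis
      using S.polar_in_D[of "cmod z" "cis (Arg z)"] z(1) zz by (simp add: Complex.DeMoivre profile_cos)
  qed
  moreover have "x = cmod z *\<^sub>R vector [cos (Arg z), sin (Arg z)]"
    unfolding z(2) by (subst zz) (simp add: vec_of_complex_def vec_eq_iff forall_2 norm_mult)
  ultimately show "x \<in> polar_domain u"
    unfolding polar_domain_def mem_Collect_eq by (intro exI[of _ "cmod z"] exI[of _ "Arg z"]) simp
qed

lemma vimage_polar_domain: "vec_of_complex -` polar_domain u = S.D"
  by (auto simp: polar_domain_eq)

lemma open_polar_domain: "open (polar_domain u)"
  using patch by (simp add: rotating_patch_def)

lemma open_D: "open S.D"
  using open_vimage[OF open_polar_domain, of vec_of_complex] continuous_on_vec_of_complex
  by (simp add: vimage_polar_domain)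

lemma stream_eq: "stream (polar_domain u) \<Omega> (vec_of_complex x) = log_pot S.D x / (2 * pi) - \<Omega> / 2 * (cmod x)\<^sup>2"
proof -
  have [measurable]: "polar_domain u \<in> sets borel" using open_polar_domain by simp
  have "(LINT y|lborel. indicator (polar_domain u) y * newtonian (vec_of_complex x - y))
    = (LINT y|lborel. indicator (polar_domain u) (vec_of_complex y) * newtonian (vec_of_complex x - vec_of_complex y))"
    unfolding lborel_vec2_eq_distr_complex newtonian_def by (subst integral_distr) auto
  also have "\<dots> = (LINT y|lborel. indicator S.D y * ln (cmod (x - y)) / (2 * pi))"
    unfolding vec_of_complex_diff newtonian_def norm_vec_of_complex
    by (intro Bochner_Integration.integral_cong refl) (auto simp: indicator_def simp flip: vimage_polar_domain)
  also have "\<dots> = log_pot S.D x / (2 * pi)"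
    by (simp add: log_pot_def)
  finally show ?thesis by (simp add: stream_def)
qed

lemma frontier_D: "x \<in> frontier S.D \<Longrightarrow> vec_of_complex x \<in> frontier (polar_domain u)"
proof -
  assume x: "x \<in> frontier S.D"
  then have "x \<in> closure S.D" "x \<notin> S.D" using open_D by (auto simp: frontier_def interior_open)
  then have "vec_of_complex x \<in> closure (polar_domain u)"
    unfolding polar_domain_eq
    using image_closure_subset[OF continuous_on_vec_of_complex closed_closure closure_subset[of "vec_of_complex ` S.D"]] by blast
  moreover have "vec_of_complex x \<notin> polar_domain u"
    using \<open>x \<notin> S.D\<close> by (auto simp: polar_domain_eq)
  ultimately show ?thesis
    using open_polar_domain by (simp add: frontier_def interior_open)
qed

lemma rotating: "\<exists>C. rotating_star_patch m profile \<Omega> C"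
proof -
  obtain C where C: "\<And>x. x \<in> frontier (polar_domain u) \<Longrightarrow> stream (polar_domain u) \<Omega> x = C"
    using patch by (auto simp: rotating_patch_def constant_on_def)
  have "rotating_star_patch m profile \<Omega> C"
    using \<Omega> m_ge open_D C[OF frontier_D] stream_eq by unfold_locales auto
  then show ?thesis ..
qed

lemma R1_eq: "S.R1 = 1 + u (pi / m)" and R2_eq: "S.R2 = 1 + u 0"
  by (simp_all add: S.R1_def S.R2_def profile_def)

lemma ratio_neq:
  assumes "10^7 \<le> m"
  shows "1 + u 0 \<noteq> (1 + u (pi / m)) * exp (3400 / m)"
proof -
  obtain C where "rotating_star_patch m profile \<Omega> C" using rotating by blast
  then interpret rotating_star_patch m profile \<Omega> C .
  show ?thesis using radius_ratio_neq[OF assms] by (simp add: R1_eq R2_eq)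
qed

lemma u_bounds: "u (pi / m) \<le> u \<theta>" "u \<theta> \<le> u 0"
proof -
  have "profile (-1) \<le> profile (cos (real m * \<theta>))" "profile (cos (real m * \<theta>)) \<le> profile 1"
    by (intro monoD[OF S.s_mono]; simp)+
  then show "u (pi / m) \<le> u \<theta>" "u \<theta> \<le> u 0"
    unfolding profile_cos by (simp_all add: profile_def)
qed

text \<open>A zero of \<open>u\<close> places 1 between the two radii, so a bound on their ratio
  controls both. The factor 2 in 6800 = 2 * 3400 comes from
  \<open>exp x \<le> 1 + 2 * x\<close>.\<close>

lemma abs_u_le:
  assumes ratio: "1 + u 0 < (1 + u (pi / m)) * exp (3400 / m)" and m: "10^7 \<le> m"
  shows "\<bar>u \<theta>\<bar> \<le> 6800 / m"
proof -
  define x where "x = 3400 / real m"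
  have mr: "10^7 \<le> real m" using m by (metis of_nat_le_iff of_nat_numeral of_nat_power)
  then have x: "0 \<le> x" "x \<le> 1" using m_ge by (auto simp: x_def field_simps)
  have "exp x \<le> 1 + x + x\<^sup>2" by (rule exp_bound[OF x])
  also have "x\<^sup>2 \<le> x * 1" unfolding power2_eq_square using x by (intro mult_left_mono)
  finally have ex: "exp x \<le> 1 + 2 * x" by simp
  obtain \<theta>0 where \<theta>0: "u \<theta>0 = 0" using u_zero by blast
  have lo: "u (pi / m) \<le> 0" and hi: "0 \<le> u 0" using u_bounds[of \<theta>0] by (simp_all add: \<theta>0)
  have ratio': "1 + u 0 \<le> (1 + u (pi / m)) * exp x" using ratio by (simp add: x_def)
  also have "\<dots> \<le> 1 * exp x" using lo by (intro mult_right_mono) auto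
  finally have "u 0 \<le> 2 * x" using ex by simp
  moreover have "- u (pi / m) \<le> x"
  proof -
    have "1 \<le> (1 + u (pi / m)) * exp x" using ratio' hi by linarith
    then have "exp (- x) \<le> 1 + u (pi / m)" by (simp add: exp_minus field_simps)
    then show ?thesis using exp_ge_add_one_self[of "- x"] by linarith
  qed
  ultimately have "\<bar>u \<theta>\<bar> \<le> 2 * x"
    using u_bounds[of \<theta>] x by linarith
  then show ?thesis by (simp add: x_def)
qed

end

lemma Linfty_norm_le:
  assumes "continuous_on UNIV u" "\<And>\<theta>. \<bar>u \<theta>\<bar> \<le> c"
  shows "Linfty_norm u \<le> ereal c"
  unfolding Linfty_norm_def
proof (rule esssup_I)
  have "u \<in> borel_measurable lborel" using assms(1) by (simp add: borel_measurable_continuous_onI)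
  then have "u \<in> borel_measurable lebesgue" by (rule measurable_completion)
  then have "u \<in> borel_measurable (lebesgue_on {0..2 * pi})" by (rule measurable_restrict_space1)
  then show "(\<lambda>\<theta>. ereal \<bar>u \<theta>\<bar>) \<in> borel_measurable (lebesgue_on {0..2 * pi})" by simp
  show "AE \<theta> in lebesgue_on {0..2 * pi}. ereal \<bar>u \<theta>\<bar> \<le> ereal c"
    using assms(2) by simp
qed

theorem theorem1p4:
  shows "\<exists>c::real. \<exists>m\<^sub>0::nat. c > 0 \<and> m\<^sub>0 \<ge> 3 \<and>
    (\<forall>m::nat. m \<ge> m\<^sub>0 \<longrightarrow>
      (\<forall>(U :: real \<Rightarrow> real \<Rightarrow> real) (\<Omega> :: real \<Rightarrow> real).
        (\<forall>s\<ge>0. U s \<in> C2_torus) \<and>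
        (\<forall>s\<ge>0. \<Omega> s \<in> {0<..<1/2}) \<and>
        C2_continuous_on {0..} U \<and>
        continuous_on {0..} \<Omega> \<and>
        (\<forall>s\<ge>0. U s \<in> admissible m) \<and>
        (\<forall>s\<ge>0. rotating_patch (polar_domain (U s)) (\<Omega> s)) \<and>
        (\<forall>s>0. \<forall>\<theta>\<in>{0<..<pi / real m}. deriv (U s) \<theta> < 0) \<and>
        U 0 = (\<lambda>_. 0) \<and> \<Omega> 0 = (real m - 1) / (2 * real m)
        \<longrightarrow> (\<forall>s\<ge>0. Linfty_norm (U s) \<le> ereal (c / real m))))"
proof (intro exI[of _ "6800 :: real"] exI[of _ "10^7 :: nat"] conjI allI impI)
  fix m :: nat and U :: "real \<Rightarrow> real \<Rightarrow> real" and \<Omega> :: "real \<Rightarrow> real" and s :: real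
  assume m: "10^7 \<le> m" and s: "0 \<le> s"
    and H: "(\<forall>s\<ge>0. U s \<in> C2_torus) \<and>
        (\<forall>s\<ge>0. \<Omega> s \<in> {0<..<1/2}) \<and>
        C2_continuous_on {0..} U \<and>
        continuous_on {0..} \<Omega> \<and>
        (\<forall>s\<ge>0. U s \<in> admissible m) \<and>
        (\<forall>s\<ge>0. rotating_patch (polar_domain (U s)) (\<Omega> s)) \<and>
        (\<forall>s>0. \<forall>\<theta>\<in>{0<..<pi / real m}. deriv (U s) \<theta> < 0) \<and>
        U 0 = (\<lambda>_. 0) \<and> \<Omega> 0 = (real m - 1) / (2 * real m)"
  \<comment> \<open>Only positive parameters qualify: at 0 the patch is a disc and has no strictly
    decreasing profile.\<close>
  have sym_patch: "symmetric_patch m (U t) (\<Omega> t)" if "0 < t" for t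
    using that H m by unfold_locales auto
  have cont: "continuous_on {0..} (\<lambda>t. U t \<theta>)" for \<theta>
    using H by (intro C2_continuous_on_imp_pointwise) auto
  have "continuous_on UNIV (U s)"
    using H s C2_torus_derivs(3) by blast
  moreover have "\<bar>U s \<theta>\<bar> \<le> 6800 / real m" for \<theta>
  proof (cases "s = 0")
    case True
    then show ?thesis using H by simp
  next
    case False
    then interpret symmetric_patch m "U s" "\<Omega> s" using s by (intro sym_patch) simp
    \<comment> \<open>At parameter 0 this is \<open>exp (3400 / m) - 1\<close>, and a later zero
      would give exactly the excluded ratio of radii.\<close>
    define g where "g t = (1 + U t (pi / m)) * exp (3400 / m) - (1 + U t 0)" for t
    have g0: "0 < g 0" using H m by (simp add: g_def)
    have "0 < g s"
    proof (rule ccontr)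
      assume "\<not> 0 < g s"
      moreover have "continuous_on {0..s} g"
        unfolding g_def using cont by (intro continuous_intros continuous_on_subset[OF cont]) auto
      ultimately obtain t where t: "0 \<le> t" "t \<le> s" "g t = 0"
        using IVT2'[of g s 0 0] g0 s by auto
      then have "0 < t" using g0 by (cases "t = 0") auto
      then show False
        using symmetric_patch.ratio_neq[OF sym_patch m, of t] t(3) by (simp add: g_def)
    qed
    then show ?thesis by (intro abs_u_le m) (simp add: g_def)
  qed
  ultimately show "Linfty_norm (U s) \<le> ereal (6800 / real m)"
    by (rule Linfty_norm_le)
qed auto

end
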